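(* Let $n\ge 1$, $m\ge 1$, and let $f_1,\dots,f_n$ be non-constant entire functions on $\mathbb{C}^m$ satisfying $$T(r,f_i)=S(r,f_{i+1})\qquad\text{for } 1\le i\le n-1 .$$ Then for every transcendental meromorphic function $F$ on $\mathbb{C}$, $$\mathrm{tr.deg}_{\mathbb{C}}\,\mathbb{C}\big(f_1,\dots,f_n,F(f_1),\dots,F(f_n)\big)\ \ge\ n+1 .$$
   Context: Nevanlinna theory on $\mathbb{C}^m$: for a meromorphic function $f$ on $\mathbb{C}^m$, $m(r,f)$ is the proximity function (the average of $\log^+|f|$ over the sphere of radius $r$ with respect to the normalized invariant measure), $N(r,f)$ the integrated counting function of poles, and $T(r,f)=m(r,f)+N(r,f)$ the Nevanlinna characteristic. $S(r,f)$ denotes any quantity that is $o(T(r,f))$ as $r\to\infty$ outside a possible exceptional set of $r$ of finite linear measure. $F(f_i)$ denotes the composition $F\circ f_i$, a meromorphic function on $\mathbb{C}^m$. $\mathrm{tr.deg}_{\mathbb{C}}\,\mathbb{C}(g_1,\dots,g_k)$ is the transcendence degree over $\mathbb{C}$ of the field generated over $\mathbb{C}$ by the meromorphic functions $g_1,\dots,g_k$. *)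

theory Defs
  imports "HOL-Complex_Analysis.Complex_Analysis" "HOL-Computational_Algebra.Polynomial"
begin

definition hol_at_Cm :: "(complex ^ 'm \<Rightarrow> complex) \<Rightarrow> complex ^ 'm \<Rightarrow> bool" where
  "hol_at_Cm h z \<longleftrightarrow> (\<exists>U. open U \<and> z \<in> U \<and>
     (\<forall>w\<in>U. \<exists>D. (h has_derivative D) (at w) \<and> (\<forall>c v. D (c *s v) = c * D v)))"

definition entire_Cm :: "(complex ^ 'm \<Rightarrow> complex) \<Rightarrow> bool" where
  "entire_Cm h \<longleftrightarrow> (\<forall>z. hol_at_Cm h z)"

definition log_plus :: "real \<Rightarrow> real" where
  "log_plus t = (if t \<le> 1 then 0 else ln t)"

text \<open>Proximity function m(r,f): average of log^+|f| over the sphere of radius r with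
  respect to the normalized invariant measure. That measure is realised as the push-forward
  of normalized Lebesgue measure on the unit ball under the radial projection x \<mapsto> x/|x|.\<close>
definition proximity_Cm :: "(complex ^ 'm \<Rightarrow> complex) \<Rightarrow> real \<Rightarrow> real" where
  "proximity_Cm f r =
     (LINT x : ball 0 1 | lborel. log_plus (norm (f ((r / norm x) *\<^sub>R x))))
       / measure lborel (ball (0 :: complex ^ 'm) 1)"

text \<open>Nevanlinna characteristic of an entire function: T(r,f) = m(r,f) + N(r,f), and
  N(r,f) = 0 since an entire function has no poles.\<close>
definition nev_T_entire :: "(complex ^ 'm \<Rightarrow> complex) \<Rightarrow> real \<Rightarrow> real" where
  "nev_T_entire f r = proximity_Cm f r + 0"

definition small_outside :: "(real \<Rightarrow> real) \<Rightarrow> (real \<Rightarrow> real) \<Rightarrow> bool" where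
  "small_outside phi T \<longleftrightarrow> (\<exists>E. E \<in> sets lebesgue \<and> emeasure lebesgue E < \<infinity> \<and>
     (\<forall>\<epsilon>>0. \<exists>R. \<forall>r\<ge>R. r \<notin> E \<longrightarrow> \<bar>phi r\<bar> \<le> \<epsilon> * T r))"

definition transcendental_mero :: "(complex \<Rightarrow> complex) \<Rightarrow> bool" where
  "transcendental_mero F \<longleftrightarrow> F meromorphic_on UNIV \<and>
     \<not> (\<exists>p q :: complex poly. q \<noteq> 0 \<and> (\<forall>\<^sub>\<approx>z. F z = poly p z / poly q z))"

text \<open>Polynomials in k variables X_0..X_{k-1} over C, as finitely supported coefficient
  functions on exponent vectors (exponents vanish at indices \<ge> k).\<close>
definition mpoly_ok :: "nat \<Rightarrow> ((nat \<Rightarrow> nat) \<Rightarrow> complex) \<Rightarrow> bool" where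
  "mpoly_ok k c \<longleftrightarrow> finite {\<alpha>. c \<alpha> \<noteq> 0} \<and> (\<forall>\<alpha>. c \<alpha> \<noteq> 0 \<longrightarrow> (\<forall>i\<ge>k. \<alpha> i = 0))"

definition mpoly_eval :: "nat \<Rightarrow> ((nat \<Rightarrow> nat) \<Rightarrow> complex) \<Rightarrow> (nat \<Rightarrow> complex) \<Rightarrow> complex" where
  "mpoly_eval k c x = (\<Sum>\<alpha> \<in> {\<alpha>. c \<alpha> \<noteq> 0}. c \<alpha> * (\<Prod>i<k. x i ^ \<alpha> i))"

definition reg_dom :: "(nat \<Rightarrow> complex ^ 'm \<Rightarrow> complex) \<Rightarrow> nat \<Rightarrow> (complex ^ 'm) set" where
  "reg_dom g k = {z. \<forall>j<k. hol_at_Cm (g j) z}"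

text \<open>The elements h_l = P_l(g)/Q_l(g), l < N, of the field C(g_0,...,g_{k-1})
  (Q_l(g) not identically zero) are algebraically independent over C: no nonzero
  polynomial R in N variables has R(h_0,...,h_{N-1}) identically zero.\<close>
definition alg_indep_in_field ::
  "(nat \<Rightarrow> complex ^ 'm \<Rightarrow> complex) \<Rightarrow> nat \<Rightarrow> nat \<Rightarrow>
   (nat \<Rightarrow> (nat \<Rightarrow> nat) \<Rightarrow> complex) \<Rightarrow> (nat \<Rightarrow> (nat \<Rightarrow> nat) \<Rightarrow> complex) \<Rightarrow> bool" where
  "alg_indep_in_field g k N P Q \<longleftrightarrow>
     (\<forall>l<N. mpoly_ok k (P l) \<and> mpoly_ok k (Q l) \<and>
        (\<exists>z\<in>reg_dom g k. mpoly_eval k (Q l) (\<lambda>j. g j z) \<noteq> 0)) \<and>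
     (\<forall>R. mpoly_ok N R \<and> R \<noteq> (\<lambda>_. 0) \<longrightarrow>
        (\<exists>z\<in>reg_dom g k. (\<forall>l<N. mpoly_eval k (Q l) (\<lambda>j. g j z) \<noteq> 0) \<and>
           mpoly_eval N R (\<lambda>l. mpoly_eval k (P l) (\<lambda>j. g j z) / mpoly_eval k (Q l) (\<lambda>j. g j z)) \<noteq> 0))"

definition tr_deg :: "(nat \<Rightarrow> complex ^ 'm \<Rightarrow> complex) \<Rightarrow> nat \<Rightarrow> enat" where
  "tr_deg g k = Sup {enat N | N. \<exists>P Q. alg_indep_in_field g k N P Q}"

end

theory Submission
  imports Defs
begin

text \<open>
  The functions \<open>f\<^sub>1, \<dots>, f\<^sub>n, F(f\<^sub>n)\<close> are algebraically independent, because each grows faster than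
  any algebraic function of its predecessors.  Growth is compared through spherical means of
  \<open>ln (max |g| \<delta>)\<close>.  For entire \<open>g\<close> these means increase with the radius, by the maximum principle
  applied to products of rotated copies of \<open>g\<close>, and for \<open>g \<noteq> 0\<close> they are bounded below uniformly in
  \<open>\<delta>\<close>; this replaces Jensen's formula.

  For the last function, let \<open>\<Sum>\<^sub>j R\<^sub>j F(\<phi>)\<^sup>j = 0\<close> with \<open>\<phi> = f\<^sub>n\<close> and with each \<open>R\<^sub>j\<close> a polynomial in
  \<open>f\<^sub>1, \<dots>, f\<^sub>n\<close>.  By Casorati-Weierstrass at infinity there is, for every \<open>K\<close>, a disc of values \<open>a\<close> each
  with \<open>K\<close> preimages \<open>p\<^sub>1(a), \<dots>, p\<^sub>K(a)\<close> under \<open>F\<close> in fixed disjoint discs.  The function \<open>\<Sum>\<^sub>j R\<^sub>j a\<^sup>j\<close> is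
  divisible by \<open>\<Prod>\<^sub>k (\<phi> - p\<^sub>k(a))\<close> in the ring of entire functions, so the mean of \<open>\<Sum>\<^sub>k ln |\<phi> - p\<^sub>k(a)|\<close> is
  at most \<open>\<Sum>\<^sub>j T(r, R\<^sub>j) + O(1)\<close>.  Averaging over many values \<open>a\<close> turns each of the \<open>K\<close> summands into
  \<open>T(r, \<phi>) + O(1)\<close>.  Since \<open>\<Sum>\<^sub>j T(r, R\<^sub>j) \<le> D T(r, \<phi>) + O(1)\<close> with \<open>D\<close> independent of \<open>K\<close>, taking \<open>K > D\<close>
  bounds \<open>T(r, \<phi>)\<close>, and \<open>\<phi>\<close> is constant.
\<close>

section \<open>Averages over the unit ball\<close>

text \<open>A single value \<open>a\<close> would not do. If \<open>p\<close> is a deficient value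
  of \<open>\<phi>\<close>, the mean of \<open>ln |\<phi> - p|\<close> can fall far below
  \<open>T(r, \<phi>)\<close>, as for the exponential function and \<open>p = 0\<close>, and nothing
  prevents the points \<open>p\<^sub>k(a)\<close> from being deficient. The average over equally
  spaced values is immune to this, and its cost is bounded independently of \<open>r\<close>
  although the number of values grows with \<open>r\<close>. The truncation levels depend on
  \<open>r\<close> as well, which is why the lower bounds must be uniform in
  \<open>\<delta>\<close>.

  The independence of \<open>f\<^sub>1, \<dots>, f\<^sub>n\<close> alone is also an ingredient of
  the last step: it ensures that the \<open>R\<^sub>j\<close> do not all vanish identically.

  Exceptional sets of radii do no harm. The final bound on \<open>T(r, \<phi>)\<close> is needed
  only for some arbitrarily large \<open>r\<close>, since monotonicity spreads it to all radii, and
  then \<open>\<phi>\<close> is bounded and Liouville's theorem applies.\<close>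

lemma norm_smult_vec: "norm (c *s x) = norm c * norm (x :: complex ^ 'm)"
  by (simp add: norm_vec_def norm_mult L2_set_right_distrib)

lemma of_real_smult_vec: "complex_of_real r *s x = r *\<^sub>R (x :: complex ^ 'm)"
  by (simp add: vec_eq_iff scaleR_conv_of_real[where 'a = complex])

lemma continuous_on_smult_vec [continuous_intros]:
  fixes f :: "'a :: topological_space \<Rightarrow> complex" and g :: "'a \<Rightarrow> complex ^ 'm"
  assumes "continuous_on S f" "continuous_on S g"
  shows "continuous_on S (\<lambda>x. f x *s g x)"
  unfolding vector_scalar_mult_def
  by (intro continuous_on_vec_lambda continuous_intros assms)

lemma borel_measurable_smult_vec:
  "(\<lambda>x. c *s x) \<in> borel_measurable (borel :: (complex ^ 'm) measure)"
  by (intro borel_measurable_continuous_onI continuous_intros)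

lemma nn_integral_lborel_translation:
  fixes f :: "'a :: euclidean_space \<Rightarrow> ennreal"
  assumes "f \<in> borel_measurable borel"
  shows "(\<integral>\<^sup>+x. f (a + x) \<partial>lborel) = (\<integral>\<^sup>+x. f x \<partial>lborel)"
proof -
  have "(\<integral>\<^sup>+x. f x \<partial>lborel) = (\<integral>\<^sup>+x. f x \<partial>distr lborel borel ((+) a))"
    by (simp add: lborel_distr_plus)
  also have "\<dots> = (\<integral>\<^sup>+x. f (a + x) \<partial>lborel)"
    using assms by (subst nn_integral_distr) auto
  finally show ?thesis by simp
qed

lemma nn_integral_lborel_affine:
  fixes f :: "'a :: euclidean_space \<Rightarrow> ennreal"
  assumes "f \<in> borel_measurable borel" "c > 0"
  shows "(\<integral>\<^sup>+x. f x \<partial>lborel) = ennreal (c ^ DIM('a)) * (\<integral>\<^sup>+x. f (a + c *\<^sub>R x) \<partial>lborel)"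
proof -
  have "(\<integral>\<^sup>+x. f x \<partial>lborel) =
    (\<integral>\<^sup>+x. f x \<partial>density (distr lborel borel (\<lambda>x. a + c *\<^sub>R x)) (\<lambda>_. ennreal (\<bar>c\<bar> ^ DIM('a))))"
    using lborel_affine[of c a] assms(2) by simp
  also have "\<dots> = ennreal (c ^ DIM('a)) * (\<integral>\<^sup>+x. f (a + c *\<^sub>R x) \<partial>lborel)"
    using assms by (simp add: nn_integral_density nn_integral_distr nn_integral_cmult)
  finally show ?thesis .
qed

text \<open>Translation invariance and Tonelli give
  \<open>\<mu>(A) \<lambda>(B) = \<lambda>(A) \<mu>(-B)\<close> for the pull-back \<open>\<mu>\<close> of \<open>\<lambda>\<close> under a rotation;
  with \<open>B\<close> the unit ball this forces \<open>\<mu> = \<lambda>\<close>.\<close>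
lemma emeasure_lborel_rotation:
  fixes A :: "(complex ^ 'm) set"
  assumes A: "A \<in> sets borel" and c: "norm c = 1"
  shows "emeasure lborel ((\<lambda>x. c *s x) -` A) = emeasure lborel A"
proof -
  define T where "T = (\<lambda>x :: complex ^ 'm. c *s x)"
  define Ti where "Ti = (\<lambda>x :: complex ^ 'm. inverse c *s x)"
  define B where "B = ball (0 :: complex ^ 'm) 1"
  have c0: "c \<noteq> 0" using c by auto
  have TTi: "T (Ti x) = x" for x using c0 by (simp add: T_def Ti_def vector_smult_assoc)
  have Tadd: "T (x + y) = T x + T y" for x y by (simp add: T_def vector_add_ldistrib)
  have nT: "norm (T x) = norm x" for x using c by (simp add: T_def norm_smult_vec)
  have [measurable]: "T \<in> borel_measurable borel"
    unfolding T_def by (rule borel_measurable_smult_vec)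
  have [measurable]: "B \<in> sets borel" "A \<in> sets borel" using A by (auto simp: B_def)
  have pre: "T -` A \<in> sets borel"
    using measurable_sets[of T borel borel A] A by simp
  have "emeasure lborel (T -` A) * emeasure lborel B =
      (\<integral>\<^sup>+y. indicator B y * emeasure lborel (T -` A) \<partial>lborel)"
    by (simp add: nn_integral_multc mult.commute)
  also have "\<dots> = (\<integral>\<^sup>+y. \<integral>\<^sup>+x. indicator B y * indicator A (T x + y) \<partial>lborel \<partial>lborel)"
  proof (rule nn_integral_cong)
    fix y :: "complex ^ 'm"
    have "emeasure lborel (T -` A) = (\<integral>\<^sup>+x. indicator A (T x) \<partial>lborel)"
    proof -
      have "emeasure lborel (T -` A) = (\<integral>\<^sup>+x. indicator (T -` A) x \<partial>lborel)"
        using pre by (simp add: nn_integral_indicator)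
      thus ?thesis by (simp add: indicator_vimage[symmetric] indicator_def)
    qed
    \<comment> \<open>Writing \<open>y\<close> as \<open>T (Ti y)\<close> turns the shift by
      \<open>y\<close> after the rotation into a translation before it.\<close>
    also have "\<dots> = (\<integral>\<^sup>+x. indicator A (T (Ti y + x)) \<partial>lborel)"
      by (rule nn_integral_lborel_translation[symmetric]) measurable
    also have "\<dots> = (\<integral>\<^sup>+x. indicator A (T x + y) \<partial>lborel)"
      by (simp add: Tadd TTi add.commute)
    finally show "indicator B y * emeasure lborel (T -` A) =
        (\<integral>\<^sup>+x. indicator B y * indicator A (T x + y) \<partial>lborel)"
      by (simp add: nn_integral_cmult)
  qed
  also have "\<dots> = (\<integral>\<^sup>+x. \<integral>\<^sup>+y. indicator B y * indicator A (T x + y) \<partial>lborel \<partial>lborel)"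
    by (rule lborel_pair.Fubini') measurable
  also have "\<dots> = (\<integral>\<^sup>+x. \<integral>\<^sup>+y. indicator B (y - T x) * indicator A y \<partial>lborel \<partial>lborel)"
  proof (rule nn_integral_cong)
    fix x :: "complex ^ 'm"
    show "(\<integral>\<^sup>+y. indicator B y * indicator A (T x + y) \<partial>lborel) =
      (\<integral>\<^sup>+y. indicator B (y - T x) * indicator A y \<partial>lborel)"
      using nn_integral_lborel_translation[of "\<lambda>y. indicator B (y - T x) * indicator A y" "T x"]
      by simp
  qed
  also have "\<dots> = (\<integral>\<^sup>+y. \<integral>\<^sup>+x. indicator B (y - T x) * indicator A y \<partial>lborel \<partial>lborel)"
    by (rule lborel_pair.Fubini') measurable
  also have "\<dots> = (\<integral>\<^sup>+y. emeasure lborel B * indicator A y \<partial>lborel)"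
  proof (rule nn_integral_cong)
    fix y :: "complex ^ 'm"
    have eq: "norm (y - T (Ti y + x)) = norm x" for x
      by (simp add: Tadd TTi nT)
    have "(\<integral>\<^sup>+x. indicator B (y - T x) \<partial>lborel) = (\<integral>\<^sup>+x. indicator B (y - T (Ti y + x)) \<partial>lborel)"
      by (rule nn_integral_lborel_translation[symmetric]) measurable
    also have "\<dots> = (\<integral>\<^sup>+x. indicator B x \<partial>lborel)"
      by (intro nn_integral_cong) (simp add: indicator_def B_def eq del: Tadd)
    finally show "(\<integral>\<^sup>+x. indicator B (y - T x) * indicator A y \<partial>lborel) = emeasure lborel B * indicator A y"
      by (simp add: nn_integral_multc)
  qed
  also have "\<dots> = emeasure lborel A * emeasure lborel B"
    by (simp add: nn_integral_cmult nn_integral_multc mult.commute)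
  finally have "emeasure lborel (T -` A) * emeasure lborel B = emeasure lborel A * emeasure lborel B" .
  moreover have "emeasure lborel B \<noteq> 0" "emeasure lborel B \<noteq> top"
    using emeasure_lborel_ball_finite[of "0 :: complex ^ 'm" 1] content_ball_pos[of 1 "0 :: complex ^ 'm"]
    by (auto simp: B_def measure_def)
  ultimately show ?thesis
    unfolding T_def by (simp add: mult.commute[of _ "emeasure lborel B"] ennreal_mult_cancel_left)
qed

text \<open>The radial projection carries this probability measure to the invariant measure on the
  sphere, so solid and spherical means are integrals against one and the same measure.\<close>

definition ball_measure :: "(complex ^ 'm) measure" where
  "ball_measure = uniform_measure lborel (ball 0 1)"

lemma sets_ball_measure [measurable_cong, simp]: "sets ball_measure = sets borel"
  and space_ball_measure [simp]: "space ball_measure = UNIV"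
  by (simp_all add: ball_measure_def)

lemma emeasure_unit_ball:
  "emeasure lborel (ball (0 :: complex ^ 'm) 1) \<noteq> 0" "emeasure lborel (ball (0 :: complex ^ 'm) 1) < \<infinity>"
  using emeasure_lborel_ball_finite[of "0 :: complex ^ 'm" 1] content_ball_pos[of 1 "0 :: complex ^ 'm"]
  by (auto simp: measure_def)

lemma emeasure_ball_measure_UNIV [simp]: "emeasure ball_measure (UNIV :: (complex ^ 'm) set) = 1"
  using emeasure_uniform_measure_1[of lborel "ball (0 :: complex ^ 'm) 1"] emeasure_unit_ball[where 'm = 'm]
  by (simp add: ball_measure_def)

lemma measure_ball_measure_UNIV [simp]: "measure ball_measure (UNIV :: (complex ^ 'm) set) = 1"
  by (simp add: measure_def)

lemma finite_ball_measure: "finite_measure ball_measure"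
  by (rule finite_measureI) simp

lemma AE_ball_measure: "AE x in ball_measure. norm x < 1"
  unfolding ball_measure_def by (rule AE_uniform_measureI) auto

lemma distr_ball_measure_rotation:
  assumes c: "norm c = 1"
  shows "distr ball_measure borel (\<lambda>x. c *s x) = (ball_measure :: (complex ^ 'm) measure)"
proof (rule measure_eqI)
  fix A :: "(complex ^ 'm) set"
  assume "A \<in> sets (distr ball_measure borel (\<lambda>x. c *s x))"
  hence A: "A \<in> sets borel" by simp
  have m: "(\<lambda>x. c *s x) \<in> borel_measurable (borel :: (complex ^ 'm) measure)"
    by (rule borel_measurable_smult_vec)
  have v: "(\<lambda>x. c *s x) -` A \<in> sets borel"
    using measurable_sets[OF m A] by simp
  have eq: "ball 0 1 \<inter> (\<lambda>x. c *s x) -` A = (\<lambda>x. c *s x) -` (ball 0 1 \<inter> A)"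
    using c by (auto simp: norm_smult_vec)
  have "emeasure lborel (ball 0 1 \<inter> (\<lambda>x. c *s x) -` A) = emeasure lborel (ball 0 1 \<inter> A)"
    unfolding eq using A c by (intro emeasure_lborel_rotation) auto
  thus "emeasure (distr ball_measure borel (\<lambda>x. c *s x)) A = emeasure ball_measure A"
    using A m v by (subst emeasure_distr) (auto simp: ball_measure_def)
qed simp

lemma integral_ball_measure_rotation:
  fixes u :: "complex ^ 'm \<Rightarrow> real"
  assumes "u \<in> borel_measurable borel" "norm c = 1"
  shows "(\<integral>x. u (c *s x) \<partial>ball_measure) = (\<integral>x. u x \<partial>ball_measure)"
proof -
  have "(\<integral>x. u x \<partial>ball_measure) = (\<integral>x. u x \<partial>distr ball_measure borel (\<lambda>x. c *s x))"
    by (simp add: distr_ball_measure_rotation assms)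
  also have "\<dots> = (\<integral>x. u (c *s x) \<partial>ball_measure)"
    using assms borel_measurable_smult_vec[of c, where 'm = 'm]
    by (subst integral_distr) (auto simp: measurable_def)
  finally show ?thesis by simp
qed

lemma nn_integral_ball_measure:
  fixes f :: "complex ^ 'm \<Rightarrow> ennreal"
  assumes [measurable]: "f \<in> borel_measurable borel"
  shows "(\<integral>\<^sup>+x. f x \<partial>ball_measure) = (\<integral>\<^sup>+x. f x * indicator (ball 0 1) x \<partial>lborel)
    / emeasure lborel (ball (0 :: complex ^ 'm) 1)"
  unfolding ball_measure_def by (subst nn_integral_uniform_measure) auto

lemma integral_ball_measure:
  fixes u :: "complex ^ 'm \<Rightarrow> real"
  assumes [measurable]: "u \<in> borel_measurable borel"
  shows "(\<integral>x. u x \<partial>ball_measure) = (LINT x : ball 0 1 | lborel. u x) / measure lborel (ball (0 :: complex ^ 'm) 1)"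
proof -
  have "emeasure lborel (ball (0 :: complex ^ 'm) 1) = ennreal (measure lborel (ball (0 :: complex ^ 'm) 1))"
    using emeasure_unit_ball(2)[where 'm = 'm] by (intro emeasure_eq_ennreal_measure) auto
  hence "indicator (ball 0 1) x / emeasure lborel (ball (0 :: complex ^ 'm) 1) =
      ennreal (indicator (ball 0 1) x / measure lborel (ball (0 :: complex ^ 'm) 1))" for x :: "complex ^ 'm"
    using content_ball_pos[of 1 "0 :: complex ^ 'm"]
    by (auto simp: indicator_def divide_ennreal ennreal_1[symmetric] simp del: ennreal_1)
  hence eq: "ball_measure = density lborel (\<lambda>x :: complex ^ 'm. ennreal (indicator (ball 0 1) x / measure lborel (ball (0 :: complex ^ 'm) 1)))"
    by (simp add: ball_measure_def uniform_measure_def)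
  have "(\<integral>x. u x \<partial>ball_measure) =
      (\<integral>x. (indicator (ball 0 1) x / measure lborel (ball (0 :: complex ^ 'm) 1)) *\<^sub>R u x \<partial>lborel)"
    unfolding eq by (rule integral_density) (auto intro!: borel_measurable_divide borel_measurable_indicator)
  also have "\<dots> = (\<integral>x. (indicator (ball 0 1) x *\<^sub>R u x) / measure lborel (ball (0 :: complex ^ 'm) 1) \<partial>lborel)"
    by (intro Bochner_Integration.integral_cong) auto
  finally show ?thesis
    by (simp add: set_lebesgue_integral_def)
qed

lemma integrable_ball_measure_bounded:
  fixes u :: "complex ^ 'm \<Rightarrow> real"
  assumes "u \<in> borel_measurable borel" "\<And>x. norm x < 1 \<Longrightarrow> \<bar>u x\<bar> \<le> B"
  shows "integrable ball_measure u"
proof -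
  interpret finite_measure ball_measure by (rule finite_ball_measure)
  show ?thesis
    using AE_ball_measure assms
    by (intro integrable_const_bound[where B = B]) (auto elim!: eventually_mono)
qed

lemma integral_ball_measure_mono:
  fixes u v :: "complex ^ 'm \<Rightarrow> real"
  assumes "integrable ball_measure u" "integrable ball_measure v" "\<And>x. norm x < 1 \<Longrightarrow> u x \<le> v x"
  shows "(\<integral>x. u x \<partial>ball_measure) \<le> (\<integral>x. v x \<partial>ball_measure)"
  using assms AE_ball_measure by (intro integral_mono_AE) (auto elim!: eventually_mono)

text \<open>Before normalization this is monotonicity of the integral of a nonnegative function,
  because the condition on the radii puts \<open>ball a R\<close> inside \<open>ball a' R'\<close>;
  the factor is the ratio of the volumes.\<close>

lemma integral_ball_measure_affine_le:
  fixes v :: "complex ^ 'm \<Rightarrow> real"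
  assumes v: "continuous_on UNIV v" and nonneg: "\<And>x. v x \<ge> 0"
    and R: "R > 0" "norm (a - a') + R \<le> R'"
  shows "(\<integral>x. v (a + R *\<^sub>R x) \<partial>ball_measure) \<le>
    (R' / R) ^ DIM(complex ^ 'm) * (\<integral>x. v (a' + R' *\<^sub>R x) \<partial>ball_measure)"
proof -
  let ?d = "DIM(complex ^ 'm)"
  have R': "R' > 0" using R norm_ge_zero[of "a - a'"] by linarith
  have [measurable]: "v \<in> borel_measurable borel"
    using v by (rule borel_measurable_continuous_onI)
  have int: "integrable ball_measure (\<lambda>x. v (b + c *\<^sub>R x))" for b c
  proof -
    have "compact ((\<lambda>x. v (b + c *\<^sub>R x)) ` cball 0 1)"
      by (intro compact_continuous_image continuous_on_compose2[OF v] continuous_intros) auto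
    then obtain B where "\<forall>y\<in>(\<lambda>x. v (b + c *\<^sub>R x)) ` cball 0 1. norm y \<le> B"
      using compact_imp_bounded bounded_iff by metis
    thus ?thesis
      by (intro integrable_ball_measure_bounded[where B = B]) auto
  qed
  have conv: "ennreal (\<integral>x. v (b + c *\<^sub>R x) \<partial>ball_measure) * ennreal (c ^ ?d) =
     (\<integral>\<^sup>+x. ennreal (v x) * indicator (ball b c) x \<partial>lborel) / emeasure lborel (ball (0 :: complex ^ 'm) 1)"
    if c: "c > 0" for b c
  proof -
    have "ennreal (\<integral>x. v (b + c *\<^sub>R x) \<partial>ball_measure) = (\<integral>\<^sup>+x. ennreal (v (b + c *\<^sub>R x)) \<partial>ball_measure)"
      using int nonneg by (intro nn_integral_eq_integral[symmetric]) auto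
    also have "\<dots> = (\<integral>\<^sup>+x. ennreal (v (b + c *\<^sub>R x)) * indicator (ball 0 1) x \<partial>lborel)
        / emeasure lborel (ball (0 :: complex ^ 'm) 1)"
      by (rule nn_integral_ball_measure) measurable
    also have "(\<integral>\<^sup>+x. ennreal (v (b + c *\<^sub>R x)) * indicator (ball 0 1) x \<partial>lborel) =
       (\<integral>\<^sup>+x. ennreal (v (b + c *\<^sub>R x)) * indicator (ball b c) (b + c *\<^sub>R x) \<partial>lborel)"
      using c by (intro nn_integral_cong) (auto simp: indicator_def dist_norm)
    moreover have "(\<integral>\<^sup>+x. ennreal (v x) * indicator (ball b c) x \<partial>lborel) = ennreal (c ^ ?d) *
        (\<integral>\<^sup>+x. ennreal (v (b + c *\<^sub>R x)) * indicator (ball b c) (b + c *\<^sub>R x) \<partial>lborel)"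
      using c by (intro nn_integral_lborel_affine) (auto intro!: borel_measurable_times_ennreal borel_measurable_indicator)
    ultimately show ?thesis
      by (simp add: ennreal_times_divide mult.commute[of _ "ennreal _"])
  qed
  have "ennreal (\<integral>x. v (a + R *\<^sub>R x) \<partial>ball_measure) * ennreal (R ^ ?d) \<le>
    ennreal (\<integral>x. v (a' + R' *\<^sub>R x) \<partial>ball_measure) * ennreal (R' ^ ?d)"
  proof (unfold conv[OF R(1)] conv[OF R'], intro divide_right_mono_ennreal nn_integral_mono mult_left_mono)
    fix x :: "complex ^ 'm"
    have "x \<in> ball a' R'" if "x \<in> ball a R"
      using that R dist_triangle[of a' x a] by (auto simp: dist_norm norm_minus_commute)
    thus "indicator (ball a R) x \<le> (indicator (ball a' R') x :: ennreal)"
      by (auto simp: indicator_def)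
  qed auto
  hence "(\<integral>x. v (a + R *\<^sub>R x) \<partial>ball_measure) * R ^ ?d \<le> (\<integral>x. v (a' + R' *\<^sub>R x) \<partial>ball_measure) * R' ^ ?d"
    using R R' nonneg
    by (simp flip: ennreal_mult'' add: Bochner_Integration.integral_nonneg)
  thus ?thesis
    using R by (simp add: power_divide field_simps)
qed

section \<open>Circle sums and holomorphy along complex lines\<close>

text \<open>Multiplying the \<open>N\<close>-th roots of unity by one of them only permutes them, so
  a sampled circle sum does not depend on its starting point.\<close>

lemma sum_periodic_shift:
  fixes g :: "nat \<Rightarrow> 'a :: ab_group_add"
  assumes "\<And>k. g (k + N) = g k"
  shows "(\<Sum>k<N. g (k + j)) = (\<Sum>k<N. g k)"
proof (induction j)
  case (Suc j)
  have "(\<Sum>k<N. g (k + Suc j)) = (\<Sum>k<Suc N. g (k + j)) - g j"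
    by (subst sum.lessThan_Suc_shift) simp
  also have "\<dots> = (\<Sum>k<N. g (k + j))"
    using assms[of j] by (simp add: add.commute)
  finally show ?case using Suc by simp
qed simp

text \<open>Cutting off at \<open>\<delta>\<close> keeps \<open>ln |g|\<close> continuous across the
  zeros of \<open>g\<close>, so its means exist without any study of those zeros. The level
  \<open>1\<close> gives \<open>log_plus\<close>, hence one monotonicity result serves
  characteristics and lower bounds alike.\<close>

definition ln_trunc :: "real \<Rightarrow> real \<Rightarrow> real" where
  "ln_trunc \<delta> t = ln (max t \<delta>)"

lemma ln_trunc_one: "ln_trunc 1 t = log_plus t"
  by (auto simp: ln_trunc_def log_plus_def max_def)

lemma log_plus_nonneg [simp]: "log_plus t \<ge> 0"
  by (auto simp: log_plus_def)

lemma ln_trunc_le_log_plus: "0 < \<delta> \<Longrightarrow> \<delta> \<le> 1 \<Longrightarrow> ln_trunc \<delta> t \<le> log_plus t"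
  by (auto simp: ln_trunc_def log_plus_def max_def)

lemma exp_ln_trunc: "\<delta> > 0 \<Longrightarrow> exp (ln_trunc \<delta> t) = max t \<delta>"
  by (simp add: ln_trunc_def)

lemma continuous_on_ln_trunc [continuous_intros]:
  "\<delta> > 0 \<Longrightarrow> continuous_on S f \<Longrightarrow> continuous_on S (\<lambda>x. ln_trunc \<delta> (f x))"
  unfolding ln_trunc_def by (intro continuous_intros) (auto simp: max_def)

lemma norm_cis_minus_one_le: "norm (cis t - 1) \<le> \<bar>t\<bar>"
  using abs_sin_x_le_abs_x[of "t / 2"] by (simp add: cis_conv_exp dist_exp_i_1)

text \<open>The maximum principle is applied to the product of those \<open>h (\<omega>\<^sup>k \<zeta>)\<close> whose value at radius
  \<open>\<rho>\<close> is not truncated, so that the product attains the truncated sum there.\<close>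
lemma circle_sum_mono:
  fixes h :: "complex \<Rightarrow> complex" and N :: nat and \<eta> :: real
  assumes h: "h holomorphic_on UNIV" and \<delta>: "\<delta> > 0" and N: "N > 0"
    and r: "0 \<le> \<rho>" "\<rho> \<le> r"
    and osc: "\<And>\<zeta> \<zeta>'. norm \<zeta> = r \<Longrightarrow> norm \<zeta>' = r \<Longrightarrow> dist \<zeta> \<zeta>' \<le> r * (2 * pi / N) \<Longrightarrow>
        ln_trunc \<delta> (norm (h \<zeta>)) \<le> ln_trunc \<delta> (norm (h \<zeta>')) + \<eta>"
    and \<omega>_def: "\<omega> = cis (2 * pi / N)"
  shows "(\<Sum>k<N. ln_trunc \<delta> (norm (h (\<omega> ^ k * of_real \<rho>)))) \<le>
      (\<Sum>k<N. ln_trunc \<delta> (norm (h (\<omega> ^ k * of_real r)))) + N * \<eta>"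
proof -
  define S where "S = {k. norm (h (\<omega> ^ k * of_real \<rho>)) \<ge> \<delta>}"
  define G where "G = (\<lambda>\<zeta>. \<Prod>k<N. if k \<in> S then h (\<omega> ^ k * \<zeta>) else of_real \<delta>)"
  define B where "B = exp ((\<Sum>k<N. ln_trunc \<delta> (norm (h (\<omega> ^ k * of_real r)))) + N * \<eta>)"
  have \<omega>N: "\<omega> ^ N = 1"
    using N by (simp add: \<omega>_def Complex.DeMoivre)
  have n\<omega>: "norm (\<omega> ^ k) = 1" for k
    by (simp add: \<omega>_def norm_power)
  have holG: "G holomorphic_on UNIV"
    unfolding G_def
  proof (intro holomorphic_on_prod)
    fix k
    have "(\<lambda>\<zeta>. h (\<omega> ^ k * \<zeta>)) holomorphic_on UNIV"
      using holomorphic_on_compose_gen[of "\<lambda>\<zeta>. \<omega> ^ k * \<zeta>" UNIV h UNIV] h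
      by (auto simp: o_def intro!: holomorphic_on_mult holomorphic_on_const holomorphic_on_ident)
    thus "(\<lambda>\<zeta>. if k \<in> S then h (\<omega> ^ k * \<zeta>) else of_real \<delta>) holomorphic_on UNIV"
      by (cases "k \<in> S") simp_all
  qed
  have bd: "norm (G \<zeta>) \<le> B" if \<zeta>: "norm \<zeta> = r" for \<zeta>
  proof -
    define \<phi> where "\<phi> = Arg2pi \<zeta>"
    \<comment> \<open>The grid point \<open>\<omega> ^ j\<close> precedes \<open>\<zeta>\<close> in
      argument by at most one mesh width.\<close>
    define j where "j = nat \<lfloor>\<phi> * N / (2 * pi)\<rfloor>"
    have \<phi>: "0 \<le> \<phi>" by (simp add: \<phi>_def Arg2pi_ge_0)
    have \<zeta>_eq: "\<zeta> = of_real r * cis \<phi>"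
      using Arg2pi_eq[of \<zeta>] \<zeta> by (simp add: \<phi>_def cis_conv_exp)
    have j: "real j \<le> \<phi> * N / (2 * pi)" "\<phi> * N / (2 * pi) < real j + 1"
      using \<phi> by (auto simp: j_def of_nat_nat)
    have d: "\<bar>\<phi> - j * (2 * pi / N)\<bar> \<le> 2 * pi / N"
    proof -
      have "j * (2 * pi / N) \<le> \<phi>" using j(1) N by (simp add: field_simps)
      moreover have "\<phi> \<le> j * (2 * pi / N) + 2 * pi / N" using j(2) N by (simp add: field_simps)
      ultimately show ?thesis by simp
    qed
    have \<omega>j: "\<omega> ^ j = cis (j * (2 * pi / N))"
      by (simp add: \<omega>_def Complex.DeMoivre)
    have "cis \<phi> - \<omega> ^ j = \<omega> ^ j * (cis (\<phi> - j * (2 * pi / N)) - 1)"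
      unfolding \<omega>j by (simp add: algebra_simps cis_mult)
    hence "norm (cis \<phi> - \<omega> ^ j) = norm (cis (\<phi> - j * (2 * pi / N)) - 1)"
      by (simp add: norm_mult n\<omega>)
    also have "\<dots> \<le> \<bar>\<phi> - j * (2 * pi / N)\<bar>"
      by (rule norm_cis_minus_one_le)
    finally have dist: "norm (cis \<phi> - \<omega> ^ j) \<le> 2 * pi / N" using d by simp
    have step: "ln_trunc \<delta> (norm (h (\<omega> ^ k * \<zeta>))) \<le> ln_trunc \<delta> (norm (h (\<omega> ^ (k + j) * of_real r))) + \<eta>" for k
    proof (rule osc)
      have "\<omega> ^ k * \<zeta> - \<omega> ^ (k + j) * of_real r = \<omega> ^ k * of_real r * (cis \<phi> - \<omega> ^ j)"
        by (simp add: \<zeta>_eq power_add algebra_simps)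
      hence "dist (\<omega> ^ k * \<zeta>) (\<omega> ^ (k + j) * of_real r) = r * norm (cis \<phi> - \<omega> ^ j)"
        using r by (simp only: dist_norm norm_mult n\<omega> norm_of_real)
      also have "\<dots> \<le> r * (2 * pi / N)"
        using r dist by (intro mult_left_mono) linarith+
      finally show "dist (\<omega> ^ k * \<zeta>) (\<omega> ^ (k + j) * of_real r) \<le> r * (2 * pi / N)" .
    qed (use \<zeta> r in \<open>auto simp: norm_mult n\<omega>\<close>)
    \<comment> \<open>In either branch a factor of \<open>G\<close> has modulus at most the maximum
      of \<open>|h|\<close> and \<open>\<delta>\<close>.\<close>
    have "norm (G \<zeta>) \<le> (\<Prod>k<N. exp (ln_trunc \<delta> (norm (h (\<omega> ^ k * \<zeta>)))))"
      unfolding G_def prod_norm[symmetric] using \<delta>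
      by (intro prod_mono) (auto simp: exp_ln_trunc)
    also have "\<dots> = exp (\<Sum>k<N. ln_trunc \<delta> (norm (h (\<omega> ^ k * \<zeta>))))"
      by (simp add: exp_sum)
    also have "\<dots> \<le> exp (\<Sum>k<N. ln_trunc \<delta> (norm (h (\<omega> ^ (k + j) * of_real r))) + \<eta>)"
      using step by (intro exp_mono sum_mono) auto
    also have "(\<Sum>k<N. ln_trunc \<delta> (norm (h (\<omega> ^ (k + j) * of_real r))) + \<eta>) =
       (\<Sum>k<N. ln_trunc \<delta> (norm (h (\<omega> ^ (k + j) * of_real r)))) + N * \<eta>"
      by (simp add: sum.distrib)
    also have "(\<Sum>k<N. ln_trunc \<delta> (norm (h (\<omega> ^ (k + j) * of_real r)))) =
        (\<Sum>k<N. ln_trunc \<delta> (norm (h (\<omega> ^ k * of_real r))))"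
      by (rule sum_periodic_shift) (simp add: power_add \<omega>N)
    finally show ?thesis by (simp add: B_def)
  qed
  have "norm (G (of_real \<rho>)) \<le> B"
  proof (cases "r = 0")
    case True
    thus ?thesis using r bd[of "of_real \<rho>"] by simp
  next
    case False
    show ?thesis
    proof (rule maximum_modulus_frontier[of G "cball 0 r"])
      show "G holomorphic_on interior (cball 0 r)"
        by (rule holomorphic_on_subset[OF holG]) simp
      show "continuous_on (closure (cball 0 r)) G"
        by (rule continuous_on_subset[OF holomorphic_on_imp_continuous_on[OF holG]]) simp
    qed (use bd r False in auto)
  qed
  moreover have "norm (G (of_real \<rho>)) = exp (\<Sum>k<N. ln_trunc \<delta> (norm (h (\<omega> ^ k * of_real \<rho>))))"
    unfolding G_def prod_norm[symmetric] exp_sum[OF finite_lessThan] using \<delta>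
    by (intro prod.cong) (auto simp: exp_ln_trunc S_def max_def)
  ultimately show ?thesis by (simp add: B_def)
qed

text \<open>Continuity and holomorphy along complex lines suffice throughout, and unlike complex
  differentiability they pass to quotients with removable zeros without effort.\<close>
definition hol_vec_on :: "(complex ^ 'm \<Rightarrow> complex) \<Rightarrow> (complex ^ 'm) set \<Rightarrow> bool" where
  "hol_vec_on g U \<longleftrightarrow> continuous_on U g \<and>
     (\<forall>x y. (\<lambda>\<zeta>. g (x + \<zeta> *s y)) holomorphic_on {\<zeta>. x + \<zeta> *s y \<in> U})"

lemma hol_vec_on_imp_continuous_on: "hol_vec_on g U \<Longrightarrow> continuous_on U g"
  by (simp add: hol_vec_on_def)

lemma hol_vec_on_line: "hol_vec_on g UNIV \<Longrightarrow> (\<lambda>\<zeta>. g (x + \<zeta> *s y)) holomorphic_on UNIV"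
  by (simp add: hol_vec_on_def)

lemma hol_vec_on_subset: "hol_vec_on g U \<Longrightarrow> V \<subseteq> U \<Longrightarrow> hol_vec_on g V"
  unfolding hol_vec_on_def
proof (elim conjE, intro conjI allI)
  fix x y
  assume "V \<subseteq> U" "\<forall>x y. (\<lambda>\<zeta>. g (x + \<zeta> *s y)) holomorphic_on {\<zeta>. x + \<zeta> *s y \<in> U}"
  thus "(\<lambda>\<zeta>. g (x + \<zeta> *s y)) holomorphic_on {\<zeta>. x + \<zeta> *s y \<in> V}"
    by (blast intro: holomorphic_on_subset[of _ "{\<zeta>. x + \<zeta> *s y \<in> U}"])
qed (rule continuous_on_subset)

lemma hol_vec_on_cong: "(\<And>z. z \<in> U \<Longrightarrow> g z = h z) \<Longrightarrow> hol_vec_on g U \<longleftrightarrow> hol_vec_on h U"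
proof -
  assume eq: "\<And>z. z \<in> U \<Longrightarrow> g z = h z"
  have "continuous_on U g \<longleftrightarrow> continuous_on U h"
    by (rule continuous_on_cong) (auto simp: eq)
  moreover have "(\<lambda>\<zeta>. g (x + \<zeta> *s y)) holomorphic_on {\<zeta>. x + \<zeta> *s y \<in> U} \<longleftrightarrow>
      (\<lambda>\<zeta>. h (x + \<zeta> *s y)) holomorphic_on {\<zeta>. x + \<zeta> *s y \<in> U}" for x y
    by (rule holomorphic_cong) (auto simp: eq)
  ultimately show ?thesis by (simp add: hol_vec_on_def)
qed

lemma hol_vec_on_const [intro]: "hol_vec_on (\<lambda>_. c) U"
  by (simp add: hol_vec_on_def)

lemma hol_vec_on_diff: "hol_vec_on g U \<Longrightarrow> hol_vec_on h U \<Longrightarrow> hol_vec_on (\<lambda>z. g z - h z) U"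
  by (simp add: hol_vec_on_def continuous_on_diff holomorphic_on_diff)

lemma hol_vec_on_mult: "hol_vec_on g U \<Longrightarrow> hol_vec_on h U \<Longrightarrow> hol_vec_on (\<lambda>z. g z * h z) U"
  by (simp add: hol_vec_on_def continuous_on_mult holomorphic_on_mult)

lemma hol_vec_on_power: "hol_vec_on g U \<Longrightarrow> hol_vec_on (\<lambda>z. g z ^ n) U"
  by (simp add: hol_vec_on_def continuous_on_power holomorphic_on_power)

lemma hol_vec_on_divide:
  "hol_vec_on g U \<Longrightarrow> hol_vec_on h U \<Longrightarrow> (\<And>z. z \<in> U \<Longrightarrow> h z \<noteq> 0) \<Longrightarrow> hol_vec_on (\<lambda>z. g z / h z) U"
  unfolding hol_vec_on_def
proof (elim conjE, intro conjI allI)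
  fix x y
  assume "\<And>z. z \<in> U \<Longrightarrow> h z \<noteq> 0"
    and "\<forall>x y. (\<lambda>\<zeta>. g (x + \<zeta> *s y)) holomorphic_on {\<zeta>. x + \<zeta> *s y \<in> U}"
    and "\<forall>x y. (\<lambda>\<zeta>. h (x + \<zeta> *s y)) holomorphic_on {\<zeta>. x + \<zeta> *s y \<in> U}"
  thus "(\<lambda>\<zeta>. g (x + \<zeta> *s y) / h (x + \<zeta> *s y)) holomorphic_on {\<zeta>. x + \<zeta> *s y \<in> U}"
    by (intro holomorphic_on_divide) blast+
qed (simp add: continuous_on_divide)

lemma hol_vec_on_sum: "(\<And>i. i \<in> I \<Longrightarrow> hol_vec_on (g i) U) \<Longrightarrow> hol_vec_on (\<lambda>z. \<Sum>i\<in>I. g i z) U"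
  by (simp add: hol_vec_on_def continuous_on_sum holomorphic_on_sum)

lemma hol_vec_on_prod: "(\<And>i. i \<in> I \<Longrightarrow> hol_vec_on (g i) U) \<Longrightarrow> hol_vec_on (\<lambda>z. \<Prod>i\<in>I. g i z) U"
  by (simp add: hol_vec_on_def continuous_on_prod holomorphic_on_prod)

lemma hol_vec_on_compose:
  assumes g: "hol_vec_on g U" and F: "F holomorphic_on V" and sub: "g ` U \<subseteq> V"
  shows "hol_vec_on (\<lambda>z. F (g z)) U"
  unfolding hol_vec_on_def
proof (intro conjI allI)
  show "continuous_on U (\<lambda>z. F (g z))"
    by (rule continuous_on_compose2[OF holomorphic_on_imp_continuous_on[OF F]
          hol_vec_on_imp_continuous_on[OF g] sub])
  fix x y
  have "(\<lambda>\<zeta>. g (x + \<zeta> *s y)) holomorphic_on {\<zeta>. x + \<zeta> *s y \<in> U}"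
    using g by (simp add: hol_vec_on_def)
  moreover have "(\<lambda>\<zeta>. g (x + \<zeta> *s y)) ` {\<zeta>. x + \<zeta> *s y \<in> U} \<subseteq> V"
    using sub by blast
  ultimately show "(\<lambda>\<zeta>. F (g (x + \<zeta> *s y))) holomorphic_on {\<zeta>. x + \<zeta> *s y \<in> U}"
    using holomorphic_on_compose_gen[OF _ F] unfolding o_def by blast
qed

lemma hol_vec_on_UNIV_local:
  assumes "\<And>z. \<exists>U. open U \<and> z \<in> U \<and> hol_vec_on g U"
  shows "hol_vec_on g UNIV"
  unfolding hol_vec_on_def
proof (intro conjI allI)
  have "isCont g z" for z
  proof -
    obtain U where U: "open U" "z \<in> U" "hol_vec_on g U" using assms by blast
    thus ?thesis
      using hol_vec_on_imp_continuous_on[OF U(3)] by (simp add: continuous_on_eq_continuous_at)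
  qed
  thus "continuous_on UNIV g" by (simp add: continuous_on_eq_continuous_at)
  fix x y
  have "(\<lambda>\<zeta>. g (x + \<zeta> *s y)) field_differentiable at \<zeta>0" for \<zeta>0
  proof -
    obtain U where U: "open U" "x + \<zeta>0 *s y \<in> U" "hol_vec_on g U" using assms by blast
    have "open {\<zeta>. x + \<zeta> *s y \<in> U}"
      using open_vimage[OF U(1), of "\<lambda>\<zeta>. x + \<zeta> *s y"] by (simp add: vimage_def continuous_intros)
    moreover have "(\<lambda>\<zeta>. g (x + \<zeta> *s y)) holomorphic_on {\<zeta>. x + \<zeta> *s y \<in> U}"
      using U(3) by (simp add: hol_vec_on_def)
    ultimately show ?thesis
      using U(2) by (blast intro: holomorphic_on_imp_differentiable_at)
  qed
  thus "(\<lambda>\<zeta>. g (x + \<zeta> *s y)) holomorphic_on {\<zeta>. x + \<zeta> *s y \<in> UNIV}"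
    by (simp add: holomorphic_on_def field_differentiable_at_within)
qed

text \<open>Complex linearity of the derivative \<open>D\<close> makes it multiplication by
  \<open>D y\<close> along a line of direction \<open>y\<close>.\<close>

lemma entire_Cm_imp_hol_vec_on:
  assumes "entire_Cm h"
  shows "hol_vec_on h UNIV"
  unfolding hol_vec_on_def
proof (intro conjI allI)
  have D: "\<exists>D. (h has_derivative D) (at w) \<and> (\<forall>c v. D (c *s v) = c * D v)" for w
    using assms unfolding entire_Cm_def hol_at_Cm_def by blast
  show "continuous_on UNIV h"
    unfolding continuous_on_eq_continuous_at[OF open_UNIV]
    using D has_derivative_continuous by blast
  fix x y
  have "(\<lambda>\<zeta>. h (x + \<zeta> *s y)) field_differentiable at \<zeta>" for \<zeta>
  proof -
    obtain D where D: "(h has_derivative D) (at (x + \<zeta> *s y))" "\<And>c v. D (c *s v) = c * D v"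
      using D by blast
    have "((\<lambda>\<zeta>. \<zeta> *s y) has_derivative (\<lambda>\<zeta>. \<zeta> *s y)) (at \<zeta>)"
      by (intro bounded_linear_imp_has_derivative linear_conv_bounded_linear[THEN iffD1] linearI)
        (simp_all add: vec_eq_iff algebra_simps)
    hence "((\<lambda>\<zeta>. x + \<zeta> *s y) has_derivative (\<lambda>\<zeta>. \<zeta> *s y)) (at \<zeta>)"
      using has_derivative_add[OF has_derivative_const[of x "at \<zeta>"]] by simp
    from has_derivative_compose[OF this D(1)]
    have "((\<lambda>\<zeta>. h (x + \<zeta> *s y)) has_derivative (\<lambda>c. D y * c)) (at \<zeta>)"
      by (simp add: D(2) mult.commute)
    thus ?thesis
      unfolding field_differentiable_def has_field_derivative_def by blast
  qed
  thus "(\<lambda>\<zeta>. h (x + \<zeta> *s y)) holomorphic_on {\<zeta>. x + \<zeta> *s y \<in> UNIV}"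
    by (simp add: holomorphic_on_def field_differentiable_at_within)
qed

text \<open>Identity theorem on the complex line through \<open>z0\<close> and \<open>z\<close>: its
  parameters near \<open>0\<close> lead into \<open>U\<close>.\<close>

lemma hol_vec_on_eq_const:
  assumes g: "hol_vec_on g UNIV" and U: "open U" "z0 \<in> U" and c: "\<And>z. z \<in> U \<Longrightarrow> g z = c"
  shows "g z = c"
proof -
  define h where "h = (\<lambda>\<zeta>. g (z0 + \<zeta> *s (z - z0)))"
  have h: "h holomorphic_on UNIV" unfolding h_def by (rule hol_vec_on_line[OF g])
  define V where "V = (\<lambda>\<zeta>. z0 + \<zeta> *s (z - z0)) -` U"
  have V: "open V" "0 \<in> V"
    unfolding V_def using U(2) by (auto intro!: open_vimage[OF U(1)] continuous_intros)
  have "h 1 = (\<lambda>_. c) 1"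
  proof (rule analytic_continuation_open[OF V(1) open_UNIV _ connected_UNIV _ h holomorphic_on_const])
    show "V \<noteq> {}" using V(2) by blast
  qed (use c in \<open>auto simp: V_def h_def\<close>)
  thus ?thesis by (simp add: h_def)
qed

text \<open>The image of a ball is connected, and a connected countable set has at most one point;
  failure would make \<open>g\<close> constant on a ball, hence everywhere. It serves to steer clear
  of the singularities of \<open>F\<close>.\<close>

lemma hol_vec_on_avoid_countable:
  assumes g: "hol_vec_on g UNIV" and nc: "\<not> (\<exists>c. \<forall>z. g z = c)"
    and U: "open U" "U \<noteq> {}" and S: "countable S"
  shows "\<exists>z\<in>U. g z \<notin> S"
proof (rule ccontr)
  assume contra: "\<not> ?thesis"
  obtain z0 where z0: "z0 \<in> U" using U(2) by blast
  obtain e where e: "e > 0" "ball z0 e \<subseteq> U"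
    using openE[OF U(1) z0] by blast
  have conn: "connected (g ` ball z0 e)"
    by (rule connected_continuous_image[OF continuous_on_subset[OF hol_vec_on_imp_continuous_on[OF g]]]) auto
  have count: "countable (g ` ball z0 e)"
    using contra e(2) by (intro countable_subset[OF _ S]) auto
  have eq: "g z = g z0" if "z \<in> ball z0 e" for z
  proof (rule ccontr)
    assume "g z \<noteq> g z0"
    moreover have "g z \<in> g ` ball z0 e" "g z0 \<in> g ` ball z0 e"
      using that e(1) by auto
    ultimately show False
      using connected_uncountable[OF conn] count by simp
  qed
  have "z0 \<in> ball z0 e" using e(1) by simp
  from hol_vec_on_eq_const[OF g open_ball this eq] nc show False by blast
qed

section \<open>Spherical means of truncated logarithms\<close>

lemma continuous_bounded_on_cball:
  fixes u :: "complex ^ 'm \<Rightarrow> real"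
  assumes "continuous_on UNIV u"
  obtains B where "\<And>z. norm z \<le> R \<Longrightarrow> \<bar>u z\<bar> \<le> B"
proof -
  have "compact (u ` cball 0 R)"
    by (rule compact_continuous_image[OF continuous_on_subset[OF assms]]) auto
  then obtain B where "\<forall>y\<in>u ` cball 0 R. norm y \<le> B"
    using compact_imp_bounded bounded_iff by metis
  thus ?thesis by (intro that[of B]) auto
qed

lemma radial_measurable:
  fixes u :: "complex ^ 'm \<Rightarrow> real"
  assumes u: "continuous_on UNIV u" and [measurable]: "\<alpha> \<in> borel_measurable borel"
  shows "(\<lambda>x. u (\<alpha> x *\<^sub>R x)) \<in> borel_measurable borel"
proof -
  have [measurable]: "u \<in> borel_measurable borel"
    using u by (rule borel_measurable_continuous_onI)
  show ?thesis by measurable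
qed

lemma radial_integrable:
  fixes u :: "complex ^ 'm \<Rightarrow> real"
  assumes u: "continuous_on UNIV u" and \<alpha>: "\<alpha> \<in> borel_measurable borel"
    and R: "\<And>x. norm x < 1 \<Longrightarrow> \<bar>\<alpha> x\<bar> * norm x \<le> R"
  shows "integrable ball_measure (\<lambda>x. u (\<alpha> x *\<^sub>R x))"
proof -
  obtain B where B: "\<And>z. norm z \<le> R \<Longrightarrow> \<bar>u z\<bar> \<le> B"
    using continuous_bounded_on_cball[OF u] by blast
  show ?thesis
    by (rule integrable_ball_measure_bounded[where B = B]) (use radial_measurable[OF u \<alpha>] B R in auto)
qed

text \<open>Since \<open>ball_measure\<close> is invariant under unit scalars, each integral equals
  its average over \<open>N\<close> rotations by roots of unity, and \<open>circle_sum_mono\<close>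
  compares these averages on every line through the origin. Radii that vary with \<open>x\<close> in
  a rotation-invariant way let this one lemma cover spheres, solid balls and centres.\<close>

lemma radial_mean_mono:
  fixes g :: "complex ^ 'm \<Rightarrow> complex"
  assumes g: "hol_vec_on g UNIV" and \<delta>: "\<delta> > 0"
    and \<alpha>: "\<alpha> \<in> borel_measurable borel" and \<beta>: "\<beta> \<in> borel_measurable borel"
    and rot: "\<And>c x. norm c = 1 \<Longrightarrow> \<alpha> (c *s x) = \<alpha> x" "\<And>c x. norm c = 1 \<Longrightarrow> \<beta> (c *s x) = \<beta> x"
    and le: "\<And>x. norm x < 1 \<Longrightarrow> 0 \<le> \<alpha> x" "\<And>x. norm x < 1 \<Longrightarrow> \<alpha> x \<le> \<beta> x"
      "\<And>x. norm x < 1 \<Longrightarrow> \<beta> x * norm x \<le> R"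
  shows "(\<integral>x. ln_trunc \<delta> (norm (g (\<alpha> x *\<^sub>R x))) \<partial>ball_measure) \<le>
    (\<integral>x. ln_trunc \<delta> (norm (g (\<beta> x *\<^sub>R x))) \<partial>ball_measure)"
proof -
  define U where "U = (\<lambda>z. ln_trunc \<delta> (norm (g z)))"
  have U: "continuous_on UNIV U"
    unfolding U_def using \<delta> hol_vec_on_imp_continuous_on[OF g] by (intro continuous_intros) auto
  have \<alpha>R: "\<bar>\<alpha> x\<bar> * norm x \<le> R" and \<beta>R: "\<bar>\<beta> x\<bar> * norm x \<le> R" if "norm x < 1" for x
    using le[OF that] mult_right_mono[of "\<alpha> x" "\<beta> x" "norm x"] by auto
  define v w where "v = (\<lambda>x. U (\<alpha> x *\<^sub>R x))" and "w = (\<lambda>x. U (\<beta> x *\<^sub>R x))"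
  have meas: "v \<in> borel_measurable borel" "w \<in> borel_measurable borel"
    unfolding v_def w_def by (rule radial_measurable[OF U]; fact)+
  have rot_eq: "v (c *s x) = U ((c * of_real (\<alpha> x)) *s x)" "w (c *s x) = U ((c * of_real (\<beta> x)) *s x)"
    if "norm c = 1" for c x
    using that by (simp_all add: v_def w_def rot mult.commute[of c] of_real_smult_vec[symmetric] vector_smult_assoc)
  obtain B where B: "\<And>z. norm z \<le> R \<Longrightarrow> \<bar>U z\<bar> \<le> B"
    using continuous_bounded_on_cball[OF U] by blast
  have int: "integrable ball_measure (\<lambda>x. v (c *s x))" "integrable ball_measure (\<lambda>x. w (c *s x))"
    if c: "norm c = 1" for c
  proof -
    have m: "(\<lambda>x. v (c *s x)) \<in> borel_measurable borel" "(\<lambda>x. w (c *s x)) \<in> borel_measurable borel"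
      using measurable_compose[OF borel_measurable_smult_vec meas(1)]
        measurable_compose[OF borel_measurable_smult_vec meas(2)] by auto
    show "integrable ball_measure (\<lambda>x. v (c *s x))" "integrable ball_measure (\<lambda>x. w (c *s x))"
      by (rule integrable_ball_measure_bounded[where B = B];
          use m B \<alpha>R \<beta>R c in \<open>simp add: rot_eq norm_smult_vec norm_mult\<close>)+
  qed
  have "(\<integral>x. v x \<partial>ball_measure) \<le> (\<integral>x. w x \<partial>ball_measure) + \<eta>" if \<eta>: "\<eta> > 0" for \<eta>
  proof -
    \<comment> \<open>Uniform continuity on a ball containing all points involved makes the error
      \<open>\<eta>\<close> in \<open>circle_sum_mono\<close> the same for all lines once the mesh
      is fine.\<close>
    have "uniformly_continuous_on (cball 0 R) U"
      by (rule compact_uniformly_continuous[OF continuous_on_subset[OF U]]) auto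
    then obtain d where d: "d > 0"
      "\<And>z z'. z \<in> cball 0 R \<Longrightarrow> z' \<in> cball 0 R \<Longrightarrow> dist z' z < d \<Longrightarrow> dist (U z') (U z) < \<eta>"
      using \<eta> unfolding uniformly_continuous_on_def by metis
    obtain N0 :: nat where N0: "R * (2 * pi) / d < N0" using reals_Archimedean2 by blast
    define N where "N = Suc N0"
    have N: "N > 0" "R * (2 * pi / N) < d"
    proof -
      have "R * (2 * pi) / d < N" using N0 by (simp add: N_def)
      hence "R * (2 * pi) < d * N" using d(1) by (simp add: field_simps)
      thus "R * (2 * pi / N) < d" by (simp add: N_def field_simps)
    qed (simp add: N_def)
    define \<omega> where "\<omega> = cis (2 * pi / N)"
    have n\<omega>: "norm (\<omega> ^ k) = 1" for k by (simp add: \<omega>_def norm_power)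
    have "(\<Sum>k<N. v (\<omega> ^ k *s x)) \<le> (\<Sum>k<N. w (\<omega> ^ k *s x)) + N * \<eta>" if x: "norm x < 1" for x
    proof -
      have hol: "(\<lambda>\<zeta>. g (\<zeta> *s x)) holomorphic_on UNIV"
        using hol_vec_on_line[OF g, of 0 x] by simp
      have osc: "ln_trunc \<delta> (norm (g (\<zeta> *s x))) \<le> ln_trunc \<delta> (norm (g (\<zeta>' *s x))) + \<eta>"
        if "norm \<zeta> = \<beta> x" "norm \<zeta>' = \<beta> x" "dist \<zeta> \<zeta>' \<le> \<beta> x * (2 * pi / N)" for \<zeta> \<zeta>'
      proof -
        have "dist (\<zeta> *s x) (\<zeta>' *s x) = dist \<zeta> \<zeta>' * norm x"
          by (simp only: dist_norm vector_sub_rdistrib[symmetric] norm_smult_vec)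
        also have "\<dots> \<le> \<beta> x * (2 * pi / N) * norm x"
          using that by (intro mult_right_mono) auto
        also have "\<dots> = (\<beta> x * norm x) * (2 * pi / N)" by simp
        also have "\<dots> \<le> R * (2 * pi / N)"
          using le(3)[OF x] by (intro mult_right_mono) auto
        also have "\<dots> < d" by (rule N)
        finally have "dist (U (\<zeta> *s x)) (U (\<zeta>' *s x)) < \<eta>"
          using that le(3)[OF x] by (intro d(2)) (auto simp: norm_smult_vec)
        thus ?thesis by (simp add: U_def dist_real_def)
      qed
      have "(\<Sum>k<N. ln_trunc \<delta> (norm (g ((\<omega> ^ k * of_real (\<alpha> x)) *s x)))) \<le>
        (\<Sum>k<N. ln_trunc \<delta> (norm (g ((\<omega> ^ k * of_real (\<beta> x)) *s x)))) + N * \<eta>"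
        by (rule circle_sum_mono[where h = "\<lambda>\<zeta>. g (\<zeta> *s x)",
              OF hol \<delta> N(1) le(1)[OF x] le(2)[OF x] osc \<omega>_def])
      thus ?thesis by (simp add: rot_eq[OF n\<omega>] U_def)
    qed
    hence "(\<integral>x. (\<Sum>k<N. v (\<omega> ^ k *s x)) \<partial>ball_measure) \<le>
       (\<integral>x. (\<Sum>k<N. w (\<omega> ^ k *s x)) + N * \<eta> \<partial>ball_measure)"
      using int[OF n\<omega>] finite_measure.integrable_const[OF finite_ball_measure]
      by (intro integral_ball_measure_mono Bochner_Integration.integrable_add Bochner_Integration.integrable_sum) auto
    also have "\<dots> = (\<integral>x. (\<Sum>k<N. w (\<omega> ^ k *s x)) \<partial>ball_measure) + N * \<eta>"
      using int[OF n\<omega>] finite_measure.integrable_const[OF finite_ball_measure]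
      by (subst Bochner_Integration.integral_add) (auto simp: Bochner_Integration.integrable_sum)
    also have "(\<integral>x. (\<Sum>k<N. w (\<omega> ^ k *s x)) \<partial>ball_measure) = N * (\<integral>x. w x \<partial>ball_measure)"
      using int[OF n\<omega>] by (simp add: integral_ball_measure_rotation[OF meas(2) n\<omega>])
    also have "(\<integral>x. (\<Sum>k<N. v (\<omega> ^ k *s x)) \<partial>ball_measure) = N * (\<integral>x. v x \<partial>ball_measure)"
      using int[OF n\<omega>] by (simp add: integral_ball_measure_rotation[OF meas(1) n\<omega>])
    finally have "N * (\<integral>x. v x \<partial>ball_measure) \<le> N * ((\<integral>x. w x \<partial>ball_measure) + \<eta>)"
      by (simp add: algebra_simps)
    thus ?thesis using N(1) by simp
  qed
  hence "(\<integral>x. v x \<partial>ball_measure) \<le> (\<integral>x. w x \<partial>ball_measure)"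
    by (rule field_le_epsilon)
  thus ?thesis by (simp add: v_def w_def U_def)
qed

text \<open>At \<open>x = 0\<close> the argument is \<open>0\<close>, because
  \<open>r / 0 = 0\<close>. All arguments thus lie in the closed ball of radius
  \<open>\<bar>r\<bar>\<close>, and this is why comparisons of spherical means are made on that ball
  and not only on the sphere.\<close>

definition sphere_mean :: "real \<Rightarrow> (complex ^ 'm \<Rightarrow> real) \<Rightarrow> real" where
  "sphere_mean r u = (\<integral>x. u ((r / norm x) *\<^sub>R x) \<partial>ball_measure)"

lemma sphere_mean_integrable:
  fixes u :: "complex ^ 'm \<Rightarrow> real"
  assumes "continuous_on UNIV u"
  shows "integrable ball_measure (\<lambda>x. u ((r / norm x) *\<^sub>R x))"
  by (rule radial_integrable[OF assms, where R = "\<bar>r\<bar>"]) auto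

lemma sphere_mean_mono:
  fixes u v :: "complex ^ 'm \<Rightarrow> real"
  assumes "continuous_on UNIV u" "continuous_on UNIV v" "r \<ge> 0" "\<And>z. norm z \<le> r \<Longrightarrow> u z \<le> v z"
  shows "sphere_mean r u \<le> sphere_mean r v"
  unfolding sphere_mean_def
  by (rule integral_ball_measure_mono[OF sphere_mean_integrable sphere_mean_integrable])
     (use assms in auto)

lemma sphere_mean_add:
  fixes u v :: "complex ^ 'm \<Rightarrow> real"
  assumes "continuous_on UNIV u" "continuous_on UNIV v"
  shows "sphere_mean r (\<lambda>z. u z + v z) = sphere_mean r u + sphere_mean r v"
  unfolding sphere_mean_def
  by (rule Bochner_Integration.integral_add) (intro sphere_mean_integrable assms)+

lemma sphere_mean_diff:
  fixes u v :: "complex ^ 'm \<Rightarrow> real"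
  assumes "continuous_on UNIV u" "continuous_on UNIV v"
  shows "sphere_mean r (\<lambda>z. u z - v z) = sphere_mean r u - sphere_mean r v"
  unfolding sphere_mean_def
  by (rule Bochner_Integration.integral_diff) (intro sphere_mean_integrable assms)+

lemma sphere_mean_sum:
  fixes u :: "'i \<Rightarrow> complex ^ 'm \<Rightarrow> real"
  assumes "\<And>i. i \<in> I \<Longrightarrow> continuous_on UNIV (u i)"
  shows "sphere_mean r (\<lambda>z. \<Sum>i\<in>I. u i z) = (\<Sum>i\<in>I. sphere_mean r (u i))"
  unfolding sphere_mean_def
  by (rule Bochner_Integration.integral_sum) (intro sphere_mean_integrable assms)

lemma sphere_mean_cmult: "sphere_mean r (\<lambda>z. c * u z) = c * sphere_mean r u"
  unfolding sphere_mean_def by simp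

lemma sphere_mean_const [simp]: "sphere_mean r (\<lambda>_. c) = c"
  unfolding sphere_mean_def by simp

lemma sphere_mean_nonneg: "(\<And>z. u z \<ge> 0) \<Longrightarrow> sphere_mean r u \<ge> 0"
  unfolding sphere_mean_def by (simp add: Bochner_Integration.integral_nonneg)

lemma nev_T_entire_eq_sphere_mean:
  assumes "continuous_on UNIV f"
  shows "nev_T_entire f r = sphere_mean r (\<lambda>z. log_plus (norm (f z)))"
proof -
  have c: "continuous_on UNIV (\<lambda>z. log_plus (norm (f z)))"
    unfolding ln_trunc_one[symmetric] by (intro continuous_intros assms) auto
  show ?thesis
    unfolding nev_T_entire_def proximity_Cm_def sphere_mean_def
    by (subst integral_ball_measure) (auto intro: radial_measurable[OF c])
qed

lemma continuous_on_ln_trunc_hol: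
  assumes "hol_vec_on g UNIV" "\<delta> > 0"
  shows "continuous_on UNIV (\<lambda>z. ln_trunc \<delta> (norm (g z)))"
  using assms by (intro continuous_intros hol_vec_on_imp_continuous_on)

lemma continuous_on_log_plus_hol:
  assumes "hol_vec_on g UNIV"
  shows "continuous_on UNIV (\<lambda>z. log_plus (norm (g z)))"
  using continuous_on_ln_trunc_hol[OF assms, of 1] by (simp add: ln_trunc_one)

lemma sphere_mean_radius_mono:
  assumes g: "hol_vec_on g UNIV" and \<delta>: "\<delta> > 0" and r: "0 \<le> \<rho>" "\<rho> \<le> r"
  shows "sphere_mean \<rho> (\<lambda>z. ln_trunc \<delta> (norm (g z))) \<le> sphere_mean r (\<lambda>z. ln_trunc \<delta> (norm (g z)))"
  unfolding sphere_mean_def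
  by (rule radial_mean_mono[OF g \<delta>, where R = r])
     (use r in \<open>auto simp: norm_smult_vec divide_right_mono\<close>)

lemma ball_mean_le_sphere_mean:
  assumes g: "hol_vec_on g UNIV" and \<delta>: "\<delta> > 0" and r: "0 \<le> r"
  shows "(\<integral>x. ln_trunc \<delta> (norm (g (r *\<^sub>R x))) \<partial>ball_measure) \<le> sphere_mean r (\<lambda>z. ln_trunc \<delta> (norm (g z)))"
proof -
  \<comment> \<open>The upper radius \<open>r / norm x\<close> is \<open>0\<close> at the origin, so
    the lower one is reset to \<open>0\<close> there; after multiplication by \<open>x = 0\<close>
    this changes nothing.\<close>
  have "(\<integral>x. ln_trunc \<delta> (norm (g ((if x = 0 then 0 else r) *\<^sub>R x))) \<partial>ball_measure) \<le>
      (\<integral>x. ln_trunc \<delta> (norm (g ((r / norm x) *\<^sub>R x))) \<partial>ball_measure)"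
  proof (rule radial_mean_mono[OF g \<delta>, where R = r])
    fix x :: "complex ^ 'a" assume "norm x < 1"
    thus "(if x = 0 then 0 else r) \<le> r / norm x"
      using r mult_left_mono[of "norm x" 1 r] by (auto simp: field_simps)
  qed (use r in \<open>auto simp: norm_smult_vec\<close>)
  moreover have "(if x = 0 then 0 else r) *\<^sub>R x = r *\<^sub>R x" for x :: "complex ^ 'a" by simp
  ultimately show ?thesis by (simp add: sphere_mean_def)
qed

text \<open>The sub-mean-value property: the comparison of radii with inner radius \<open>0\<close>,
  applied to the translate of \<open>g\<close> by \<open>a\<close>.\<close>

lemma centre_le_ball_mean:
  assumes g: "hol_vec_on g UNIV" and \<delta>: "\<delta> > 0" and R: "0 \<le> R"
  shows "ln_trunc \<delta> (norm (g a)) \<le> (\<integral>x. ln_trunc \<delta> (norm (g (a + R *\<^sub>R x))) \<partial>ball_measure)"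
proof -
  have "hol_vec_on (\<lambda>z. g (a + z)) UNIV"
    unfolding hol_vec_on_def
  proof (intro conjI allI)
    show "continuous_on UNIV (\<lambda>z. g (a + z))"
      by (rule continuous_on_compose2[OF hol_vec_on_imp_continuous_on[OF g]]) (auto intro!: continuous_intros)
    show "(\<lambda>\<zeta>. g (a + (x + \<zeta> *s y))) holomorphic_on {\<zeta>. x + \<zeta> *s y \<in> UNIV}" for x y
      using hol_vec_on_line[OF g, of "a + x" y] by (simp add: add.assoc)
  qed
  from radial_mean_mono[OF this \<delta>, of "\<lambda>_. 0" "\<lambda>_. R" R]
  show ?thesis using R by (simp add: mult_left_le)
qed

text \<open>A lower bound that does not depend on the truncation: solid means around a point where
  \<open>g\<close> does not vanish control the solid mean over the unit ball, which in turn is dominated by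
  the spherical means.\<close>
lemma sphere_mean_lower_bound:
  fixes g :: "complex ^ 'm \<Rightarrow> complex"
  assumes g: "hol_vec_on g UNIV" and \<delta>: "0 < \<delta>" "\<delta> \<le> 1" and r: "1 \<le> r"
    and \<eta>: "0 < \<eta>" "\<eta> \<le> norm (g a)"
    and B: "0 \<le> B" "\<And>z. norm (z - a) \<le> norm a + 1 \<Longrightarrow> norm (g z) \<le> exp B"
  shows "B - (norm a + 1) ^ DIM(complex ^ 'm) * (B - ln \<eta>) \<le> sphere_mean r (\<lambda>z. ln_trunc \<delta> (norm (g z)))"
proof -
  \<comment> \<open>The least radius for which the ball around \<open>a\<close> contains the unit
    ball.\<close>
  define R where "R = norm a + 1"
  define U where "U = (\<lambda>z. ln_trunc \<delta> (norm (g z)))"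
  \<comment> \<open>\<open>B - U\<close> is known to be nonnegative only on
    \<open>cball a R\<close>; cutting it at \<open>0\<close> makes it nonnegative everywhere, as the
    comparison of nested balls requires.\<close>
  define v where "v = (\<lambda>z. max 0 (B - U z))"
  have U: "continuous_on UNIV U"
    unfolding U_def by (rule continuous_on_ln_trunc_hol[OF g \<delta>(1)])
  have v: "continuous_on UNIV v"
    unfolding v_def by (intro continuous_intros U)
  have R: "R > 0" by (simp add: R_def add_nonneg_pos)
  have int: "integrable ball_measure (\<lambda>x. u (b + c *\<^sub>R x))" if "continuous_on UNIV u"
    for u :: "complex ^ 'm \<Rightarrow> real" and b c
  proof -
    have "continuous_on UNIV (\<lambda>z. u (b + c *\<^sub>R z))"
      by (rule continuous_on_compose2[OF that]) (auto intro!: continuous_intros)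
    from radial_integrable[OF this, of "\<lambda>_. 1" 1] show ?thesis by simp
  qed
  have UB: "U z \<le> B" if "norm (z - a) \<le> R" for z
  proof -
    have "max (norm (g z)) \<delta> \<le> exp B" using B(2)[of z] that \<delta>(2) B(1) one_le_exp_iff[of B]
      by (auto simp: R_def simp del: one_le_exp_iff)
    thus ?thesis unfolding U_def ln_trunc_def using \<delta>(1)
      by (metis ln_exp ln_mono max.strict_coboundedI2)
  qed
  have "(\<integral>x. v (0 + 1 *\<^sub>R x) \<partial>ball_measure) \<le> (R / 1) ^ DIM(complex ^ 'm) * (\<integral>x. v (a + R *\<^sub>R x) \<partial>ball_measure)"
    by (rule integral_ball_measure_affine_le[OF v]) (auto simp: v_def R_def)
  also have "(\<integral>x. v (a + R *\<^sub>R x) \<partial>ball_measure) \<le> (\<integral>x. B - U (a + R *\<^sub>R x) \<partial>ball_measure)"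
  proof (rule integral_ball_measure_mono)
    show "v (a + R *\<^sub>R x) \<le> B - U (a + R *\<^sub>R x)" if "norm x < 1" for x
    proof -
      have "norm (a + R *\<^sub>R x - a) \<le> R" using that R by simp
      thus ?thesis unfolding v_def using UB by force
    qed
    show "integrable ball_measure (\<lambda>x. B - U (a + R *\<^sub>R x))"
      using int[of "\<lambda>z. B - U z" a R] U by (simp add: continuous_on_diff)
  qed (rule int[OF v])
  also have "\<dots> = B - (\<integral>x. U (a + R *\<^sub>R x) \<partial>ball_measure)"
    using int[OF U, of a R] finite_measure.integrable_const[OF finite_ball_measure, of B]
    by (subst Bochner_Integration.integral_diff) auto
  also have "\<dots> \<le> B - ln \<eta>"
  proof -
    have "ln \<eta> \<le> U a" using \<eta> unfolding U_def ln_trunc_def by (intro ln_mono) auto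
    also have "U a \<le> (\<integral>x. U (a + R *\<^sub>R x) \<partial>ball_measure)"
      unfolding U_def by (rule centre_le_ball_mean[OF g \<delta>(1)]) (use R in simp)
    finally show ?thesis by simp
  qed
  finally have 1: "(\<integral>x. v x \<partial>ball_measure) \<le> R ^ DIM(complex ^ 'm) * (B - ln \<eta>)"
    using R by (simp add: mult_left_mono)
  have "B - (\<integral>x. v x \<partial>ball_measure) = (\<integral>x. B - v x \<partial>ball_measure)"
    using int[OF v, of 0 1] finite_measure.integrable_const[OF finite_ball_measure, of B]
    by (subst Bochner_Integration.integral_diff) auto
  also have "\<dots> \<le> (\<integral>x. U x \<partial>ball_measure)"
  proof (rule integral_ball_measure_mono)
    show "integrable ball_measure (\<lambda>x. B - v x)"
      using int[of "\<lambda>z. B - v z" 0 1] v by (simp add: continuous_on_diff)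
    show "integrable ball_measure U" using int[OF U, of 0 1] by simp
    show "B - v x \<le> U x" if "norm x < 1" for x
      unfolding v_def by linarith
  qed
  also have "\<dots> \<le> sphere_mean 1 U"
    using ball_mean_le_sphere_mean[OF g \<delta>(1), of 1] by (simp add: U_def)
  also have "\<dots> \<le> sphere_mean r U"
    unfolding U_def by (rule sphere_mean_radius_mono[OF g \<delta>(1)]) (use r in auto)
  finally show ?thesis using 1 by (simp add: R_def U_def)
qed

text \<open>Monotonicity in the radius spreads the bound to all radii. A value of
  \<open>log_plus |f|\<close> is at most the mean over a ball around the point, hence a constant
  multiple of a mean over a centred ball. So \<open>f\<close> is bounded, and Liouville's theorem
  applies on each line through the origin.\<close>

lemma bounded_characteristic_imp_constant:
  fixes f :: "complex ^ 'm \<Rightarrow> complex"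
  assumes f: "hol_vec_on f UNIV"
    and bd: "\<And>R0. \<exists>r\<ge>R0. sphere_mean r (\<lambda>z. log_plus (norm (f z))) \<le> C"
  shows "\<exists>c. \<forall>z. f z = c"
proof -
  let ?d = "DIM(complex ^ 'm)"
  define U where "U = (\<lambda>z. log_plus (norm (f z)))"
  have U_eq: "U = (\<lambda>z. ln_trunc 1 (norm (f z)))" by (simp add: U_def ln_trunc_one)
  have U: "continuous_on UNIV U" unfolding U_def by (rule continuous_on_log_plus_hol[OF f])
  have bd': "sphere_mean r U \<le> C" if r: "r \<ge> 0" for r
  proof -
    obtain r' where "r' \<ge> r" "sphere_mean r' U \<le> C" using bd[of r] by (auto simp: U_def)
    thus ?thesis
      using sphere_mean_radius_mono[OF f, of 1 r r'] r by (simp add: U_eq)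
  qed
  have U_le: "U z \<le> 2 ^ ?d * C" for z
  proof -
    define R where "R = norm z + 1"
    have R: "R > 0" by (simp add: R_def add_nonneg_pos)
    have "U z \<le> (\<integral>x. U (z + R *\<^sub>R x) \<partial>ball_measure)"
      unfolding U_eq by (rule centre_le_ball_mean[OF f]) (use R in auto)
    \<comment> \<open>As \<open>R = norm z + 1\<close>, the ball of radius \<open>R\<close> around
      \<open>z\<close> lies in the centred ball of radius \<open>2 * R\<close>.\<close>
    also have "\<dots> \<le> (2 * R / R) ^ ?d * (\<integral>x. U (0 + (2 * R) *\<^sub>R x) \<partial>ball_measure)"
      by (rule integral_ball_measure_affine_le[OF U]) (use R in \<open>auto simp: U_def R_def\<close>)
    also have "(\<integral>x. U (0 + (2 * R) *\<^sub>R x) \<partial>ball_measure) \<le> sphere_mean (2 * R) U"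
      using ball_mean_le_sphere_mean[OF f, of 1 "2 * R"] R by (simp add: U_eq)
    also have "\<dots> \<le> C" using bd'[of "2 * R"] R by simp
    finally show ?thesis using R by (simp add: mult_left_mono)
  qed
  have fb: "norm (f z) \<le> exp (2 ^ ?d * C)" for z
  proof -
    have "max (norm (f z)) 1 = exp (U z)" by (simp add: U_eq exp_ln_trunc)
    also have "\<dots> \<le> exp (2 ^ ?d * C)" using U_le by simp
    finally show ?thesis by simp
  qed
  have "f z = f 0" for z
  proof -
    have "(\<lambda>\<zeta>. f (0 + \<zeta> *s z)) constant_on UNIV"
      using hol_vec_on_line[OF f, of 0 z] fb
      by (intro Liouville_theorem) (auto simp: bounded_iff)
    then obtain c where "\<And>\<zeta>. f (0 + \<zeta> *s z) = c" unfolding constant_on_def by blast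
    from this[of 1] this[of 0] show ?thesis by simp
  qed
  thus ?thesis by blast
qed

section \<open>Preimages under transcendental meromorphic functions\<close>

lemma poly_norm_le_power:
  fixes q :: "complex poly"
  assumes "norm z \<ge> 1"
  shows "norm (poly q z) \<le> (\<Sum>i\<le>degree q. norm (coeff q i)) * norm z ^ degree q"
proof -
  have "norm (poly q z) \<le> (\<Sum>i\<le>degree q. norm (coeff q i * z ^ i))"
    unfolding poly_altdef by (rule norm_sum)
  also have "\<dots> \<le> (\<Sum>i\<le>degree q. norm (coeff q i) * norm z ^ degree q)"
    using assms by (intro sum_mono) (auto simp: norm_mult norm_power intro!: mult_left_mono power_increasing)
  finally show ?thesis by (simp add: sum_distrib_right)
qed

lemma eventually_poly_nonzero_at:
  fixes q :: "complex poly"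
  assumes "q \<noteq> 0"
  shows "eventually (\<lambda>z. poly q z \<noteq> 0) (at w)"
proof -
  have "finite ({z. poly q z = 0} - {w})" using poly_roots_finite[OF assms] by simp
  hence "open (- ({z. poly q z = 0} - {w}))"
    by (intro open_Compl finite_imp_closed)
  from eventually_at_in_open[OF this, of w]
  show ?thesis by (simp add: eventually_mono)
qed

text \<open>Poles can only lie in the closed disc of radius \<open>R\<close>, so they are finitely
  many. Clearing them by a polynomial leaves an entire function of polynomial growth, which is a
  polynomial.\<close>

lemma meromorphic_bounded_imp_rational:
  assumes G: "G meromorphic_on UNIV"
    and bd: "\<And>z. eventually (\<lambda>w. norm w > R \<longrightarrow> norm (G w) \<le> C) (at z)"
  shows "\<exists>p q :: complex poly. q \<noteq> 0 \<and> (\<forall>\<^sub>\<approx>z. G z = poly p z / poly q z)"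
proof -
  define P where "P = {z. is_pole G z}"
  have iso: "isolated_singularity_at G z" and ness: "not_essential G z" for z
    using meromorphic_on_subset[OF G, of "{z}"] meromorphic_on_isolated_singularity
      meromorphic_on_not_essential by auto
  have P_sub: "P \<subseteq> cball 0 R"
  proof
    fix z assume "z \<in> P"
    hence pole: "is_pole G z" by (simp add: P_def)
    show "z \<in> cball 0 R"
    proof (rule ccontr)
      assume "z \<notin> cball 0 R"
      hence "z \<in> - cball 0 R" by simp
      hence "eventually (\<lambda>w. w \<in> - cball 0 R) (at z)"
        by (intro eventually_at_in_open') auto
      moreover have "eventually (\<lambda>w. norm (G w) \<ge> C + 1) (at z)"
        using pole unfolding is_pole_def filterlim_at_infinity[OF order.refl]
        by (metis add_increasing2 filterlim_at_infinity_imp_norm_at_top filterlim_at_top order.refl pole is_pole_def)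
      ultimately have "eventually (\<lambda>w. False) (at z)"
        using bd[of z] by eventually_elim auto
      thus False by simp
    qed
  qed
  have "P sparse_in UNIV"
    using meromorphic_on_imp_not_pole_cosparse[OF G] by (simp add: eventually_cosparse P_def)
  hence "P sparse_in cball 0 R" by (rule sparse_in_subset) simp
  hence "finite (cball 0 R \<inter> P)" by (rule sparse_in_compact_finite) simp
  hence finP: "finite P" using P_sub by (simp add: Int_absorb1)
  have "\<exists>k c. ((\<lambda>w. (w - p) ^ k * G w) \<longlongrightarrow> c) (at p)" if p: "p \<in> P" for p
  proof -
    obtain r where r: "r > 0" "G analytic_on ball p r - {p}"
      using iso[of p] unfolding isolated_singularity_at_def by blast
    have "G holomorphic_on ball p r - {p}" using r(2) by (rule analytic_imp_holomorphic)
    from zorder_exist_pole[OF this] r(1) p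
    obtain r' where r': "r' > 0" "zor_poly G p holomorphic_on cball p r'"
      "\<And>w. w \<in> cball p r' - {p} \<Longrightarrow> G w = zor_poly G p w / (w - p) ^ nat (- zorder G p)"
      unfolding P_def by auto
    have "isCont (zor_poly G p) p"
      using r'(1,2) holomorphic_on_imp_continuous_on continuous_on_interior[of "cball p r'" "zor_poly G p" p]
      by simp
    hence lim: "(zor_poly G p \<longlongrightarrow> zor_poly G p p) (at p)" by (simp add: isCont_def)
    have "eventually (\<lambda>w. w \<in> ball p r' - {p}) (at p)"
      using r'(1) by (intro eventually_at_in_open) auto
    hence "eventually (\<lambda>w. zor_poly G p w = (w - p) ^ nat (- zorder G p) * G w) (at p)"
      by eventually_elim (use r'(3) in auto)
    from Lim_transform_eventually[OF lim this] show ?thesis by blast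
  qed
  then obtain k c where kc: "\<And>p. p \<in> P \<Longrightarrow> ((\<lambda>w. (w - p) ^ k p * G w) \<longlongrightarrow> c p) (at p)"
    by metis
  define q where "q = (\<Prod>p\<in>P. [:-p, 1:] ^ k p)"
  have q0: "q \<noteq> 0" using finP by (simp add: q_def)
  define Gq where "Gq = (\<lambda>z. G z * poly q z)"
  define H where "H = remove_sings Gq"
  have Gq_mero: "Gq meromorphic_on UNIV"
    unfolding Gq_def
    by (intro meromorphic_on_mult G analytic_on_imp_meromorphic_on)
       (simp add: poly_altdef[abs_def] analytic_intros)
  have lim: "\<exists>c. (Gq \<longlongrightarrow> c) (at z)" for z
  proof (cases "z \<in> P")
    case True
    have "Gq w = ((w - z) ^ k z * G w) * (\<Prod>p\<in>P - {z}. (w - p) ^ k p)" for w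
      using True finP unfolding Gq_def q_def poly_prod
      by (subst prod.remove[of P z]) (simp_all add: poly_power mult_ac)
    moreover have "((\<lambda>w. ((w - z) ^ k z * G w) * (\<Prod>p\<in>P - {z}. (w - p) ^ k p)) \<longlongrightarrow>
        c z * (\<Prod>p\<in>P - {z}. (z - p) ^ k p)) (at z)"
      by (intro tendsto_mult kc True tendsto_prod tendsto_power tendsto_diff tendsto_const tendsto_ident_at)
    ultimately show ?thesis by (metis (no_types, lifting) ext)
  next
    case False
    then obtain c where "(G \<longlongrightarrow> c) (at z)"
      using ness[of z] unfolding not_essential_def P_def by blast
    moreover have "(poly q \<longlongrightarrow> poly q z) (at z)"
      using poly_isCont[of z q] by (simp add: isCont_def)
    ultimately have "(Gq \<longlongrightarrow> c * poly q z) (at z)" unfolding Gq_def by (rule tendsto_mult)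
    thus ?thesis by blast
  qed
  have "H analytic_on {z}" for z
  proof -
    obtain c where "(Gq \<longlongrightarrow> c) (at z)" using lim by blast
    moreover have "isolated_singularity_at Gq z"
      using meromorphic_on_subset[OF Gq_mero, of "{z}"] meromorphic_on_isolated_singularity by blast
    ultimately show ?thesis unfolding H_def by (intro remove_sings_analytic_at)
  qed
  hence "H analytic_on UNIV" using analytic_on_analytic_at by blast
  hence H: "H holomorphic_on UNIV" by (rule analytic_imp_holomorphic)
  have HG: "eventually (\<lambda>w. H w = Gq w) (at z)" for z
    using eventually_remove_sings_eq[OF Gq_mero] unfolding H_def
    by (simp add: eventually_cosparse_open_eq)
  \<comment> \<open>The hypothesis speaks of punctured neighbourhoods only; continuity of
    \<open>H\<close> carries the bound to \<open>z\<close> itself.\<close>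
  have Hbd: "norm (H z) \<le> C * norm (poly q z)" if z: "norm z > R" for z
  proof (rule tendsto_le[of "at z"])
    have "isCont H z"
      using H holomorphic_on_imp_continuous_on[OF H] by (simp add: continuous_on_eq_continuous_at)
    thus "((\<lambda>w. norm (H w)) \<longlongrightarrow> norm (H z)) (at z)"
      by (intro tendsto_norm) (simp add: isCont_def)
    show "((\<lambda>w. C * norm (poly q w)) \<longlongrightarrow> C * norm (poly q z)) (at z)"
      using poly_isCont[of z q] by (intro tendsto_mult tendsto_const tendsto_norm) (simp add: isCont_def)
    have "eventually (\<lambda>w. w \<in> - cball 0 R) (at z)"
      using z by (intro eventually_at_in_open') auto
    thus "eventually (\<lambda>w. norm (H w) \<le> C * norm (poly q w)) (at z)"
      using bd[of z] HG[of z]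
      by eventually_elim (auto simp: Gq_def norm_mult intro!: mult_right_mono)
  qed simp
  define A where "A = (\<Sum>i\<le>degree q. norm (coeff q i))"
  define C' where "C' = max C 0"
  have H_sum: "H z = (\<Sum>k\<le>degree q. (deriv ^^ k) H 0 / fact k * z ^ k)" for z
  proof (rule Liouville_polynomial[OF H, where A = "max 1 (R + 1)" and B = "C' * A"])
    fix z :: complex assume z: "max 1 (R + 1) \<le> norm z"
    have "norm (H z) \<le> C * norm (poly q z)" using z by (intro Hbd) auto
    also have "\<dots> \<le> C' * norm (poly q z)" by (intro mult_right_mono) (auto simp: C'_def)
    also have "\<dots> \<le> C' * (A * norm z ^ degree q)"
      unfolding A_def using z by (intro mult_left_mono poly_norm_le_power) (auto simp: C'_def)
    finally show "norm (H z) \<le> C' * A * norm z ^ degree q" by (simp add: mult_ac)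
  qed
  define p where "p = (\<Sum>k\<le>degree q. monom ((deriv ^^ k) H 0 / fact k) k)"
  have Hp: "H z = poly p z" for z
    unfolding p_def poly_sum poly_monom by (rule H_sum)
  have "eventually (\<lambda>w. G w = poly p w / poly q w) (at z)" for z
    using HG[of z] eventually_poly_nonzero_at[OF q0, of z]
    by eventually_elim (simp add: Hp Gq_def)
  hence "\<forall>\<^sub>\<approx>z. G z = poly p z / poly q z"
    by (simp add: eventually_cosparse_open_eq)
  thus ?thesis using q0 by blast
qed

text \<open>Casorati-Weierstrass at infinity: if \<open>F\<close> avoided a disc around
  \<open>v\<close> outside a bounded set, \<open>1 / (F - v)\<close> would be bounded there, hence
  rational, and so would be \<open>F\<close>.\<close>

lemma transcendental_mero_dense_image:
  assumes F: "transcendental_mero F" and V: "open V" "v \<in> V"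
  shows "\<exists>z. norm z > R \<and> F analytic_on {z} \<and> F z \<in> V"
proof (rule ccontr)
  assume contra: "\<not> ?thesis"
  have mero: "F meromorphic_on UNIV" using F by (simp add: transcendental_mero_def)
  obtain e where e: "e > 0" "ball v e \<subseteq> V" using openE[OF V] by blast
  define G where "G = (\<lambda>z. inverse (F z - v))"
  have "G meromorphic_on UNIV"
    unfolding G_def by (intro meromorphic_on_inverse meromorphic_on_diff mero meromorphic_on_const)
  moreover have "eventually (\<lambda>w. norm w > R \<longrightarrow> norm (G w) \<le> inverse e) (at z)" for z
  proof -
    have "eventually (\<lambda>w. F analytic_on {w}) (at z)"
      using meromorphic_on_imp_analytic_cosparse[OF mero] by (simp add: eventually_cosparse_open_eq)
    thus ?thesis
    proof eventually_elim
      case (elim w)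
      show ?case
      proof
        assume "norm w > R"
        hence "F w \<notin> ball v e" using contra elim e(2) by blast
        hence "e \<le> norm (F w - v)" by (simp add: dist_norm norm_minus_commute)
        thus "norm (G w) \<le> inverse e"
          unfolding G_def norm_inverse using e(1) by (intro le_imp_inverse_le)
      qed
    qed
  qed
  ultimately obtain p q :: "complex poly" where
    pq: "q \<noteq> 0" "\<forall>\<^sub>\<approx>z. G z = poly p z / poly q z"
    using meromorphic_bounded_imp_rational by blast
  have "\<exists>p q :: complex poly. q \<noteq> 0 \<and> (\<forall>\<^sub>\<approx>z. F z = poly p z / poly q z)"
  proof (cases "p = 0")
    \<comment> \<open>By the convention \<open>inverse 0 = 0\<close>, a zero of \<open>G\<close> is
      a point where \<open>F\<close> equals \<open>v\<close>.\<close>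
    case True
    have "\<forall>\<^sub>\<approx>z. F z = poly [:v:] z / poly 1 z"
      using pq(2) by eventually_elim (simp add: G_def True)
    moreover have "(1 :: complex poly) \<noteq> 0" by simp
    ultimately show ?thesis by blast
  next
    case False
    have "\<forall>\<^sub>\<approx>z. poly p z \<noteq> 0"
      using eventually_poly_nonzero_at[OF False] by (simp add: eventually_cosparse_open_eq)
    hence "\<forall>\<^sub>\<approx>z. F z = poly ([:v:] * p + q) z / poly p z"
      using pq(2)
    proof eventually_elim
      case (elim z)
      have "F z - v = inverse (G z)" by (simp add: G_def)
      also have "\<dots> = poly q z / poly p z" using elim by simp
      finally show ?case using elim by (simp add: field_simps)
    qed
    thus ?thesis using False by blast
  qed
  thus False using F by (simp add: transcendental_mero_def)
qed

text \<open>Off a sparse set, a meromorphic function on the plane is identically \<open>c\<close> or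
  avoids \<open>c\<close>; the former would make \<open>F\<close> rational. This gives access to the
  open mapping theorem on every disc of holomorphy.\<close>

lemma transcendental_mero_not_constant_on:
  assumes F: "transcendental_mero F" and S: "open S" "S \<noteq> {}"
  shows "\<not> F constant_on S"
proof
  assume "F constant_on S"
  then obtain c where c: "\<And>z. z \<in> S \<Longrightarrow> F z = c" unfolding constant_on_def by blast
  obtain z where z: "z \<in> S" using S(2) by blast
  have mero: "F meromorphic_on UNIV" using F by (simp add: transcendental_mero_def)
  have "\<not> (\<forall>\<^sub>\<approx>z. F z = c)"
  proof
    assume "\<forall>\<^sub>\<approx>z. F z = c"
    hence "(1 :: complex poly) \<noteq> 0 \<and> (\<forall>\<^sub>\<approx>z. F z = poly [:c:] z / poly 1 z)" by simp
    thus False using F unfolding transcendental_mero_def by blast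
  qed
  hence "\<forall>\<^sub>\<approx>z. F z \<noteq> c"
    using meromorphic_imp_constant_or_avoid[OF mero open_UNIV connected_UNIV, of c] by blast
  hence "eventually (\<lambda>w. F w \<noteq> c) (at z)" by (simp add: eventually_cosparse_open_eq)
  moreover have "eventually (\<lambda>w. w \<in> S) (at z)" using S(1) z by (rule eventually_at_in_open')
  ultimately have "eventually (\<lambda>w. False) (at z)" by eventually_elim (use c in auto)
  thus False by simp
qed

text \<open>The scales have different tasks: preimages will lie in discs of radius \<open>s\<close>,
  \<open>F\<close> will be Lipschitz on radius \<open>2 * s\<close>, for which holomorphy on radius
  \<open>3 * s\<close> leaves room, and the gap \<open>4 * s\<close> keeps the discs of radius
  \<open>2 * s\<close> disjoint.\<close>

lemma analytic_separated_balls: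
  fixes Z :: "complex set"
  assumes Z: "finite Z" "\<And>z. z \<in> Z \<Longrightarrow> F analytic_on {z}"
  obtains s where "s > 0" "\<And>z. z \<in> Z \<Longrightarrow> F holomorphic_on ball z (3 * s)"
    "\<And>z z'. z \<in> Z \<Longrightarrow> z' \<in> Z \<Longrightarrow> z \<noteq> z' \<Longrightarrow> 4 * s \<le> dist z z'"
proof -
  have "\<exists>s>0. (\<forall>z\<in>Z. F holomorphic_on ball z (3 * s)) \<and> (\<forall>z\<in>Z. \<forall>z'\<in>Z. z \<noteq> z' \<longrightarrow> 4 * s \<le> dist z z')"
    using Z
  proof (induction Z rule: finite_induct)
    case empty
    show ?case by (intro exI[of _ 1]) simp
  next
    case (insert x Z)
    then obtain s where s: "s > 0" "\<forall>z\<in>Z. F holomorphic_on ball z (3 * s)"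
      "\<forall>z\<in>Z. \<forall>z'\<in>Z. z \<noteq> z' \<longrightarrow> 4 * s \<le> dist z z'" by auto
    obtain e where e: "e > 0" "F holomorphic_on ball x e"
      using insert.prems[of x] unfolding analytic_on_def by auto
    obtain d where d: "d > 0" "\<forall>z\<in>Z. z \<noteq> x \<longrightarrow> d \<le> dist x z"
      using finite_set_avoid[OF insert.hyps(1)] by blast
    define t where "t = Min {s, e / 3, d / 4}"
    have t: "t > 0" "t \<le> s" "3 * t \<le> e" "4 * t \<le> d"
      using s(1) e(1) d(1) by (auto simp: t_def min_def)
    have "F holomorphic_on ball z (3 * t)" if "z \<in> insert x Z" for z
    proof (cases "z = x")
      case True
      thus ?thesis using t(3) by (intro holomorphic_on_subset[OF e(2)]) auto
    next
      case False
      hence "F holomorphic_on ball z (3 * s)" using that s(2) by blast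
      thus ?thesis using t(2) by (rule_tac holomorphic_on_subset) auto
    qed
    moreover have "4 * t \<le> dist z z'" if zz: "z \<in> insert x Z" "z' \<in> insert x Z" "z \<noteq> z'" for z z'
    proof -
      consider "z = x" "z' \<in> Z" | "z' = x" "z \<in> Z" | "z \<in> Z" "z' \<in> Z"
        using zz by blast
      thus ?thesis
      proof cases
        case 1 thus ?thesis using d(2) t(4) zz(3) by force
      next
        case 2 thus ?thesis using d(2) t(4) zz(3) by (metis dist_commute order_trans)
      next
        case 3 thus ?thesis using s(3) t(2) zz(3) by (meson mult_left_mono order_trans zero_le_numeral)
      qed
    qed
    ultimately show ?case using t(1) by blast
  qed
  thus ?thesis using that by blast
qed

lemma transcendental_mero_open_image_ball:
  assumes "transcendental_mero F" "F holomorphic_on ball z r" "r > 0"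
  shows "open (F ` ball z r)"
proof (rule open_mapping_thm[OF assms(2)])
  show "\<not> F constant_on ball z r"
    using assms by (intro transcendental_mero_not_constant_on) auto
qed auto

text \<open>By the open mapping theorem the small discs around the old points all map onto
  neighbourhoods of the old value. A nearby value taken far away yields the new preimage, while each
  old point moves inside its disc to a preimage of the new value.\<close>

lemma transcendental_mero_many_preimages:
  assumes F: "transcendental_mero F"
  shows "open V \<Longrightarrow> V \<noteq> {} \<Longrightarrow> \<exists>a\<in>V. \<exists>Z. finite Z \<and> card Z = K \<and> (\<forall>z\<in>Z. F analytic_on {z} \<and> F z = a)"
proof (induction K)
  case 0
  then obtain a where "a \<in> V" by blast
  thus ?case by (intro bexI[of _ a] exI[of _ "{}"]) auto
next
  case (Suc K)
  then obtain a Z where a: "a \<in> V" and Z: "finite Z" "card Z = K"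
    "\<And>z. z \<in> Z \<Longrightarrow> F analytic_on {z}" "\<And>z. z \<in> Z \<Longrightarrow> F z = a" by blast
  obtain s where s: "s > 0" "\<And>z. z \<in> Z \<Longrightarrow> F holomorphic_on ball z (3 * s)"
    "\<And>z z'. z \<in> Z \<Longrightarrow> z' \<in> Z \<Longrightarrow> z \<noteq> z' \<Longrightarrow> 4 * s \<le> dist z z'"
    using analytic_separated_balls[OF Z(1,3)] by blast
  have hol: "F holomorphic_on ball z s" if "z \<in> Z" for z
    using s(1) by (intro holomorphic_on_subset[OF s(2)[OF that]]) auto
  define V' where "V' = V \<inter> (\<Inter>z\<in>Z. F ` ball z s)"
  have "open V'"
    unfolding V'_def using Z(1) s(1) Suc.prems(1) hol F
    by (intro open_Int open_INT transcendental_mero_open_image_ball ballI) auto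
  moreover have "a \<in> V'"
  proof -
    have "a \<in> F ` ball z s" if "z \<in> Z" for z
      using Z(4)[OF that] s(1) by (intro image_eqI[of _ _ z]) auto
    thus ?thesis using a by (simp add: V'_def)
  qed
  moreover obtain R where R: "\<And>z. z \<in> Z \<Longrightarrow> norm z \<le> R"
    using finite_imp_bounded[OF Z(1)] unfolding bounded_iff by blast
  \<comment> \<open>Beyond \<open>R + s\<close> the point \<open>z'\<close> differs from all moved
    points, which lie within \<open>s\<close> of points of norm at most \<open>R\<close>.\<close>
  ultimately obtain z' where z': "norm z' > R + s" "F analytic_on {z'}" "F z' \<in> V'"
    using transcendental_mero_dense_image[OF F] by blast
  have "\<forall>z\<in>Z. \<exists>w\<in>ball z s. F w = F z'"
    using z'(3) unfolding V'_def by fastforce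
  then obtain w where w: "\<And>z. z \<in> Z \<Longrightarrow> w z \<in> ball z s" "\<And>z. z \<in> Z \<Longrightarrow> F (w z) = F z'" by metis
  have "inj_on w Z"
  proof (rule inj_onI, rule ccontr)
    fix x y assume xy: "x \<in> Z" "y \<in> Z" "w x = w y" "x \<noteq> y"
    hence "4 * s \<le> dist x y" by (intro s(3))
    moreover have "dist x y \<le> dist x (w x) + dist y (w x)" by (rule dist_triangle2)
    ultimately show False using w(1)[OF xy(1)] w(1)[OF xy(2)] xy(3) s(1) by simp
  qed
  hence "card (w ` Z) = K" using Z(2) by (simp add: card_image)
  moreover have "z' \<notin> w ` Z"
  proof
    assume "z' \<in> w ` Z"
    then obtain z where z: "z \<in> Z" "z' = w z" by blast
    have "norm (w z) \<le> norm z + dist z (w z)"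
      using norm_triangle_sub[of "w z" z] by (simp add: dist_norm norm_minus_commute)
    thus False using R[OF z(1)] w(1)[OF z(1)] z'(1) z(2) by simp
  qed
  ultimately have "card (insert z' (w ` Z)) = Suc K" using Z(1) by simp
  moreover have "F analytic_on {w z}" if "z \<in> Z" for z
    using hol[OF that] w(1)[OF that] open_ball holomorphic_on_imp_analytic_at by blast
  ultimately show ?case
    using z' w(2) Z(1) unfolding V'_def
    by (intro bexI[of _ "F z'"] exI[of _ "insert z' (w ` Z)"]) auto
qed

text \<open>Passes from one value with \<open>K\<close> preimages to a disc of such values, because
  finitely many open images share a neighbourhood of \<open>a0\<close>. The Lipschitz bound will
  show that well separated values have well separated preimages in each disc.\<close>

lemma transcendental_mero_branches:
  assumes F: "transcendental_mero F" and V: "open V" "V \<noteq> {}"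
  obtains a0 s \<epsilon> Z \<Lambda> where "a0 \<in> V" "s > 0" "\<epsilon> > 0" "\<Lambda> > 0" "finite Z" "card Z = K"
    "\<And>z. z \<in> Z \<Longrightarrow> F holomorphic_on ball z (3 * s)"
    "\<And>z z'. z \<in> Z \<Longrightarrow> z' \<in> Z \<Longrightarrow> z \<noteq> z' \<Longrightarrow> 4 * s \<le> dist z z'"
    "\<And>z a. z \<in> Z \<Longrightarrow> a \<in> ball a0 \<epsilon> \<Longrightarrow> \<exists>w\<in>ball z s. F w = a"
    "\<And>z w w'. z \<in> Z \<Longrightarrow> w \<in> ball z (2 * s) \<Longrightarrow> w' \<in> ball z (2 * s) \<Longrightarrow> norm (F w - F w') \<le> \<Lambda> * norm (w - w')"
    "\<And>z w. z \<in> Z \<Longrightarrow> w \<in> ball z (2 * s) \<Longrightarrow> norm (deriv F w) \<le> \<Lambda>"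
proof -
  obtain a0 Z where a0: "a0 \<in> V" and Z: "finite Z" "card Z = K"
    "\<And>z. z \<in> Z \<Longrightarrow> F analytic_on {z}" "\<And>z. z \<in> Z \<Longrightarrow> F z = a0"
    using transcendental_mero_many_preimages[OF F V] by blast
  obtain s where s: "s > 0" "\<And>z. z \<in> Z \<Longrightarrow> F holomorphic_on ball z (3 * s)"
    "\<And>z z'. z \<in> Z \<Longrightarrow> z' \<in> Z \<Longrightarrow> z \<noteq> z' \<Longrightarrow> 4 * s \<le> dist z z'"
    using analytic_separated_balls[OF Z(1,3)] by blast
  define W where "W = (\<Inter>z\<in>Z. F ` ball z s)"
  have hol: "F holomorphic_on ball z s" if "z \<in> Z" for z
    using s(1) by (intro holomorphic_on_subset[OF s(2)[OF that]]) auto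
  have W: "open W"
    unfolding W_def using Z(1) s(1) hol F
    by (intro open_INT transcendental_mero_open_image_ball ballI) auto
  have "a0 \<in> F ` ball z s" if "z \<in> Z" for z
    using Z(4)[OF that] s(1) by (intro image_eqI[of _ _ z]) auto
  hence "a0 \<in> W" by (simp add: W_def)
  then obtain \<epsilon> where \<epsilon>: "\<epsilon> > 0" "ball a0 \<epsilon> \<subseteq> W" using openE[OF W] by blast
  have "\<exists>B. \<forall>w\<in>cball z (2 * s). norm (deriv F w) \<le> B" if z: "z \<in> Z" for z
  proof -
    have "deriv F holomorphic_on ball z (3 * s)"
      using s(2)[OF z] by (rule holomorphic_deriv) simp
    hence "continuous_on (cball z (2 * s)) (deriv F)"
      using s(1) by (intro continuous_on_subset[OF holomorphic_on_imp_continuous_on]) auto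
    hence "compact (deriv F ` cball z (2 * s))" by (intro compact_continuous_image) auto
    thus ?thesis using compact_imp_bounded bounded_iff by (metis imageI)
  qed
  then obtain B where B: "\<And>z w. z \<in> Z \<Longrightarrow> w \<in> cball z (2 * s) \<Longrightarrow> norm (deriv F w) \<le> B z" by metis
  \<comment> \<open>The sum gives one constant for all discs, and the summand \<open>1\<close> keeps
    it positive even for empty \<open>Z\<close>.\<close>
  define \<Lambda> where "\<Lambda> = 1 + (\<Sum>z\<in>Z. \<bar>B z\<bar>)"
  have \<Lambda>: "\<Lambda> > 0" by (simp add: \<Lambda>_def add_pos_nonneg sum_nonneg)
  have B\<Lambda>: "B z \<le> \<Lambda>" if "z \<in> Z" for z
    using member_le_sum[OF that, of "\<lambda>z. \<bar>B z\<bar>"] Z(1) by (simp add: \<Lambda>_def)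
  have dF: "norm (deriv F w) \<le> \<Lambda>" if "z \<in> Z" "w \<in> ball z (2 * s)" for z w
    using B[OF that(1), of w] B\<Lambda>[OF that(1)] that(2) by auto
  have lip: "norm (F w - F w') \<le> \<Lambda> * norm (w - w')"
    if z: "z \<in> Z" "w \<in> ball z (2 * s)" "w' \<in> ball z (2 * s)" for z w w'
  proof (rule field_differentiable_bound[of "ball z (2 * s)" F "deriv F"])
    fix x assume x: "x \<in> ball z (2 * s)"
    have "x \<in> ball z (3 * s)" using x s(1) by auto
    thus "(F has_field_derivative deriv F x) (at x within ball z (2 * s))"
      using holomorphic_derivI[OF s(2)[OF z(1)] open_ball] by blast
  qed (use z dF in auto)
  show ?thesis
  proof (rule that[OF a0 s(1) \<epsilon>(1) \<Lambda> Z(1,2) s(2) s(3) _ lip dF])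
    fix z a assume "z \<in> Z" "a \<in> ball a0 \<epsilon>"
    hence "a \<in> F ` ball z s" using \<epsilon>(2) unfolding W_def by blast
    thus "\<exists>w\<in>ball z s. F w = a" by blast
  qed
qed

section \<open>Averaged logarithmic potentials of separated points\<close>

text \<open>The logarithm of the weak Stirling bound \<open>L! \<ge> (L / e)^L\<close>; the
  induction step is \<open>(1 + 1 / L)^L \<le> e\<close>.\<close>

lemma ln_ratio_sum_le: "L * ln (real L) - (\<Sum>i=1..L. ln (real i)) \<le> L"
proof (induction L)
  case (Suc L)
  show ?case
  proof (cases "L = 0")
    case False
    have "ln (real (Suc L)) - ln (real L) = ln (1 + 1 / real L)"
    proof -
      have "1 + 1 / real L = real (Suc L) / real L" using False by (simp add: field_simps)
      thus ?thesis using False by (simp only: ln_div) (simp add: ln_div)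
    qed
    also have "\<dots> \<le> 1 / real L" using False by (intro ln_add_one_self_le_self) auto
    finally have "L * (ln (real (Suc L)) - ln (real L)) \<le> L * (1 / real L)"
      by (rule mult_left_mono) simp
    hence "L * ln (real (Suc L)) - L * ln (real L) \<le> 1"
      using False by (simp add: algebra_simps)
    with Suc show ?thesis by (simp add: algebra_simps)
  qed simp
qed simp

text \<open>Equally spaced points cannot cluster, so averaging the logarithmic potentials of their
  unit masses loses only a constant against \<open>log_plus\<close>, whatever the position of \<open>w\<close>.\<close>
lemma ln_trunc_average:
  fixes p :: "nat \<Rightarrow> complex"
  assumes L: "L > 0" and c: "c > 0" and M: "M \<ge> 0" and \<delta>: "0 < \<delta>" "\<delta> \<le> 1"
    and pM: "\<And>j. j < L \<Longrightarrow> norm (p j) \<le> M"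
    and sep: "\<And>i j. i < L \<Longrightarrow> j < L \<Longrightarrow> c * \<bar>real i - real j\<bar> / L \<le> norm (p i - p j)"
  shows "L * (log_plus (norm w) - (ln (2 * M + 2) + \<bar>ln (c / 2)\<bar> + 2)) + ln \<delta> \<le>
    (\<Sum>j<L. ln_trunc \<delta> (norm (w - p j)))"
proof (cases "norm w \<ge> 2 * M + 2")
  \<comment> \<open>Far away, each distance to \<open>w\<close> is at least
    \<open>norm w / 2\<close>, which costs only \<open>ln 2\<close> per point.\<close>
  case True
  have "log_plus (norm w) - (ln (2 * M + 2) + \<bar>ln (c / 2)\<bar> + 2) \<le> ln_trunc \<delta> (norm (w - p j))" if "j < L" for j
  proof -
    have "norm w - norm (p j) \<le> norm (w - p j)" by (rule norm_triangle_ineq2)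
    hence "norm w / 2 \<le> norm (w - p j)" using pM[OF that] True M by simp
    hence "ln (norm w / 2) \<le> ln_trunc \<delta> (norm (w - p j))"
      unfolding ln_trunc_def using True M by (intro ln_mono) auto
    moreover have "ln (norm w / 2) = log_plus (norm w) - ln 2"
    proof -
      have "norm w > 1" using True M by linarith
      thus ?thesis by (subst ln_div) (auto simp: log_plus_def)
    qed
    moreover have "ln 2 \<le> ln (2 * M + 2)" using M by (intro ln_mono) auto
    ultimately show ?thesis by linarith
  qed
  hence "(\<Sum>j<L. log_plus (norm w) - (ln (2 * M + 2) + \<bar>ln (c / 2)\<bar> + 2)) \<le> (\<Sum>j<L. ln_trunc \<delta> (norm (w - p j)))"
    by (intro sum_mono) auto
  moreover have "ln \<delta> \<le> 0" using \<delta> by simp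
  ultimately show ?thesis by simp
next
  case False
  have lp: "log_plus (norm w) \<le> ln (2 * M + 2)"
    unfolding log_plus_def using False M by (auto intro!: ln_mono)
  \<comment> \<open>The nearest point is the only one whose distance to \<open>w\<close> has no
    lower bound; it is left to the truncation and causes the summand \<open>ln \<delta>\<close>. For
    any other point, its distance to \<open>p m\<close> is at most twice its distance to
    \<open>w\<close>.\<close>
  define m where "m = arg_min_on (\<lambda>j. norm (w - p j)) {..<L}"
  have m: "m < L" "\<And>j. j < L \<Longrightarrow> norm (w - p m) \<le> norm (w - p j)"
    using arg_min_if_finite(1)[of "{..<L}" "\<lambda>j. norm (w - p j)"]
      arg_min_least[of "{..<L}" _ "\<lambda>j. norm (w - p j)"] L by (auto simp: m_def)
  define h where "h = (\<lambda>i::nat. ln (real L) - ln (real i))"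
  have h0: "h i \<ge> 0" if "i \<in> {1..L}" for i using that by (auto simp: h_def)
  have hsum: "(\<Sum>i\<in>I. h i) \<le> L" if "I \<subseteq> {1..L}" for I
  proof -
    have "(\<Sum>i\<in>I. h i) \<le> (\<Sum>i=1..L. h i)" using that h0 by (intro sum_mono2) auto
    also have "\<dots> = L * ln (real L) - (\<Sum>i=1..L. ln (real i))" by (simp add: h_def sum_subtractf)
    also have "\<dots> \<le> L" by (rule ln_ratio_sum_le)
    finally show ?thesis .
  qed
  \<comment> \<open>Each index gap occurs at most once on either side of \<open>m\<close>, so each
    side loses at most \<open>L\<close> by \<open>hsum\<close>; this is the origin of the summand
    \<open>2\<close> in the constant.\<close>
  define d where "d = (\<lambda>j. if j < m then m - j else j - m)"
  have bound: "- \<bar>ln (c / 2)\<bar> - h (d j) \<le> ln_trunc \<delta> (norm (w - p j))" if j: "j < L" "j \<noteq> m" for j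
  proof -
    have dj: "real (d j) = \<bar>real j - real m\<bar>" "d j > 0" using j by (auto simp: d_def)
    have "c * \<bar>real j - real m\<bar> / L \<le> norm (p j - p m)" using sep j m(1) by blast
    also have "\<dots> \<le> norm (w - p j) + norm (w - p m)"
      using norm_triangle_ineq4[of "w - p m" "w - p j"] by simp
    also have "\<dots> \<le> 2 * norm (w - p j)" using m(2)[OF j(1)] by simp
    finally have "(c / 2) * (d j / L) \<le> norm (w - p j)" by (simp add: dj)
    hence "ln ((c / 2) * (d j / L)) \<le> ln_trunc \<delta> (norm (w - p j))"
      unfolding ln_trunc_def using c dj(2) L by (intro ln_mono) auto
    moreover have "ln ((c / 2) * (d j / L)) = ln (c / 2) - h (d j)"
      using c dj(2) L by (simp add: h_def ln_mult ln_div)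
    ultimately show ?thesis by linarith
  qed
  have left: "(\<Sum>j<m. h (d j)) \<le> L"
  proof -
    have "inj_on d {..<m}" by (auto simp: inj_on_def d_def)
    hence "(\<Sum>j<m. h (d j)) = (\<Sum>i\<in>d ` {..<m}. h i)" by (simp add: sum.reindex)
    also have "\<dots> \<le> L" using m(1) by (intro hsum) (auto simp: d_def)
    finally show ?thesis .
  qed
  have right: "(\<Sum>j\<in>{m<..<L}. h (d j)) \<le> L"
  proof -
    have "inj_on d {m<..<L}" by (auto simp: inj_on_def d_def)
    hence "(\<Sum>j\<in>{m<..<L}. h (d j)) = (\<Sum>i\<in>d ` {m<..<L}. h i)" by (simp add: sum.reindex)
    also have "\<dots> \<le> L" using m(1) by (intro hsum) (auto simp: d_def)
    finally show ?thesis .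
  qed
  have split: "{..<L} - {m} = {..<m} \<union> {m<..<L}" using m(1) by auto
  have "(\<Sum>j\<in>{..<L} - {m}. h (d j)) = (\<Sum>j<m. h (d j)) + (\<Sum>j\<in>{m<..<L}. h (d j))"
    unfolding split by (rule sum.union_disjoint) auto
  hence hs: "(\<Sum>j\<in>{..<L} - {m}. h (d j)) \<le> 2 * real L" using left right by linarith
  have "- (L * \<bar>ln (c / 2)\<bar>) - 2 * L \<le> (\<Sum>j\<in>{..<L} - {m}. - \<bar>ln (c / 2)\<bar> - h (d j))"
  proof -
    have "(\<Sum>j\<in>{..<L} - {m}. - \<bar>ln (c / 2)\<bar> - h (d j)) =
       - (real (card ({..<L} - {m})) * \<bar>ln (c / 2)\<bar>) - (\<Sum>j\<in>{..<L} - {m}. h (d j))"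
      by (simp add: sum_subtractf)
    moreover have "real (card ({..<L} - {m})) * \<bar>ln (c / 2)\<bar> \<le> L * \<bar>ln (c / 2)\<bar>"
      by (intro mult_right_mono) (auto simp: card_Diff_singleton_if)
    ultimately show ?thesis using hs by linarith
  qed
  also have "\<dots> \<le> (\<Sum>j\<in>{..<L} - {m}. ln_trunc \<delta> (norm (w - p j)))"
    by (intro sum_mono bound) auto
  finally have "- (L * \<bar>ln (c / 2)\<bar>) - 2 * L \<le> (\<Sum>j\<in>{..<L} - {m}. ln_trunc \<delta> (norm (w - p j)))" .
  moreover have "ln \<delta> \<le> ln_trunc \<delta> (norm (w - p m))"
    unfolding ln_trunc_def using \<delta> by (intro ln_mono) auto
  moreover have "(\<Sum>j<L. ln_trunc \<delta> (norm (w - p j))) =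
     ln_trunc \<delta> (norm (w - p m)) + (\<Sum>j\<in>{..<L} - {m}. ln_trunc \<delta> (norm (w - p j)))"
    using m(1) by (intro sum.remove) auto
  moreover have "L * (log_plus (norm w) - ln (2 * M + 2)) \<le> 0"
    using lp by (intro mult_nonneg_nonpos) auto
  ultimately show ?thesis by (simp add: algebra_simps)
qed

section \<open>Growth of algebraic functions\<close>

definition characteristic :: "(complex ^ 'm \<Rightarrow> complex) \<Rightarrow> real \<Rightarrow> real" where
  "characteristic g r = sphere_mean r (\<lambda>z. log_plus (norm (g z)))"

lemma characteristic_nonneg: "characteristic g r \<ge> 0"
  unfolding characteristic_def by (rule sphere_mean_nonneg) simp

lemma le_exp_log_plus: "t \<le> exp (log_plus t)"
  by (auto simp: log_plus_def)

lemma log_plus_leI: "t \<le> exp B \<Longrightarrow> 0 \<le> B \<Longrightarrow> log_plus t \<le> B"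
  unfolding log_plus_def by (auto dest: ln_mono[where y = "exp B"])

lemma ln_trunc_leI: "t \<le> exp B \<Longrightarrow> 0 \<le> B \<Longrightarrow> 0 < \<delta> \<Longrightarrow> \<delta> \<le> 1 \<Longrightarrow> ln_trunc \<delta> t \<le> B"
  using ln_trunc_le_log_plus log_plus_leI order_trans by blast

lemma ln_le_log_plus: "0 < t \<Longrightarrow> ln t \<le> log_plus t"
  by (auto simp: log_plus_def)

lemma sum_le_exp_sum_log_plus:
  fixes x :: "nat \<Rightarrow> real"
  assumes "m \<ge> 0"
  shows "(\<Sum>j\<le>d. x j * m) \<le> real (Suc d) * m * exp (\<Sum>j\<le>d. log_plus (x j))"
proof -
  have "(\<Sum>j\<le>d. x j * m) \<le> (\<Sum>j\<le>d. exp (\<Sum>j\<le>d. log_plus (x j)) * m)"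
  proof (intro sum_mono mult_right_mono assms)
    fix j assume j: "j \<in> {..d}"
    have "x j \<le> exp (log_plus (x j))" by (rule le_exp_log_plus)
    also have "\<dots> \<le> exp (\<Sum>j\<le>d. log_plus (x j))"
      using member_le_sum[OF j, of "\<lambda>j. log_plus (x j)"] by simp
    finally show "x j \<le> exp (\<Sum>j\<le>d. log_plus (x j))" .
  qed
  thus ?thesis by (simp add: mult_ac)
qed

text \<open>The order of quantifiers is the point: \<open>C\<close> comes before \<open>r\<close>
  and \<open>\<delta>\<close>, so the truncation level may be adapted to the radius at no
  cost.\<close>

lemma sphere_mean_lower_bound_ex:
  fixes g :: "complex ^ 'm \<Rightarrow> complex"
  assumes g: "hol_vec_on g UNIV" and a: "g a \<noteq> 0"
  shows "\<exists>C. \<forall>r\<ge>1. \<forall>\<delta>. 0 < \<delta> \<and> \<delta> \<le> 1 \<longrightarrow> C \<le> sphere_mean r (\<lambda>z. ln_trunc \<delta> (norm (g z)))"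
proof -
  obtain B where B: "\<And>z. norm z \<le> norm a + (norm a + 1) \<Longrightarrow> \<bar>log_plus (norm (g z))\<bar> \<le> B"
    using continuous_bounded_on_cball[OF continuous_on_log_plus_hol[OF g]] by blast
  have B0: "B \<ge> 0" by (rule order_trans[OF abs_ge_zero B[of 0]]) simp
  have "norm (g z) \<le> exp B" if "norm (z - a) \<le> norm a + 1" for z
  proof -
    have "norm z \<le> norm a + (norm a + 1)" using that norm_triangle_sub[of z a] by linarith
    hence "log_plus (norm (g z)) \<le> B" using B[of z] by simp
    thus ?thesis using le_exp_log_plus[of "norm (g z)"] order_trans exp_le_cancel_iff by blast
  qed
  thus ?thesis
    using sphere_mean_lower_bound[OF g, of _ _ "norm (g a)" a B] B0 a by auto
qed

text \<open>Let \<open>A D\<close> be the last coefficient that is not identically zero. Where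
  \<open>|\<phi>| > 1\<close>, division of the relation by \<open>\<phi> ^ (D - 1)\<close> bounds
  \<open>|A D * \<phi>|\<close> by the sum of the \<open>|A j|\<close>. So
  \<open>log_plus |\<phi>|\<close> is controlled by the coefficients and by
  \<open>- ln |A D|\<close>, whose truncated mean is bounded above. The factor \<open>2\<close>
  comes from adding \<open>log_plus |A D|\<close>, which keeps the estimate valid where
  \<open>|\<phi>| \<le> 1\<close>.\<close>

lemma characteristic_algebraic_le:
  fixes A :: "nat \<Rightarrow> complex ^ 'm \<Rightarrow> complex"
  assumes A: "\<And>j. j \<le> d \<Longrightarrow> hol_vec_on (A j) UNIV" and \<phi>: "hol_vec_on \<phi> UNIV"
    and rel: "\<And>z. (\<Sum>j\<le>d. A j z * \<phi> z ^ j) = 0"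
    and nz: "\<exists>j\<le>d. \<exists>z. A j z \<noteq> 0"
  shows "\<exists>C. \<forall>r\<ge>1. characteristic \<phi> r \<le> C + 2 * (\<Sum>j\<le>d. characteristic (A j) r)"
proof -
  define D where "D = Max {j. j \<le> d \<and> (\<exists>z. A j z \<noteq> 0)}"
  have fin: "finite {j. j \<le> d \<and> (\<exists>z. A j z \<noteq> 0)}" by simp
  have D: "D \<le> d" "\<exists>z. A D z \<noteq> 0"
    using Max_in[OF fin] nz unfolding D_def by blast+
  have above: "A j z = 0" if "D < j" "j \<le> d" for j z
  proof (rule ccontr)
    assume "A j z \<noteq> 0"
    hence "j \<le> D" unfolding D_def using that(2) by (intro Max_ge[OF fin]) blast
    thus False using that(1) by simp
  qed
  have rel': "(\<Sum>j\<le>D. A j z * \<phi> z ^ j) = 0" for z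
  proof -
    have "(\<Sum>j\<le>d. A j z * \<phi> z ^ j) = (\<Sum>j\<le>D. A j z * \<phi> z ^ j)"
      using D(1) above by (intro sum.mono_neutral_right) auto
    thus ?thesis using rel by simp
  qed
  \<comment> \<open>For \<open>D = 0\<close> the relation would say that \<open>A 0\<close> vanishes
    identically.\<close>
  have D0: "D > 0"
  proof (rule ccontr)
    assume "\<not> D > 0"
    hence "D = 0" by simp
    thus False using rel' D(2) by simp
  qed
  define g where "g = A D"
  have g: "hol_vec_on g UNIV" unfolding g_def by (rule A[OF D(1)])
  obtain a where a: "g a \<noteq> 0" using D(2) by (auto simp: g_def)
  obtain C where C: "\<And>r \<delta>. r \<ge> 1 \<Longrightarrow> 0 < \<delta> \<Longrightarrow> \<delta> \<le> 1 \<Longrightarrow> C \<le> sphere_mean r (\<lambda>z. ln_trunc \<delta> (norm (g z)))"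
    using sphere_mean_lower_bound_ex[OF g a] by blast
  define S where "S = (\<lambda>z. ln (real (Suc d)) + (\<Sum>j\<le>d. log_plus (norm (A j z))))"
  have key: "norm (g z) * norm (\<phi> z) \<le> exp (S z)" if z: "norm (\<phi> z) > 1" for z
  proof -
    obtain E where E: "D = Suc E" using D0 by (cases D) auto
    have "g z * \<phi> z ^ Suc E = - (\<Sum>j\<le>E. A j z * \<phi> z ^ j)"
      using rel'[of z] unfolding E g_def by (simp add: add_eq_0_iff2)
    hence "norm (g z) * norm (\<phi> z) ^ Suc E = norm (\<Sum>j\<le>E. A j z * \<phi> z ^ j)"
      by (metis norm_minus_cancel norm_mult norm_power)
    also have "\<dots> \<le> (\<Sum>j\<le>E. norm (A j z) * norm (\<phi> z) ^ E)"
      using z by (intro sum_norm_le) (auto simp: norm_mult norm_power intro!: mult_left_mono power_increasing)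
    also have "\<dots> = (\<Sum>j\<le>E. norm (A j z)) * norm (\<phi> z) ^ E" by (simp add: sum_distrib_right)
    finally have "(norm (g z) * norm (\<phi> z)) * norm (\<phi> z) ^ E \<le> (\<Sum>j\<le>E. norm (A j z)) * norm (\<phi> z) ^ E"
      by (simp add: mult_ac)
    hence "norm (g z) * norm (\<phi> z) \<le> (\<Sum>j\<le>E. norm (A j z))"
    proof (rule mult_right_le_imp_le)
      show "0 < norm (\<phi> z) ^ E" using z by (intro zero_less_power) linarith
    qed
    also have "\<dots> \<le> (\<Sum>j\<le>d. norm (A j z) * 1)" using D(1) E by (simp, intro sum_mono2) auto
    also have "\<dots> \<le> real (Suc d) * 1 * exp (\<Sum>j\<le>d. log_plus (norm (A j z)))"
      by (rule sum_le_exp_sum_log_plus) simp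
    also have "\<dots> = exp (S z)" by (simp add: S_def exp_add)
    finally show ?thesis .
  qed
  have contA: "continuous_on UNIV (\<lambda>z. log_plus (norm (A j z)))" if "j \<le> d" for j
    by (rule continuous_on_log_plus_hol[OF A[OF that]])
  have contS: "continuous_on UNIV S"
    unfolding S_def by (intro continuous_intros contA) auto
  have S0: "S z \<ge> 0" for z unfolding S_def by (intro add_nonneg_nonneg sum_nonneg) auto
  have "characteristic \<phi> r \<le> (ln (real (Suc d)) - C) + 2 * (\<Sum>j\<le>d. characteristic (A j) r)" if r: "r \<ge> 1" for r
  proof -
    obtain B where B: "\<And>z. norm z \<le> r \<Longrightarrow> \<bar>log_plus (norm (\<phi> z))\<bar> \<le> B"
      using continuous_bounded_on_cball[OF continuous_on_log_plus_hol[OF \<phi>]] by blast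
    have B0: "B \<ge> 0" by (rule order_trans[OF abs_ge_zero B[of 0]]) (use r in simp)
    \<comment> \<open>\<open>B\<close> bounds \<open>log_plus |\<phi>|\<close> on the ball of radius
      \<open>r\<close>, so where \<open>|g| < \<delta>\<close> the truncated term contributes
      \<open>B\<close> and suffices by itself.\<close>
    define \<delta> where "\<delta> = exp (- B)"
    have \<delta>: "0 < \<delta>" "\<delta> \<le> 1" using B0 by (auto simp: \<delta>_def)
    note contg = continuous_on_log_plus_hol[OF g] continuous_on_ln_trunc_hol[OF g \<delta>(1)]
    have "characteristic \<phi> r \<le> sphere_mean r (\<lambda>z. (log_plus (norm (g z)) - ln_trunc \<delta> (norm (g z))) + S z)"
      unfolding characteristic_def
    proof (rule sphere_mean_mono)
      fix z :: "complex ^ 'm" assume z: "norm z \<le> r"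
      have nn: "ln_trunc \<delta> (norm (g z)) \<le> log_plus (norm (g z))"
        by (rule ln_trunc_le_log_plus[OF \<delta>])
      show "log_plus (norm (\<phi> z)) \<le> (log_plus (norm (g z)) - ln_trunc \<delta> (norm (g z))) + S z"
      proof (cases "norm (\<phi> z) \<le> 1")
        case True
        hence "log_plus (norm (\<phi> z)) = 0" by (simp add: log_plus_def)
        thus ?thesis using nn S0[of z] by linarith
      next
        case False
        show ?thesis
        proof (cases "norm (g z) < \<delta>")
          case True
          hence "ln_trunc \<delta> (norm (g z)) = - B" by (simp add: ln_trunc_def \<delta>_def)
          moreover have "log_plus (norm (\<phi> z)) \<le> B" using B[OF z] by simp
          ultimately show ?thesis using S0[of z] log_plus_nonneg[of "norm (g z)"] by linarith
        next
          case gz: False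
          have gpos: "norm (g z) > 0" using gz \<delta>(1) by linarith
          have "ln (norm (g z) * norm (\<phi> z)) \<le> ln (exp (S z))"
          proof (rule ln_mono)
            have "0 < norm (\<phi> z)" using False by linarith
            thus "0 < norm (g z) * norm (\<phi> z)" using gpos by (intro mult_pos_pos)
          qed (use key[of z] False in auto)
          hence "ln (norm (g z)) + ln (norm (\<phi> z)) \<le> S z"
          proof -
            have "norm (\<phi> z) > 0" using False by linarith
            with gpos have "ln (norm (g z) * norm (\<phi> z)) = ln (norm (g z)) + ln (norm (\<phi> z))"
              by (rule ln_mult_pos)
            with \<open>ln (norm (g z) * norm (\<phi> z)) \<le> ln (exp (S z))\<close> show ?thesis by simp
          qed
          moreover have "ln_trunc \<delta> (norm (g z)) = ln (norm (g z))"
            using gz by (simp add: ln_trunc_def max_def)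
          moreover have "log_plus (norm (\<phi> z)) = ln (norm (\<phi> z))" using False by (simp add: log_plus_def)
          ultimately show ?thesis using log_plus_nonneg[of "norm (g z)"] by linarith
        qed
      qed
    next
      show "continuous_on UNIV (\<lambda>z. log_plus (norm (g z)) - ln_trunc \<delta> (norm (g z)) + S z)"
        by (intro continuous_on_add continuous_on_diff contg contS)
    qed (use r continuous_on_log_plus_hol[OF \<phi>] in auto)
    also have "\<dots> = characteristic g r - sphere_mean r (\<lambda>z. ln_trunc \<delta> (norm (g z))) + sphere_mean r S"
      unfolding characteristic_def
      by (simp add: sphere_mean_add[OF continuous_on_diff[OF contg] contS] sphere_mean_diff[OF contg])
    also have "sphere_mean r S = ln (real (Suc d)) + (\<Sum>j\<le>d. characteristic (A j) r)"
    proof -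
      have "continuous_on UNIV (\<lambda>z. \<Sum>j\<le>d. log_plus (norm (A j z)))"
        by (intro continuous_on_sum contA) auto
      from sphere_mean_add[OF continuous_on_const this, of r "ln (real (Suc d))"]
      show ?thesis unfolding S_def characteristic_def
        by (subst (asm) sphere_mean_sum) (auto intro: contA)
    qed
    also have "characteristic g r \<le> (\<Sum>j\<le>d. characteristic (A j) r)"
      unfolding g_def using D(1)
      by (intro member_le_sum) (auto intro: characteristic_nonneg)
    finally show ?thesis using C[OF r \<delta>] by linarith
  qed
  thus ?thesis by blast
qed

section \<open>Growth of compositions\<close>

text \<open>Subtracting the relation at \<open>F (\<phi> x)\<close> exhibits a factor \<open>a - F (\<phi> x)\<close>, which vanishes to
  at least the order of \<open>\<phi> x - p z\<close>, whatever the multiplicities of the zeros of \<open>\<phi> - p z\<close>.\<close>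
lemma exists_holomorphic_quotient:
  fixes \<phi> :: "complex ^ 'm \<Rightarrow> complex" and R :: "nat \<Rightarrow> complex ^ 'm \<Rightarrow> complex"
  assumes \<phi>: "hol_vec_on \<phi> UNIV" and R: "\<And>j. j \<le> d \<Longrightarrow> hol_vec_on (R j) UNIV"
    and rel: "\<And>x. F analytic_on {\<phi> x} \<Longrightarrow> (\<Sum>j\<le>d. R j x * F (\<phi> x) ^ j) = 0"
    and s: "s > 0" and Z: "finite Z"
    and hol: "\<And>z. z \<in> Z \<Longrightarrow> F holomorphic_on ball z (3 * s)"
    and sep: "\<And>z z'. z \<in> Z \<Longrightarrow> z' \<in> Z \<Longrightarrow> z \<noteq> z' \<Longrightarrow> 4 * s \<le> dist z z'"
    and p: "\<And>z. z \<in> Z \<Longrightarrow> p z \<in> ball z s" "\<And>z. z \<in> Z \<Longrightarrow> F (p z) = a"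
    and lip: "\<And>z w w'. z \<in> Z \<Longrightarrow> w \<in> ball z (2 * s) \<Longrightarrow> w' \<in> ball z (2 * s) \<Longrightarrow> norm (F w - F w') \<le> \<Lambda> * norm (w - w')"
    and dF: "\<And>z w. z \<in> Z \<Longrightarrow> w \<in> ball z (2 * s) \<Longrightarrow> norm (deriv F w) \<le> \<Lambda>"
    and \<Lambda>: "\<Lambda> > 0" and m: "m \<ge> 1" "norm a + 4 * s * \<Lambda> \<le> m"
  obtains H where "hol_vec_on H UNIV"
    "\<And>x. H x * (\<Prod>z\<in>Z. \<phi> x - p z) = (\<Sum>j\<le>d. R j x * a ^ j)"
    "\<And>x. norm (H x) \<le> \<Lambda> * (\<Sum>j\<le>d. norm (R j x) * (real j * m ^ d)) / s ^ (card Z - 1) +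
        (\<Sum>j\<le>d. norm (R j x) * m ^ d) / s ^ card Z"
proof -
  define Q where "Q = (\<lambda>x. \<Sum>j\<le>d. R j x * a ^ j)"
  \<comment> \<open>The cofactor of \<open>a - F (\<phi> x)\<close> in the sum of the terms
    \<open>R j x * (a ^ j - F (\<phi> x) ^ j)\<close>.\<close>
  define T where "T = (\<lambda>x. \<Sum>j\<le>d. R j x * (\<Sum>i<j. F (\<phi> x) ^ (j - Suc i) * a ^ i))"
  define DQ where "DQ = (\<lambda>b w. if w = b then deriv F b else (F w - F b) / (w - b))"
  \<comment> \<open>On one disc \<open>Q\<close> is \<open>(a - F (\<phi> x)) * T x\<close>. The
    difference quotient \<open>DQ\<close> absorbs the factor \<open>\<phi> x - p z\<close>, with a
    sign because \<open>a - F = - (F - F (p z))\<close>, and the other factors do not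
    vanish.\<close>
  define G where "G = (\<lambda>z x. - DQ (p z) (\<phi> x) * T x / (\<Prod>z'\<in>Z - {z}. \<phi> x - p z'))"
  \<comment> \<open>The discs are disjoint, so the choice of \<open>z\<close> is unambiguous;
    outside them the whole product is nonzero and plain division works.\<close>
  define H where "H = (\<lambda>x. if \<exists>z\<in>Z. \<phi> x \<in> ball z (2 * s) then G (SOME z. z \<in> Z \<and> \<phi> x \<in> ball z (2 * s)) x
     else Q x / (\<Prod>z\<in>Z. \<phi> x - p z))"
  have p2: "p z \<in> ball z (2 * s)" if "z \<in> Z" for z using p(1)[OF that] s by simp
  have far: "s \<le> norm (w - p z')" if "z \<in> Z" "z' \<in> Z" "z \<noteq> z'" "w \<in> ball z (2 * s)" for z z' w
  proof -
    have "dist z z' \<le> dist z w + dist w z'" "dist w z' \<le> dist w (p z') + dist (p z') z'"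
      by (rule dist_triangle)+
    moreover have "dist (p z') z' < s" using p(1)[OF that(2)] by (simp add: dist_commute)
    moreover have "dist z w < 2 * s" using that(4) by simp
    ultimately show ?thesis using sep[OF that(1-3)] unfolding dist_norm[of w "p z'"] by linarith
  qed
  have far': "s \<le> norm (w - p z)" if "z \<in> Z" "w \<notin> ball z (2 * s)" for z w
  proof -
    have "dist z w \<le> dist z (p z) + dist (p z) w" by (rule dist_triangle)
    thus ?thesis using p(1)[OF that(1)] that(2) by (simp add: dist_norm norm_minus_commute)
  qed
  have prod_near: "(\<Prod>z'\<in>Z - {z}. w - p z') \<noteq> 0" if "z \<in> Z" "w \<in> ball z (2 * s)" for z w
  proof -
    have "w - p z' \<noteq> 0" if z': "z' \<in> Z - {z}" for z'
      using far[of z z' w] that \<open>z \<in> Z\<close> \<open>w \<in> ball z (2 * s)\<close> s by auto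
    thus ?thesis using Z by simp
  qed
  have prod_far: "(\<Prod>z\<in>Z. w - p z) \<noteq> 0" if "\<And>z. z \<in> Z \<Longrightarrow> w \<notin> ball z (2 * s)" for w
  proof -
    have "w - p z \<noteq> 0" if "z \<in> Z" for z
      using far'[OF that, of w] \<open>\<And>z. z \<in> Z \<Longrightarrow> w \<notin> ball z (2 * s)\<close>[OF that] s by auto
    thus ?thesis using Z by simp
  qed
  have uniq: "z = z'" if "z \<in> Z" "z' \<in> Z" "w \<in> ball z (2 * s)" "w \<in> ball z' (2 * s)" for z z' w
  proof (rule ccontr)
    assume "z \<noteq> z'"
    from sep[OF that(1,2) this] dist_triangle2[of z z' w] that(3,4) show False by simp
  qed
  have H_near: "H x = G z x" if "z \<in> Z" "\<phi> x \<in> ball z (2 * s)" for z x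
  proof -
    have "(SOME z. z \<in> Z \<and> \<phi> x \<in> ball z (2 * s)) = z"
      using that uniq by (intro some_equality) blast+
    thus ?thesis using that unfolding H_def by auto
  qed
  have H_far: "H x = Q x / (\<Prod>z\<in>Z. \<phi> x - p z)" if "\<And>z. z \<in> Z \<Longrightarrow> \<phi> x \<notin> ball z (2 * s)" for x
    using that unfolding H_def by auto
  have DQ_mult: "DQ b w * (w - b) = F w - F b" for b w by (simp add: DQ_def)
  have QT: "Q x = (a - F (\<phi> x)) * T x" if "F analytic_on {\<phi> x}" for x
  proof -
    have "Q x = Q x - (\<Sum>j\<le>d. R j x * F (\<phi> x) ^ j)" using rel[OF that] by simp
    also have "\<dots> = (\<Sum>j\<le>d. R j x * (a ^ j - F (\<phi> x) ^ j))"
      by (simp add: Q_def sum_subtractf algebra_simps)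
    also have "\<dots> = (a - F (\<phi> x)) * T x"
      unfolding T_def
      by (subst sum_distrib_left, intro sum.cong refl) (simp add: power_diff_sumr2 mult.left_commute)
    finally show ?thesis .
  qed
  have eq: "H x * (\<Prod>z\<in>Z. \<phi> x - p z) = Q x" for x
  proof (cases "\<exists>z\<in>Z. \<phi> x \<in> ball z (2 * s)")
    case True
    then obtain z where z: "z \<in> Z" "\<phi> x \<in> ball z (2 * s)" by blast
    have "\<phi> x \<in> ball z (3 * s)" using z(2) s by simp
    hence an: "F analytic_on {\<phi> x}"
      using hol[OF z(1)] open_ball holomorphic_on_imp_analytic_at by blast
    have P0: "(\<Prod>z'\<in>Z - {z}. \<phi> x - p z') \<noteq> 0"
      by (rule prod_near[OF z])
    have "H x * (\<Prod>z\<in>Z. \<phi> x - p z) = G z x * ((\<phi> x - p z) * (\<Prod>z'\<in>Z - {z}. \<phi> x - p z'))"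
      using Z z(1) by (simp add: H_near[OF z] prod.remove)
    also have "\<dots> = - (DQ (p z) (\<phi> x) * (\<phi> x - p z)) * T x"
      using P0 by (simp add: G_def field_simps)
    also have "\<dots> = Q x" unfolding DQ_mult p(2)[OF z(1)] QT[OF an] by simp
    finally show ?thesis .
  next
    case False
    have "(\<Prod>z\<in>Z. \<phi> x - p z) \<noteq> 0"
      using False by (intro prod_far) blast
    thus ?thesis using H_far[of x] False by simp
  qed
  have holR: "hol_vec_on (R j) U" if "j \<le> d" for j U
    by (rule hol_vec_on_subset[OF R[OF that]]) simp
  have holQ: "hol_vec_on Q U" for U
    unfolding Q_def
    by (intro hol_vec_on_sum hol_vec_on_mult hol_vec_on_const holR) simp
  have hol\<phi>: "hol_vec_on \<phi> U" for U using hol_vec_on_subset[OF \<phi>] by simp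
  have open_pre: "open (\<phi> -` W)" if "open W" for W
    using that hol_vec_on_imp_continuous_on[OF \<phi>] by (simp add: open_vimage)
  have holH: "hol_vec_on H UNIV"
  proof (rule hol_vec_on_UNIV_local)
    fix x
    show "\<exists>U. open U \<and> x \<in> U \<and> hol_vec_on H U"
    proof (cases "\<exists>z\<in>Z. \<phi> x \<in> ball z (2 * s)")
      case True
      then obtain z where z: "z \<in> Z" "\<phi> x \<in> ball z (2 * s)" by blast
      define U where "U = \<phi> -` ball z (2 * s)"
      have img: "\<phi> ` U \<subseteq> ball z (2 * s)" by (auto simp: U_def)
      have F2: "F holomorphic_on ball z (2 * s)"
        using s by (intro holomorphic_on_subset[OF hol[OF z(1)]]) auto
      have "DQ (p z) holomorphic_on ball z (2 * s)"
        unfolding DQ_def using F2 open_ball by (rule pole_lemma_open)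
      from hol_vec_on_compose[OF hol\<phi> this img] have h1: "hol_vec_on (\<lambda>x. DQ (p z) (\<phi> x)) U" .
      have h2: "hol_vec_on (\<lambda>x. F (\<phi> x)) U"
        by (rule hol_vec_on_compose[OF hol\<phi> F2 img])
      have h3: "hol_vec_on T U"
        unfolding T_def
        by (intro hol_vec_on_sum hol_vec_on_mult hol_vec_on_power hol_vec_on_const h2 holR) simp
      have h4: "hol_vec_on (\<lambda>x. \<Prod>z'\<in>Z - {z}. \<phi> x - p z') U"
        by (intro hol_vec_on_prod hol_vec_on_diff hol_vec_on_const hol\<phi>)
      have h5: "hol_vec_on (\<lambda>x. - DQ (p z) (\<phi> x)) U"
        using hol_vec_on_diff[OF hol_vec_on_const[of 0] h1] by simp
      have "hol_vec_on (G z) U"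
        unfolding G_def
      proof (rule hol_vec_on_divide[OF hol_vec_on_mult[OF h5 h3] h4])
        fix y assume "y \<in> U"
        hence "\<phi> y \<in> ball z (2 * s)" by (simp add: U_def)
        thus "(\<Prod>z'\<in>Z - {z}. \<phi> y - p z') \<noteq> 0"
          by (rule prod_near[OF z(1)])
      qed
      moreover have "H y = G z y" if "y \<in> U" for y
        using that by (intro H_near z(1)) (simp add: U_def)
      ultimately have "hol_vec_on H U" using hol_vec_on_cong[of U H "G z"] by simp
      moreover have "open U" unfolding U_def by (rule open_pre) simp
      moreover have "x \<in> U" using z(2) by (simp add: U_def)
      ultimately show ?thesis by blast
    next
      case False
      \<comment> \<open>Where the product is nonzero, \<open>eq\<close> identifies \<open>H\<close>
        with the plain quotient whichever branch defines it. This set is open and contains every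
        point whose image lies outside the discs.\<close>
      define U where "U = \<phi> -` (- (p ` Z))"
      have nz: "(\<Prod>z\<in>Z. \<phi> y - p z) \<noteq> 0" if "y \<in> U" for y
        using that Z unfolding U_def by auto
      have "hol_vec_on (\<lambda>y. Q y / (\<Prod>z\<in>Z. \<phi> y - p z)) U"
        by (rule hol_vec_on_divide[OF holQ]) (intro hol_vec_on_prod hol_vec_on_diff hol_vec_on_const hol\<phi>, rule nz)
      moreover have "H y = Q y / (\<Prod>z\<in>Z. \<phi> y - p z)" if "y \<in> U" for y
        using eq[of y] nz[OF that] by (simp add: field_simps)
      ultimately have "hol_vec_on H U" using hol_vec_on_cong[of U H] by simp
      moreover have "open U"
        unfolding U_def using Z by (intro open_pre open_Compl finite_imp_closed) auto
      moreover have "x \<in> U" using False p2 unfolding U_def by auto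
      ultimately show ?thesis by blast
    qed
  qed
  have ma: "norm a \<le> m"
  proof -
    have "0 \<le> 4 * s * \<Lambda>" using s \<Lambda> by simp
    thus ?thesis using m(2) by linarith
  qed
  have pow: "norm a ^ j \<le> m ^ d" if "j \<le> d" for j
  proof -
    have "norm a ^ j \<le> m ^ j" using ma by (intro power_mono) auto
    also have "\<dots> \<le> m ^ d" using m(1) that by (intro power_increasing) auto
    finally show ?thesis .
  qed
  have Qb: "norm (Q x) \<le> (\<Sum>j\<le>d. norm (R j x) * m ^ d)" for x
    unfolding Q_def using pow by (intro sum_norm_le) (auto simp: norm_mult norm_power intro!: mult_left_mono)
  have Tb: "norm (T x) \<le> (\<Sum>j\<le>d. norm (R j x) * (real j * m ^ d))" if "norm (F (\<phi> x)) \<le> m" for x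
    unfolding T_def
  proof (intro sum_norm_le)
    fix j assume j: "j \<in> {..d}"
    have "norm (\<Sum>i<j. F (\<phi> x) ^ (j - Suc i) * a ^ i) \<le> (\<Sum>i<j. m ^ d)"
    proof (intro sum_norm_le)
      fix i assume i: "i \<in> {..<j}"
      have "norm (F (\<phi> x) ^ (j - Suc i) * a ^ i) \<le> m ^ (j - Suc i) * m ^ i"
        unfolding norm_mult norm_power using that ma m(1) by (intro mult_mono power_mono) auto
      also have "\<dots> = m ^ (j - Suc i + i)" by (simp add: power_add)
      also have "\<dots> \<le> m ^ d" using m(1) i j by (intro power_increasing) auto
      finally show "norm (F (\<phi> x) ^ (j - Suc i) * a ^ i) \<le> m ^ d" .
    qed
    thus "norm (R j x * (\<Sum>i<j. F (\<phi> x) ^ (j - Suc i) * a ^ i)) \<le> norm (R j x) * (real j * m ^ d)"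
      unfolding norm_mult by (intro mult_left_mono) auto
  qed
  define W1 where "W1 = (\<lambda>x. \<Sum>j\<le>d. norm (R j x) * (real j * m ^ d))"
  define W2 where "W2 = (\<lambda>x. \<Sum>j\<le>d. norm (R j x) * m ^ d)"
  have TW: "norm (T x) \<le> W1 x" if "norm (F (\<phi> x)) \<le> m" for x
    unfolding W1_def by (rule Tb[OF that])
  have QW: "norm (Q x) \<le> W2 x" for x
    unfolding W2_def by (rule Qb)
  have W: "W1 x \<ge> 0" "W2 x \<ge> 0" for x
    unfolding W1_def W2_def using m(1) by (auto intro!: sum_nonneg mult_nonneg_nonneg)
  have WD: "0 \<le> \<Lambda> * W1 x / s ^ (card Z - 1)" "0 \<le> W2 x / s ^ card Z" for x
    using W[of x] s \<Lambda> by (auto intro!: divide_nonneg_nonneg)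
  \<comment> \<open>Inside a disc, \<open>card Z - 1\<close> factors are at least \<open>s\<close>
    and the remaining one is absorbed by \<open>DQ\<close>, which is at most
    \<open>\<Lambda>\<close>; outside all discs every factor is at least \<open>s\<close>. The sum
    of both bounds covers both cases.\<close>
  have bound: "norm (H x) \<le> \<Lambda> * W1 x / s ^ (card Z - 1) + W2 x / s ^ card Z" for x
  proof (cases "\<exists>z\<in>Z. \<phi> x \<in> ball z (2 * s)")
    case True
    then obtain z where z: "z \<in> Z" "\<phi> x \<in> ball z (2 * s)" by blast
    have "norm (F (\<phi> x) - F (p z)) \<le> \<Lambda> * norm (\<phi> x - p z)"
      by (rule lip[OF z p2[OF z(1)]])
    \<comment> \<open>Two points of a disc of radius \<open>2 * s\<close>; this explains
      \<open>4 * s * \<Lambda>\<close> in the condition on \<open>m\<close>, which then bounds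
      \<open>F (\<phi> x)\<close>.\<close>
    also have "norm (\<phi> x - p z) \<le> 4 * s"
      using z(2) p2[OF z(1)] dist_triangle2[of "\<phi> x" "p z" z] by (simp add: dist_norm norm_minus_commute)
    finally have "norm (F (\<phi> x) - a) \<le> 4 * s * \<Lambda>" using \<Lambda> p(2)[OF z(1)] by (simp add: mult_ac)
    hence Fm: "norm (F (\<phi> x)) \<le> m" using norm_triangle_sub[of "F (\<phi> x)" a] m(2) by linarith
    have DQb: "norm (DQ (p z) (\<phi> x)) \<le> \<Lambda>"
    proof (cases "\<phi> x = p z")
      case True thus ?thesis using dF[OF z(1) p2[OF z(1)]] by (simp add: DQ_def)
    next
      case False
      thus ?thesis using lip[OF z p2[OF z(1)]] by (simp add: DQ_def norm_divide divide_le_eq)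
    qed
    have "s ^ (card Z - 1) = (\<Prod>z'\<in>Z - {z}. s)" using z(1) Z by simp
    also have "\<dots> \<le> (\<Prod>z'\<in>Z - {z}. norm (\<phi> x - p z'))"
      using far[OF z(1) _ _ z(2)] s by (intro prod_mono) auto
    also have "\<dots> = norm (\<Prod>z'\<in>Z - {z}. \<phi> x - p z')" by (rule prod_norm)
    finally have Pb: "s ^ (card Z - 1) \<le> norm (\<Prod>z'\<in>Z - {z}. \<phi> x - p z')" .
    have "norm (H x) = norm (DQ (p z) (\<phi> x)) * norm (T x) / norm (\<Prod>z'\<in>Z - {z}. \<phi> x - p z')"
      by (simp add: H_near[OF z] G_def norm_mult norm_divide)
    also have "\<dots> \<le> \<Lambda> * W1 x / s ^ (card Z - 1)"
      using DQb TW[OF Fm] Pb s \<Lambda> W[of x] by (intro frac_le mult_mono) auto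
    finally show ?thesis using WD(2)[of x] by linarith
  next
    case False
    have "s ^ card Z = (\<Prod>z\<in>Z. s)" by simp
    also have "\<dots> \<le> (\<Prod>z\<in>Z. norm (\<phi> x - p z))"
      using far'[of _ "\<phi> x"] False s by (intro prod_mono) auto
    also have "\<dots> = norm (\<Prod>z\<in>Z. \<phi> x - p z)" by (rule prod_norm)
    finally have Pb: "s ^ card Z \<le> norm (\<Prod>z\<in>Z. \<phi> x - p z)" .
    have "norm (H x) = norm (Q x) / norm (\<Prod>z\<in>Z. \<phi> x - p z)"
      using H_far[of x] False by (simp add: norm_divide)
    also have "\<dots> \<le> W2 x / s ^ card Z"
      using QW[of x] Pb s W[of x] by (intro frac_le) auto
    finally show ?thesis using WD(1)[of x] by linarith
  qed
  show ?thesis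
    by (rule that[OF holH eq[unfolded Q_def] bound[unfolded W1_def W2_def]])
qed

lemma nonneg_bound_exp:
  fixes u :: "complex ^ 'm \<Rightarrow> real"
  assumes "continuous_on UNIV u"
  obtains B where "B \<ge> 0" "\<And>z. norm z \<le> R \<Longrightarrow> u z \<le> exp B"
proof -
  obtain C where C: "\<And>z. norm z \<le> R \<Longrightarrow> \<bar>u z\<bar> \<le> C"
    using continuous_bounded_on_cball[OF assms] by blast
  show ?thesis
  proof (rule that[of "log_plus C"])
    fix z :: "complex ^ 'm" assume "norm z \<le> R"
    hence "u z \<le> C" using C[of z] by simp
    also have "C \<le> exp (log_plus C)" by (rule le_exp_log_plus)
    finally show "u z \<le> exp (log_plus C)" .
  qed simp
qed

text \<open>The strength lies in the factor \<open>1\<close> before the sum, whatever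
  \<open>K\<close> is; only \<open>C\<close> depends on \<open>K\<close>. The constants
  \<open>C1\<close>, \<open>C2\<close>, \<open>C3\<close> below are uniform in the value
  \<open>a\<close> and in \<open>r\<close>, while the truncation levels and the number
  \<open>L\<close> of values may depend on \<open>r\<close>.\<close>

lemma characteristic_composition_le:
  fixes \<phi> :: "complex ^ 'm \<Rightarrow> complex" and R :: "nat \<Rightarrow> complex ^ 'm \<Rightarrow> complex"
  assumes \<phi>: "hol_vec_on \<phi> UNIV" and F: "transcendental_mero F"
    and R: "\<And>j. j \<le> d \<Longrightarrow> hol_vec_on (R j) UNIV"
    and rel: "\<And>x. F analytic_on {\<phi> x} \<Longrightarrow> (\<Sum>j\<le>d. R j x * F (\<phi> x) ^ j) = 0"
    and nz: "\<exists>j\<le>d. \<exists>x. R j x \<noteq> 0"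
  shows "\<exists>C. \<forall>r\<ge>1. real K * characteristic \<phi> r \<le> C + (\<Sum>j\<le>d. characteristic (R j) r)"
proof -
  obtain j0 x0 where j0: "j0 \<le> d" "R j0 x0 \<noteq> 0" using nz by blast
  \<comment> \<open>At a point where some coefficient is nonzero, the relation read as a polynomial
    in the value \<open>a\<close> has finitely many roots. Values taken away from them keep
    \<open>Q a x0\<close>, and with it \<open>H a x0\<close>, uniformly away from zero.\<close>
  define pol where "pol = (\<Sum>j\<le>d. monom (R j x0) j)"
  have pol_eval: "poly pol y = (\<Sum>j\<le>d. R j x0 * y ^ j)" for y
    by (simp add: pol_def poly_sum poly_monom)
  have "coeff pol j0 = R j0 x0"
    using j0(1) by (simp add: pol_def coeff_sum)
  hence pol0: "pol \<noteq> 0" using j0(2) by auto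
  define V where "V = - {y. poly pol y = 0}"
  have V: "open V" "V \<noteq> {}"
  proof -
    have fin: "finite {y. poly pol y = 0}" by (rule poly_roots_finite[OF pol0])
    show "open V" unfolding V_def using fin by (intro open_Compl finite_imp_closed)
    show "V \<noteq> {}"
    proof
      assume "V = {}"
      hence "{y. poly pol y = 0} = UNIV" unfolding V_def by blast
      thus False using fin infinite_UNIV_char_0[where 'a = complex] by simp
    qed
  qed
  obtain a0 s \<epsilon> Z \<Lambda> where br: "a0 \<in> V" "s > 0" "\<epsilon> > 0" "\<Lambda> > 0" "finite Z" "card Z = K"
    "\<And>z. z \<in> Z \<Longrightarrow> F holomorphic_on ball z (3 * s)"
    "\<And>z z'. z \<in> Z \<Longrightarrow> z' \<in> Z \<Longrightarrow> z \<noteq> z' \<Longrightarrow> 4 * s \<le> dist z z'"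
    "\<And>z a. z \<in> Z \<Longrightarrow> a \<in> ball a0 \<epsilon> \<Longrightarrow> \<exists>w\<in>ball z s. F w = a"
    "\<And>z w w'. z \<in> Z \<Longrightarrow> w \<in> ball z (2 * s) \<Longrightarrow> w' \<in> ball z (2 * s) \<Longrightarrow> norm (F w - F w') \<le> \<Lambda> * norm (w - w')"
    "\<And>z w. z \<in> Z \<Longrightarrow> w \<in> ball z (2 * s) \<Longrightarrow> norm (deriv F w) \<le> \<Lambda>"
    by (rule transcendental_mero_branches[OF F V, where K = K]) (rule that)
  define \<eta> where "\<eta> = norm (poly pol a0) / 2"
  have \<eta>: "\<eta> > 0" using br(1) by (simp add: \<eta>_def V_def)
  obtain \<epsilon>1 where \<epsilon>1: "\<epsilon>1 > 0" "\<And>y. dist y a0 < \<epsilon>1 \<Longrightarrow> dist (poly pol y) (poly pol a0) < \<eta>"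
    using poly_isCont[of a0 pol] \<eta> unfolding continuous_at_eps_delta by blast
  define e where "e = min \<epsilon> \<epsilon>1"
  have e: "e > 0" "e \<le> \<epsilon>" "e \<le> \<epsilon>1" using br(3) \<epsilon>1(1) by (auto simp: e_def)
  have pol_ge: "\<eta> \<le> norm (poly pol y)" if "y \<in> ball a0 e" for y
  proof -
    have "dist (poly pol y) (poly pol a0) < \<eta>"
      using that e(3) by (intro \<epsilon>1(2)) (simp add: dist_commute)
    thus ?thesis
      using norm_triangle_ineq2[of "poly pol a0" "poly pol y"]
      by (simp add: \<eta>_def dist_norm norm_minus_commute)
  qed
  have "\<forall>a\<in>ball a0 e. \<forall>z\<in>Z. \<exists>w\<in>ball z s. F w = a"
  proof (intro ballI)
    fix a z assume a: "a \<in> ball a0 e" and z: "z \<in> Z"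
    have "a \<in> ball a0 \<epsilon>" using a e(2) by simp
    with z show "\<exists>w\<in>ball z s. F w = a" by (rule br(9))
  qed
  then obtain p where p: "\<And>a z. a \<in> ball a0 e \<Longrightarrow> z \<in> Z \<Longrightarrow> p a z \<in> ball z s"
    "\<And>a z. a \<in> ball a0 e \<Longrightarrow> z \<in> Z \<Longrightarrow> F (p a z) = a" by metis
  define m where "m = norm a0 + e + 4 * s * \<Lambda> + 1"
  have m: "m \<ge> 1" using e(1) br(2,4) by (simp add: m_def)
  have norm_a: "norm a \<le> norm a0 + e" if "a \<in> ball a0 e" for a
    using that norm_triangle_sub[of a a0] by (simp add: dist_norm norm_minus_commute)
  have am: "norm a + 4 * s * \<Lambda> \<le> m" if "a \<in> ball a0 e" for a
    using norm_a[OF that] by (simp add: m_def)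
  have am': "norm a \<le> m" if "a \<in> ball a0 e" for a
  proof -
    have "0 \<le> 4 * s * \<Lambda>" using br(2,4) by simp
    thus ?thesis using am[OF that] by linarith
  qed
  \<comment> \<open>One majorant for all quotients \<open>H a\<close>, so that the lower bound and
    the truncation levels do not depend on \<open>a\<close>.\<close>
  define W where "W = (\<lambda>x. \<Lambda> * (\<Sum>j\<le>d. norm (R j x) * (real j * m ^ d)) / s ^ (card Z - 1) +
        (\<Sum>j\<le>d. norm (R j x) * m ^ d) / s ^ card Z)"
  define Q where "Q = (\<lambda>a x. \<Sum>j\<le>d. R j x * a ^ j)"
  have "\<exists>H. hol_vec_on H UNIV \<and> (\<forall>x. H x * (\<Prod>z\<in>Z. \<phi> x - p a z) = Q a x) \<and> (\<forall>x. norm (H x) \<le> W x)"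
    if a: "a \<in> ball a0 e" for a
  proof (rule exists_holomorphic_quotient[where \<phi> = \<phi> and R = R and F = F and d = d and Z = Z and
        s = s and p = "p a" and a = a and \<Lambda> = \<Lambda> and m = m])
    show "hol_vec_on \<phi> UNIV" "s > 0" "finite Z" "\<Lambda> > 0" "m \<ge> 1" by fact+
    show "norm a + 4 * s * \<Lambda> \<le> m" by (rule am[OF a])
    show "hol_vec_on (R j) UNIV" if "j \<le> d" for j by (rule R[OF that])
    show "(\<Sum>j\<le>d. R j x * F (\<phi> x) ^ j) = 0" if "F analytic_on {\<phi> x}" for x by (rule rel[OF that])
    show "F holomorphic_on ball z (3 * s)" if "z \<in> Z" for z by (rule br(7)[OF that])
    show "4 * s \<le> dist z z'" if "z \<in> Z" "z' \<in> Z" "z \<noteq> z'" for z z' by (rule br(8)[OF that])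
    show "p a z \<in> ball z s" "F (p a z) = a" if "z \<in> Z" for z by (rule p[OF a that])+
    show "norm (F w - F w') \<le> \<Lambda> * norm (w - w')"
      if "z \<in> Z" "w \<in> ball z (2 * s)" "w' \<in> ball z (2 * s)" for z w w' by (rule br(10)[OF that])
    show "norm (deriv F w) \<le> \<Lambda>" if "z \<in> Z" "w \<in> ball z (2 * s)" for z w by (rule br(11)[OF that])
  next
    fix H assume "hol_vec_on H UNIV" "\<And>x. H x * (\<Prod>z\<in>Z. \<phi> x - p a z) = (\<Sum>j\<le>d. R j x * a ^ j)"
      "\<And>x. norm (H x) \<le> \<Lambda> * (\<Sum>j\<le>d. norm (R j x) * (real j * m ^ d)) / s ^ (card Z - 1) +
        (\<Sum>j\<le>d. norm (R j x) * m ^ d) / s ^ card Z"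
    thus ?thesis unfolding Q_def W_def by (intro exI[of _ H] conjI allI)
  qed
  hence "\<exists>H. \<forall>a\<in>ball a0 e. hol_vec_on (H a) UNIV \<and>
      (\<forall>x. H a x * (\<Prod>z\<in>Z. \<phi> x - p a z) = Q a x) \<and> (\<forall>x. norm (H a x) \<le> W x)"
    by (intro bchoice ballI)
  then obtain H where H: "\<And>a. a \<in> ball a0 e \<Longrightarrow> hol_vec_on (H a) UNIV"
    "\<And>a x. a \<in> ball a0 e \<Longrightarrow> H a x * (\<Prod>z\<in>Z. \<phi> x - p a z) = Q a x"
    "\<And>a x. a \<in> ball a0 e \<Longrightarrow> norm (H a x) \<le> W x" by blast
  have contR: "continuous_on UNIV (R j)" if "j \<le> d" for j
    using hol_vec_on_imp_continuous_on[OF R[OF that]] .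
  have contW: "continuous_on UNIV W"
    unfolding W_def
    by (intro continuous_on_add continuous_on_divide continuous_on_mult continuous_on_sum
        continuous_on_norm continuous_on_const contR) (use br(2) in auto)
  obtain M where M: "\<And>z. z \<in> Z \<Longrightarrow> norm z + s \<le> M"
  proof -
    obtain M' where "\<forall>z\<in>Z. norm z \<le> M'" using finite_imp_bounded[OF br(5)] unfolding bounded_iff by blast
    thus ?thesis by (intro that[of "M' + s"]) auto
  qed
  define M1 where "M1 = max M 0"
  have pM: "norm (p a z) \<le> M1" if "a \<in> ball a0 e" "z \<in> Z" for a z
    using p(1)[OF that] M[OF that(2)] norm_triangle_sub[of "p a z" z]
    by (simp add: M1_def dist_norm norm_minus_commute)

  \<comment> \<open>The lower bound \<open>\<eta>\<close> for \<open>|Q a x0|\<close>, divided by an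
    upper bound for the product of the \<open>K\<close> factors at \<open>x0\<close>.\<close>
  define \<eta>1 where "\<eta>1 = \<eta> / (norm (\<phi> x0) + M1 + 1) ^ K"
  have base: "norm (\<phi> x0) + M1 + 1 > 0" by (simp add: M1_def add_nonneg_pos)
  have \<eta>1: "\<eta>1 > 0" using \<eta> base by (simp add: \<eta>1_def)
  have H_ge: "\<eta>1 \<le> norm (H a x0)" if a: "a \<in> ball a0 e" for a
  proof -
    have "\<eta> \<le> norm (Q a x0)" using pol_ge[OF a] by (simp add: Q_def pol_eval)
    also have "\<dots> = norm (H a x0) * (\<Prod>z\<in>Z. norm (\<phi> x0 - p a z))"
      unfolding H(2)[OF a, of x0, symmetric] norm_mult prod_norm by simp
    also have "\<dots> \<le> norm (H a x0) * (\<Prod>z\<in>Z. norm (\<phi> x0) + M1 + 1)"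
    proof (intro mult_left_mono prod_mono conjI)
      fix z assume "z \<in> Z"
      thus "norm (\<phi> x0 - p a z) \<le> norm (\<phi> x0) + M1 + 1"
        using norm_triangle_ineq4[of "\<phi> x0" "p a z"] pM[OF a, of z] by simp
    qed auto
    also have "\<dots> = norm (H a x0) * (norm (\<phi> x0) + M1 + 1) ^ K" using br(6) by simp
    finally show ?thesis using base by (simp add: \<eta>1_def divide_le_eq)
  qed
  obtain B where B: "B \<ge> 0" "\<And>x. norm x \<le> norm x0 + (norm x0 + 1) \<Longrightarrow> W x \<le> exp B"
    using nonneg_bound_exp[OF contW] by blast
  define C1 where "C1 = B - (norm x0 + 1) ^ DIM(complex ^ 'm) * (B - ln \<eta>1)"
  have lower: "C1 \<le> sphere_mean r (\<lambda>x. ln_trunc \<delta> (norm (H a x)))"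
    if a: "a \<in> ball a0 e" and r: "r \<ge> 1" and \<delta>: "0 < \<delta>" "\<delta> \<le> 1" for a r \<delta>
    unfolding C1_def
  proof (rule sphere_mean_lower_bound[OF H(1)[OF a] \<delta> r \<eta>1 H_ge[OF a] B(1)])
    fix x assume "norm (x - x0) \<le> norm x0 + 1"
    hence "norm x \<le> norm x0 + (norm x0 + 1)" using norm_triangle_sub[of x x0] by linarith
    thus "norm (H a x) \<le> exp B" using H(3)[OF a, of x] B(2)[of x] by linarith
  qed

  define C2 where "C2 = ln (real (Suc d) * m ^ d)"
  have C20: "C2 \<ge> 0"
    unfolding C2_def using m one_le_power[OF m, of d] by (intro ln_ge_zero) (simp add: mult_ge1_I)
  have logQ: "log_plus (norm (Q a x)) \<le> C2 + (\<Sum>j\<le>d. log_plus (norm (R j x)))"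
    if a: "a \<in> ball a0 e" for a x
  proof (rule log_plus_leI)
    have pow: "norm a ^ j \<le> m ^ d" if "j \<le> d" for j
    proof -
      have "norm a ^ j \<le> m ^ j" using am'[OF a] by (intro power_mono) auto
      also have "\<dots> \<le> m ^ d" using m that by (intro power_increasing) auto
      finally show ?thesis .
    qed
    have "norm (Q a x) \<le> (\<Sum>j\<le>d. norm (R j x) * m ^ d)"
      unfolding Q_def using pow by (intro sum_norm_le) (auto simp: norm_mult norm_power intro!: mult_left_mono)
    also have "\<dots> \<le> real (Suc d) * m ^ d * exp (\<Sum>j\<le>d. log_plus (norm (R j x)))"
      using m by (intro sum_le_exp_sum_log_plus) auto
    also have "\<dots> = exp (C2 + (\<Sum>j\<le>d. log_plus (norm (R j x))))"
      using m by (simp add: C2_def exp_add)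
    finally show "norm (Q a x) \<le> exp (C2 + (\<Sum>j\<le>d. log_plus (norm (R j x))))" .
    show "0 \<le> C2 + (\<Sum>j\<le>d. log_plus (norm (R j x)))"
      using C20 by (intro add_nonneg_nonneg sum_nonneg) auto
  qed
  have holQ: "hol_vec_on (Q a) UNIV" for a
    unfolding Q_def by (intro hol_vec_on_sum hol_vec_on_mult hol_vec_on_const R) simp
  have contRlog: "continuous_on UNIV (\<lambda>x. log_plus (norm (R j x)))" if "j \<le> d" for j
    by (rule continuous_on_log_plus_hol[OF R[OF that]])
  have charQ: "characteristic (Q a) r \<le> C2 + (\<Sum>j\<le>d. characteristic (R j) r)"
    if a: "a \<in> ball a0 e" and r: "r \<ge> 1" for a r
  proof -
    have cs: "continuous_on UNIV (\<lambda>x. \<Sum>j\<le>d. log_plus (norm (R j x)))"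
      by (intro continuous_on_sum contRlog) simp
    have "characteristic (Q a) r \<le> sphere_mean r (\<lambda>x. C2 + (\<Sum>j\<le>d. log_plus (norm (R j x))))"
      unfolding characteristic_def
      by (rule sphere_mean_mono[OF continuous_on_log_plus_hol[OF holQ] continuous_on_add[OF continuous_on_const cs]])
         (use r logQ[OF a] in auto)
    also have "\<dots> = C2 + (\<Sum>j\<le>d. characteristic (R j) r)"
      unfolding sphere_mean_add[OF continuous_on_const cs] characteristic_def
      by (subst sphere_mean_sum) (auto intro: contRlog)
    finally show ?thesis .
  qed

  \<comment> \<open>Values will be spaced \<open>e / L\<close> apart, so their preimages in one disc
    are at least \<open>e / (\<Lambda> * L)\<close> apart.\<close>
  define c where "c = e / \<Lambda>"
  have c: "c > 0" using e(1) br(4) by (simp add: c_def)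
  define C3 where "C3 = ln (2 * M1 + 2) + \<bar>ln (c / 2)\<bar> + 2"
  have main: "real K * characteristic \<phi> r \<le> (real K * (C3 + 1) + C2 - C1) + (\<Sum>j\<le>d. characteristic (R j) r)"
    if r: "r \<ge> 1" for r
  proof -
    obtain BH where BH: "BH \<ge> 0" "\<And>x. norm x \<le> r \<Longrightarrow> W x \<le> exp BH"
      using nonneg_bound_exp[OF contW] by blast
    have "continuous_on UNIV (\<lambda>x. norm (\<phi> x) + M1)"
      by (intro continuous_on_add continuous_on_norm continuous_on_const hol_vec_on_imp_continuous_on[OF \<phi>])
    then obtain B\<phi> where B\<phi>: "B\<phi> \<ge> 0" "\<And>x. norm x \<le> r \<Longrightarrow> norm (\<phi> x) + M1 \<le> exp B\<phi>"
      using nonneg_bound_exp by blast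
    \<comment> \<open>The levels make \<open>ln |Q| = ln |H| + \<Sum> ln |\<phi> - p|\<close>
      survive truncation as an inequality. One factor below \<open>\<delta>'\<close> outweighs all
      others, each at most \<open>B\<phi>\<close> in logarithm, together with the bound
      \<open>BH\<close> for \<open>H\<close>; a value of \<open>H\<close> below
      \<open>\<delta>\<close> outweighs all \<open>K\<close> factors.\<close>
    define \<delta>' where "\<delta>' = exp (- (BH + K * B\<phi>))"
    define \<delta> where "\<delta> = exp (- (K * B\<phi>))"
    have \<delta>: "0 < \<delta>" "\<delta> \<le> 1" "0 < \<delta>'" "\<delta>' \<le> 1"
    proof -
      have "0 \<le> real K * B\<phi>" using B\<phi>(1) by simp
      thus "0 < \<delta>" "\<delta> \<le> 1" "0 < \<delta>'" "\<delta>' \<le> 1"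
        using BH(1) by (simp_all add: \<delta>_def \<delta>'_def)
    qed
    have pt: "(\<Sum>z\<in>Z. ln_trunc \<delta>' (norm (\<phi> x - p a z))) \<le> log_plus (norm (Q a x)) - ln_trunc \<delta> (norm (H a x))"
      if a: "a \<in> ball a0 e" and x: "norm x \<le> r" for a x
    proof -
      have up: "norm (\<phi> x - p a z) \<le> exp B\<phi>" if "z \<in> Z" for z
        using norm_triangle_ineq4[of "\<phi> x" "p a z"] pM[OF a that] B\<phi>(2)[OF x] by linarith
      have upl: "ln_trunc \<delta>' (norm (\<phi> x - p a z)) \<le> B\<phi>" if "z \<in> Z" for z
        by (rule ln_trunc_leI[OF up[OF that] B\<phi>(1) \<delta>(3,4)])
      have HB: "ln_trunc \<delta> (norm (H a x)) \<le> BH"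
        using H(3)[OF a, of x] BH(2)[OF x] by (intro ln_trunc_leI BH(1) \<delta>(1,2)) linarith
      have Q0: "0 \<le> log_plus (norm (Q a x))" by simp
      show ?thesis
      proof (cases "\<exists>z\<in>Z. norm (\<phi> x - p a z) < \<delta>'")
        case True
        then obtain z where z: "z \<in> Z" "norm (\<phi> x - p a z) < \<delta>'" by blast
        have "ln_trunc \<delta>' (norm (\<phi> x - p a z)) = - (BH + K * B\<phi>)"
          using z(2) by (simp add: ln_trunc_def \<delta>'_def max_def)
        moreover have "(\<Sum>z\<in>Z - {z}. ln_trunc \<delta>' (norm (\<phi> x - p a z))) \<le> (\<Sum>z\<in>Z - {z}. B\<phi>)"
          by (intro sum_mono upl) simp
        moreover have "(\<Sum>z\<in>Z - {z}. B\<phi>) \<le> (\<Sum>z\<in>Z. B\<phi>)"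
          using br(5) B\<phi>(1) by (intro sum_mono2) auto
        moreover have "(\<Sum>z\<in>Z. B\<phi>) = K * B\<phi>" using br(6) by simp
        ultimately have "(\<Sum>z\<in>Z. ln_trunc \<delta>' (norm (\<phi> x - p a z))) \<le> - BH"
          using sum.remove[OF br(5) z(1), of "\<lambda>z. ln_trunc \<delta>' (norm (\<phi> x - p a z))"] by linarith
        thus ?thesis using HB Q0 by linarith
      next
        case False
        hence ge: "\<delta>' \<le> norm (\<phi> x - p a z)" if "z \<in> Z" for z using that by force
        show ?thesis
        proof (cases "norm (H a x) < \<delta>")
          case True
          hence "ln_trunc \<delta> (norm (H a x)) = - (K * B\<phi>)" by (simp add: ln_trunc_def \<delta>_def max_def)
          moreover have "(\<Sum>z\<in>Z. ln_trunc \<delta>' (norm (\<phi> x - p a z))) \<le> (\<Sum>z\<in>Z. B\<phi>)"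
            by (intro sum_mono upl)
          moreover have "(\<Sum>z\<in>Z. B\<phi>) = K * B\<phi>" using br(6) by simp
          ultimately show ?thesis using Q0 by linarith
        next
          case Hge: False
          have pos: "0 < norm (\<phi> x - p a z)" if "z \<in> Z" for z using ge[OF that] \<delta>(3) by linarith
          have Hpos: "0 < norm (H a x)" using Hge \<delta>(1) by linarith
          have Ppos: "0 < (\<Prod>z\<in>Z. norm (\<phi> x - p a z))" by (intro prod_pos pos)
          have nQ: "norm (Q a x) = norm (H a x) * (\<Prod>z\<in>Z. norm (\<phi> x - p a z))"
            unfolding H(2)[OF a, of x, symmetric] norm_mult prod_norm by simp
          have "ln (norm (Q a x)) = ln (norm (H a x)) + ln (\<Prod>z\<in>Z. norm (\<phi> x - p a z))"
            unfolding nQ by (rule ln_mult_pos[OF Hpos Ppos])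
          moreover have "ln (\<Prod>z\<in>Z. norm (\<phi> x - p a z)) = (\<Sum>z\<in>Z. ln (norm (\<phi> x - p a z)))"
            using pos by (intro ln_prod br(5)) fastforce
          moreover have "(\<Sum>z\<in>Z. ln (norm (\<phi> x - p a z))) = (\<Sum>z\<in>Z. ln_trunc \<delta>' (norm (\<phi> x - p a z)))"
            using ge by (intro sum.cong refl) (simp add: ln_trunc_def max_absorb1)
          moreover have "ln_trunc \<delta> (norm (H a x)) = ln (norm (H a x))"
            using Hge by (simp add: ln_trunc_def max_def)
          moreover have "ln (norm (Q a x)) \<le> log_plus (norm (Q a x))"
            using nQ Hpos Ppos by (intro ln_le_log_plus) simp
          ultimately show ?thesis by linarith
        qed
      qed
    qed
    have hold: "hol_vec_on (\<lambda>x. \<phi> x - b) UNIV" for b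
      by (intro hol_vec_on_diff \<phi> hol_vec_on_const)
    note contd = continuous_on_ln_trunc_hol[OF hold \<delta>(3)]
    have avg: "(\<Sum>z\<in>Z. sphere_mean r (\<lambda>x. ln_trunc \<delta>' (norm (\<phi> x - p a z)))) \<le>
        C2 - C1 + (\<Sum>j\<le>d. characteristic (R j) r)" if a: "a \<in> ball a0 e" for a
    proof -
      note cQ = continuous_on_log_plus_hol[OF holQ[of a]]
      note cH = continuous_on_ln_trunc_hol[OF H(1)[OF a] \<delta>(1)]
      have "(\<Sum>z\<in>Z. sphere_mean r (\<lambda>x. ln_trunc \<delta>' (norm (\<phi> x - p a z)))) =
         sphere_mean r (\<lambda>x. \<Sum>z\<in>Z. ln_trunc \<delta>' (norm (\<phi> x - p a z)))"
        by (rule sphere_mean_sum[symmetric]) (rule contd)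
      also have "\<dots> \<le> sphere_mean r (\<lambda>x. log_plus (norm (Q a x)) - ln_trunc \<delta> (norm (H a x)))"
        by (rule sphere_mean_mono[OF continuous_on_sum[OF contd] continuous_on_diff[OF cQ cH]])
          (use r pt[OF a] in auto)
      also have "\<dots> = characteristic (Q a) r - sphere_mean r (\<lambda>x. ln_trunc \<delta> (norm (H a x)))"
        unfolding characteristic_def by (rule sphere_mean_diff[OF cQ cH])
      finally show ?thesis using lower[OF a r \<delta>(1,2)] charQ[OF a r] by linarith
    qed
    \<comment> \<open>With \<open>L\<close> at least \<open>- ln \<delta>'\<close>, the loss
      \<open>ln \<delta>'\<close> in the average amounts to at most \<open>1\<close> per value,
      whence \<open>C3 + 1\<close>.\<close>
    obtain L0 :: nat where L0: "BH + K * B\<phi> < L0" using reals_Archimedean2 by blast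
    define L where "L = Suc L0"
    have L: "L > 0" "- real L \<le> ln \<delta>'" using L0 by (auto simp: L_def \<delta>'_def)
    define \<alpha> where "\<alpha> = (\<lambda>j::nat. a0 + of_real (e * (real j / real L)))"
    have \<alpha>: "\<alpha> j \<in> ball a0 e" if "j < L" for j
    proof -
      have "dist a0 (\<alpha> j) = \<bar>e * (real j / real L)\<bar>"
      proof -
        have "dist a0 (a0 + of_real t) = \<bar>t\<bar>" for t by (simp add: dist_norm)
        thus ?thesis unfolding \<alpha>_def by blast
      qed
      also have "\<dots> = e * (real j / real L)" using e(1) by simp
      also have "\<dots> < e * 1" using that e(1) L(1) by (intro mult_strict_left_mono) auto
      finally show ?thesis by simp
    qed
    have pt2: "real L * (log_plus (norm (\<phi> x)) - (C3 + 1)) \<le> (\<Sum>j<L. ln_trunc \<delta>' (norm (\<phi> x - p (\<alpha> j) z)))"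
      if z: "z \<in> Z" for z x
    proof -
      have "real L * (log_plus (norm (\<phi> x)) - (ln (2 * M1 + 2) + \<bar>ln (c / 2)\<bar> + 2)) + ln \<delta>' \<le>
         (\<Sum>j<L. ln_trunc \<delta>' (norm (\<phi> x - p (\<alpha> j) z)))"
      proof (rule ln_trunc_average[OF L(1) c _ \<delta>(3,4)])
        show "M1 \<ge> 0" by (simp add: M1_def)
        show "norm (p (\<alpha> j) z) \<le> M1" if "j < L" for j by (rule pM[OF \<alpha>[OF that] z])
        fix i j assume ij: "i < L" "j < L"
        have "F (p (\<alpha> i) z) - F (p (\<alpha> j) z) = of_real (e * (real i / real L) - e * (real j / real L))"
          unfolding p(2)[OF \<alpha>[OF ij(1)] z] p(2)[OF \<alpha>[OF ij(2)] z] by (simp add: \<alpha>_def)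
        also have "e * (real i / real L) - e * (real j / real L) = e * ((real i - real j) / real L)"
          by (simp add: diff_divide_distrib right_diff_distrib)
        finally have "norm (F (p (\<alpha> i) z) - F (p (\<alpha> j) z)) = \<bar>e * ((real i - real j) / real L)\<bar>"
          by (simp only: norm_of_real)
        also have "\<dots> = e * \<bar>real i - real j\<bar> / L" using e(1) by (simp add: abs_mult)
        finally have "e * \<bar>real i - real j\<bar> / L \<le> \<Lambda> * norm (p (\<alpha> i) z - p (\<alpha> j) z)"
          using br(10)[OF z, of "p (\<alpha> i) z" "p (\<alpha> j) z"] p(1)[OF \<alpha>[OF ij(1)] z] p(1)[OF \<alpha>[OF ij(2)] z] br(2)
          by simp
        hence "(e * \<bar>real i - real j\<bar> / L) / \<Lambda> \<le> norm (p (\<alpha> i) z - p (\<alpha> j) z)"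
          using br(4) by (simp only: pos_divide_le_eq mult.commute)
        moreover have "c * \<bar>real i - real j\<bar> / L = (e * \<bar>real i - real j\<bar> / L) / \<Lambda>"
          by (simp add: c_def mult.commute)
        ultimately show "c * \<bar>real i - real j\<bar> / L \<le> norm (p (\<alpha> i) z - p (\<alpha> j) z)"
          by simp
      qed
      thus ?thesis using L(2) by (simp add: C3_def algebra_simps)
    qed
    have char2: "real L * (characteristic \<phi> r - (C3 + 1)) \<le>
        (\<Sum>j<L. sphere_mean r (\<lambda>x. ln_trunc \<delta>' (norm (\<phi> x - p (\<alpha> j) z))))" if z: "z \<in> Z" for z
    proof -
      note c\<phi> = continuous_on_log_plus_hol[OF \<phi>]
      have "real L * (characteristic \<phi> r - (C3 + 1)) =
        sphere_mean r (\<lambda>x. real L * (log_plus (norm (\<phi> x)) - (C3 + 1)))"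
        unfolding sphere_mean_cmult sphere_mean_diff[OF c\<phi> continuous_on_const] characteristic_def by simp
      also have "\<dots> \<le> sphere_mean r (\<lambda>x. \<Sum>j<L. ln_trunc \<delta>' (norm (\<phi> x - p (\<alpha> j) z)))"
        by (rule sphere_mean_mono[OF continuous_on_mult[OF continuous_on_const
                continuous_on_diff[OF c\<phi> continuous_on_const]] continuous_on_sum[OF contd]])
          (use r pt2[OF z] in auto)
      also have "\<dots> = (\<Sum>j<L. sphere_mean r (\<lambda>x. ln_trunc \<delta>' (norm (\<phi> x - p (\<alpha> j) z))))"
        by (rule sphere_mean_sum) (rule contd)
      finally show ?thesis .
    qed
    \<comment> \<open>Double counting: for fixed \<open>z\<close> the sum over the values is large
      by \<open>char2\<close>, and for a fixed value the sum over \<open>z\<close> is small by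
      \<open>avg\<close>.\<close>
    have "real K * (real L * (characteristic \<phi> r - (C3 + 1))) = (\<Sum>z\<in>Z. real L * (characteristic \<phi> r - (C3 + 1)))"
      using br(6) by simp
    also have "\<dots> \<le> (\<Sum>z\<in>Z. \<Sum>j<L. sphere_mean r (\<lambda>x. ln_trunc \<delta>' (norm (\<phi> x - p (\<alpha> j) z))))"
      by (intro sum_mono char2)
    also have "\<dots> = (\<Sum>j<L. \<Sum>z\<in>Z. sphere_mean r (\<lambda>x. ln_trunc \<delta>' (norm (\<phi> x - p (\<alpha> j) z))))"
      by (rule sum.swap)
    also have "\<dots> \<le> (\<Sum>j<L. C2 - C1 + (\<Sum>j\<le>d. characteristic (R j) r))"
      by (intro sum_mono avg \<alpha>) simp
    also have "\<dots> = real L * (C2 - C1 + (\<Sum>j\<le>d. characteristic (R j) r))" by simp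
    finally have "real L * (real K * (characteristic \<phi> r - (C3 + 1))) \<le> real L * (C2 - C1 + (\<Sum>j\<le>d. characteristic (R j) r))"
      by (simp only: mult.left_commute)
    hence "real K * (characteristic \<phi> r - (C3 + 1)) \<le> C2 - C1 + (\<Sum>j\<le>d. characteristic (R j) r)"
      using L(1) by (simp only: mult_le_cancel_left_pos of_nat_0_less_iff)
    thus ?thesis by (simp add: right_diff_distrib)
  qed
  thus ?thesis by blast
qed

section \<open>Algebraic independence\<close>

text \<open>This is the coefficient of \<open>X_k^j\<close>, a polynomial in the first
  \<open>k\<close> variables; its exponent vectors are normalized by a zero at position
  \<open>k\<close>.\<close>

definition mpoly_slice :: "((nat \<Rightarrow> nat) \<Rightarrow> complex) \<Rightarrow> nat \<Rightarrow> nat \<Rightarrow> (nat \<Rightarrow> nat) \<Rightarrow> complex" where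
  "mpoly_slice c k j = (\<lambda>\<alpha>. if \<alpha> k = 0 then c (\<alpha>(k := j)) else 0)"

lemma mpoly_slice_support_bij:
  "bij_betw (\<lambda>\<alpha>. \<alpha>(k := j)) {\<alpha>. mpoly_slice c k j \<alpha> \<noteq> 0} {\<alpha> \<in> {\<alpha>. c \<alpha> \<noteq> 0}. \<alpha> k = j}"
proof (rule bij_betwI[where g = "\<lambda>\<alpha>. \<alpha>(k := 0)"])
  show "(\<lambda>\<alpha>. \<alpha>(k := j)) \<in> {\<alpha>. mpoly_slice c k j \<alpha> \<noteq> 0} \<rightarrow> {\<alpha> \<in> {\<alpha>. c \<alpha> \<noteq> 0}. \<alpha> k = j}"
    by (auto simp: mpoly_slice_def split: if_splits)
  show "(\<lambda>\<alpha>. \<alpha>(k := 0)) \<in> {\<alpha> \<in> {\<alpha>. c \<alpha> \<noteq> 0}. \<alpha> k = j} \<rightarrow> {\<alpha>. mpoly_slice c k j \<alpha> \<noteq> 0}"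
    by (auto simp: mpoly_slice_def)
qed (auto simp: mpoly_slice_def split: if_splits)

lemma mpoly_ok_slice:
  assumes "mpoly_ok (Suc k) c"
  shows "mpoly_ok k (mpoly_slice c k j)"
  unfolding mpoly_ok_def
proof (intro conjI allI impI)
  have "finite {\<alpha> \<in> {\<alpha>. c \<alpha> \<noteq> 0}. \<alpha> k = j}" using assms by (simp add: mpoly_ok_def)
  thus "finite {\<alpha>. mpoly_slice c k j \<alpha> \<noteq> 0}"
    using bij_betw_finite[OF mpoly_slice_support_bij] by blast
  fix \<alpha> i assume \<alpha>: "mpoly_slice c k j \<alpha> \<noteq> 0" and i: "k \<le> i"
  have "\<alpha> k = 0" "c (\<alpha>(k := j)) \<noteq> 0" using \<alpha> by (auto simp: mpoly_slice_def split: if_splits)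
  moreover have "\<forall>i\<ge>Suc k. (\<alpha>(k := j)) i = 0"
    using assms calculation(2) unfolding mpoly_ok_def by blast
  ultimately show "\<alpha> i = 0" using i by (cases "i = k") auto
qed

lemma mpoly_eval_slice:
  assumes c: "mpoly_ok (Suc k) c" and d: "\<And>\<alpha>. c \<alpha> \<noteq> 0 \<Longrightarrow> \<alpha> k \<le> d"
  shows "mpoly_eval (Suc k) c x = (\<Sum>j\<le>d. mpoly_eval k (mpoly_slice c k j) x * x k ^ j)"
proof -
  define S where "S = {\<alpha>. c \<alpha> \<noteq> 0}"
  have S: "finite S" using c by (simp add: mpoly_ok_def S_def)
  have "mpoly_eval (Suc k) c x = (\<Sum>\<alpha>\<in>S. c \<alpha> * (\<Prod>i<Suc k. x i ^ \<alpha> i))"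
    by (simp add: mpoly_eval_def S_def)
  also have "\<dots> = (\<Sum>j\<le>d. \<Sum>\<alpha>\<in>{\<alpha> \<in> S. \<alpha> k = j}. c \<alpha> * (\<Prod>i<Suc k. x i ^ \<alpha> i))"
    by (rule sum.group[symmetric]) (use S d in \<open>auto simp: S_def\<close>)
  also have "\<dots> = (\<Sum>j\<le>d. mpoly_eval k (mpoly_slice c k j) x * x k ^ j)"
  proof (intro sum.cong refl)
    fix j
    have "(\<Sum>\<alpha>\<in>{\<alpha> \<in> S. \<alpha> k = j}. c \<alpha> * (\<Prod>i<Suc k. x i ^ \<alpha> i)) =
      (\<Sum>\<alpha>\<in>{\<alpha>. mpoly_slice c k j \<alpha> \<noteq> 0}. c (\<alpha>(k := j)) * (\<Prod>i<Suc k. x i ^ (\<alpha>(k := j)) i))"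
      unfolding S_def by (rule sum.reindex_bij_betw[OF mpoly_slice_support_bij, symmetric])
    also have "\<dots> = (\<Sum>\<alpha>\<in>{\<alpha>. mpoly_slice c k j \<alpha> \<noteq> 0}. mpoly_slice c k j \<alpha> * (\<Prod>i<k. x i ^ \<alpha> i) * x k ^ j)"
    proof (intro sum.cong refl)
      fix \<alpha> assume "\<alpha> \<in> {\<alpha>. mpoly_slice c k j \<alpha> \<noteq> 0}"
      hence "c (\<alpha>(k := j)) = mpoly_slice c k j \<alpha>" by (auto simp: mpoly_slice_def split: if_splits)
      moreover have "(\<Prod>i<k. x i ^ (\<alpha>(k := j)) i) = (\<Prod>i<k. x i ^ \<alpha> i)"
        by (intro prod.cong refl) simp
      ultimately show "c (\<alpha>(k := j)) * (\<Prod>i<Suc k. x i ^ (\<alpha>(k := j)) i) =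
          mpoly_slice c k j \<alpha> * (\<Prod>i<k. x i ^ \<alpha> i) * x k ^ j"
        by (simp add: mult.assoc)
    qed
    also have "\<dots> = mpoly_eval k (mpoly_slice c k j) x * x k ^ j"
      by (simp add: mpoly_eval_def sum_distrib_right)
    finally show "(\<Sum>\<alpha>\<in>{\<alpha> \<in> S. \<alpha> k = j}. c \<alpha> * (\<Prod>i<Suc k. x i ^ \<alpha> i)) =
        mpoly_eval k (mpoly_slice c k j) x * x k ^ j" .
  qed
  finally show ?thesis .
qed

lemma mpoly_slice_nonzero:
  assumes c: "mpoly_ok (Suc k) c" "c \<noteq> (\<lambda>_. 0)"
  obtains d where "\<And>\<alpha>. c \<alpha> \<noteq> 0 \<Longrightarrow> \<alpha> k \<le> d" "\<exists>j\<le>d. mpoly_slice c k j \<noteq> (\<lambda>_. 0)"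
proof -
  define d where "d = Max ((\<lambda>\<alpha>. \<alpha> k) ` {\<alpha>. c \<alpha> \<noteq> 0})"
  have fin: "finite {\<alpha>. c \<alpha> \<noteq> 0}" using c(1) by (simp add: mpoly_ok_def)
  have d: "\<alpha> k \<le> d" if "c \<alpha> \<noteq> 0" for \<alpha>
    unfolding d_def using fin that by (intro Max_ge) auto
  obtain \<alpha> where \<alpha>: "c \<alpha> \<noteq> 0" using c(2) by blast
  have "mpoly_slice c k (\<alpha> k) (\<alpha>(k := 0)) = c \<alpha>" by (simp add: mpoly_slice_def)
  hence "mpoly_slice c k (\<alpha> k) \<noteq> (\<lambda>_. 0)" using \<alpha> by metis
  thus ?thesis using d[OF \<alpha>] by (intro that[of d] d) blast+
qed

lemma mpoly_eval_cong: "(\<And>i. i < k \<Longrightarrow> x i = y i) \<Longrightarrow> mpoly_eval k c x = mpoly_eval k c y"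
  unfolding mpoly_eval_def by (intro sum.cong prod.cong refl arg_cong2[where f = "(*)"]) simp

lemma log_plus_mpoly_eval_le:
  assumes c: "mpoly_ok k c"
  obtains C D where "C \<ge> 0" "D \<ge> 0"
    "\<And>x. log_plus (norm (mpoly_eval k c x)) \<le> C + D * (\<Sum>i<k. log_plus (norm (x i)))"
proof -
  define S where "S = {\<alpha>. c \<alpha> \<noteq> 0}"
  have S: "finite S" using c by (simp add: mpoly_ok_def S_def)
  \<comment> \<open>A crude common bound for all exponents; all that counts is that it does not
    depend on \<open>x\<close>.\<close>
  define D :: real where "D = (\<Sum>\<alpha>\<in>S. \<Sum>i<k. real (\<alpha> i))"
  define A where "A = (\<Sum>\<alpha>\<in>S. norm (c \<alpha>))"
  have D0: "D \<ge> 0" unfolding D_def by (intro sum_nonneg) auto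
  have \<alpha>D: "real (\<alpha> i) \<le> D" if "\<alpha> \<in> S" "i < k" for \<alpha> i
  proof -
    have "real (\<alpha> i) \<le> (\<Sum>i<k. real (\<alpha> i))" using that(2) by (intro member_le_sum) auto
    also have "\<dots> \<le> D" unfolding D_def using S that(1)
      by (intro member_le_sum[of _ _ "\<lambda>\<alpha>. \<Sum>i<k. real (\<alpha> i)"]) (auto intro: sum_nonneg)
    finally show ?thesis .
  qed
  have "log_plus (norm (mpoly_eval k c x)) \<le> log_plus A + D * (\<Sum>i<k. log_plus (norm (x i)))" for x
  proof (rule log_plus_leI)
    have mono: "norm (\<Prod>i<k. x i ^ \<alpha> i) \<le> exp (D * (\<Sum>i<k. log_plus (norm (x i))))" if "\<alpha> \<in> S" for \<alpha>
    proof -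
      have "norm (\<Prod>i<k. x i ^ \<alpha> i) = (\<Prod>i<k. norm (x i) ^ \<alpha> i)"
        by (simp add: prod_norm[symmetric] norm_power)
      also have "\<dots> \<le> (\<Prod>i<k. exp (D * log_plus (norm (x i))))"
      proof (intro prod_mono conjI)
        fix i assume i: "i \<in> {..<k}"
        have "norm (x i) ^ \<alpha> i \<le> exp (log_plus (norm (x i))) ^ \<alpha> i"
          by (intro power_mono le_exp_log_plus) simp
        also have "\<dots> = exp (real (\<alpha> i) * log_plus (norm (x i)))" by (simp add: exp_of_nat_mult)
        also have "\<dots> \<le> exp (D * log_plus (norm (x i)))"
          using \<alpha>D[OF that, of i] i by (simp add: mult_right_mono)
        finally show "norm (x i) ^ \<alpha> i \<le> exp (D * log_plus (norm (x i)))" .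
      qed simp
      also have "\<dots> = exp (D * (\<Sum>i<k. log_plus (norm (x i))))"
        by (simp add: exp_sum[symmetric] sum_distrib_left)
      finally show ?thesis .
    qed
    have "norm (mpoly_eval k c x) \<le> (\<Sum>\<alpha>\<in>S. norm (c \<alpha>) * exp (D * (\<Sum>i<k. log_plus (norm (x i)))))"
      unfolding mpoly_eval_def S_def[symmetric]
      using mono by (intro sum_norm_le) (auto simp: norm_mult intro!: mult_left_mono)
    also have "\<dots> = A * exp (D * (\<Sum>i<k. log_plus (norm (x i))))"
      by (simp add: A_def sum_distrib_right)
    also have "\<dots> \<le> exp (log_plus A) * exp (D * (\<Sum>i<k. log_plus (norm (x i))))"
      by (intro mult_right_mono le_exp_log_plus) simp
    finally show "norm (mpoly_eval k c x) \<le> exp (log_plus A + D * (\<Sum>i<k. log_plus (norm (x i))))"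
      by (simp add: exp_add)
    show "0 \<le> log_plus A + D * (\<Sum>i<k. log_plus (norm (x i)))"
      using D0 by (intro add_nonneg_nonneg mult_nonneg_nonneg sum_nonneg) auto
  qed
  thus ?thesis using D0 by (intro that[of "log_plus A" D]) auto
qed

lemma hol_vec_on_mpoly_eval:
  assumes "\<And>i. i < k \<Longrightarrow> hol_vec_on (g i) U"
  shows "hol_vec_on (\<lambda>z. mpoly_eval k c (\<lambda>i. g i z)) U"
  unfolding mpoly_eval_def
  by (intro hol_vec_on_sum hol_vec_on_mult hol_vec_on_prod hol_vec_on_power hol_vec_on_const assms) simp

lemma characteristic_mpoly_eval_le:
  fixes g :: "nat \<Rightarrow> complex ^ 'm \<Rightarrow> complex"
  assumes c: "mpoly_ok k c" and g: "\<And>i. i < k \<Longrightarrow> hol_vec_on (g i) UNIV"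
  shows "\<exists>C\<ge>0. \<exists>D\<ge>0. \<forall>r\<ge>0. characteristic (\<lambda>z. mpoly_eval k c (\<lambda>i. g i z)) r \<le>
      C + D * (\<Sum>i<k. characteristic (g i) r)"
proof -
  obtain C D where CD: "C \<ge> 0" "D \<ge> 0"
    "\<And>x. log_plus (norm (mpoly_eval k c x)) \<le> C + D * (\<Sum>i<k. log_plus (norm (x i)))"
    using log_plus_mpoly_eval_le[OF c] by blast
  have cg: "continuous_on UNIV (\<lambda>z. log_plus (norm (g i z)))" if "i < k" for i
    by (rule continuous_on_log_plus_hol[OF g[OF that]])
  have cs: "continuous_on UNIV (\<lambda>z. \<Sum>i<k. log_plus (norm (g i z)))"
    by (intro continuous_on_sum cg) simp
  have cD: "continuous_on UNIV (\<lambda>z. D * (\<Sum>i<k. log_plus (norm (g i z))))"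
    by (intro continuous_on_mult continuous_on_const cs)
  have "characteristic (\<lambda>z. mpoly_eval k c (\<lambda>i. g i z)) r \<le> C + D * (\<Sum>i<k. characteristic (g i) r)"
    if r: "r \<ge> 0" for r
  proof -
    have "characteristic (\<lambda>z. mpoly_eval k c (\<lambda>i. g i z)) r \<le>
      sphere_mean r (\<lambda>z. C + D * (\<Sum>i<k. log_plus (norm (g i z))))"
      unfolding characteristic_def
      by (rule sphere_mean_mono[OF continuous_on_log_plus_hol[OF hol_vec_on_mpoly_eval[OF g]]
            continuous_on_add[OF continuous_on_const cD] r CD(3)])
    also have "\<dots> = C + D * (\<Sum>i<k. characteristic (g i) r)"
      unfolding sphere_mean_add[OF continuous_on_const cD] sphere_mean_cmult characteristic_def
      by (subst sphere_mean_sum) (auto intro: cg)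
    finally show ?thesis .
  qed
  thus ?thesis using CD(1,2) by blast
qed

lemma characteristic_slices_le:
  fixes g :: "nat \<Rightarrow> complex ^ 'm \<Rightarrow> complex"
  assumes c: "mpoly_ok (Suc k) c" and g: "\<And>i. i < k \<Longrightarrow> hol_vec_on (g i) UNIV"
  shows "\<exists>C\<ge>0. \<exists>D\<ge>0. \<forall>r\<ge>0. (\<Sum>j\<le>d. characteristic (\<lambda>z. mpoly_eval k (mpoly_slice c k j) (\<lambda>i. g i z)) r) \<le>
      C + D * (\<Sum>i<k. characteristic (g i) r)"
proof -
  define A where "A = (\<lambda>j. characteristic (\<lambda>z. mpoly_eval k (mpoly_slice c k j) (\<lambda>i. g i z)))"
  define t where "t = (\<lambda>r. \<Sum>i<k. characteristic (g i) r)"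
  have "\<forall>j. \<exists>C. C \<ge> 0 \<and> (\<exists>D. D \<ge> 0 \<and> (\<forall>r\<ge>0. A j r \<le> C + D * t r))"
    unfolding A_def t_def by (intro allI characteristic_mpoly_eval_le[OF mpoly_ok_slice[OF c] g])
  from choice[OF this] obtain C where C: "\<forall>j. C j \<ge> 0 \<and> (\<exists>D. D \<ge> 0 \<and> (\<forall>r\<ge>0. A j r \<le> C j + D * t r))"
    by blast
  hence "\<forall>j. \<exists>D. D \<ge> 0 \<and> (\<forall>r\<ge>0. A j r \<le> C j + D * t r)" by blast
  from choice[OF this] obtain D where D: "\<forall>j. D j \<ge> 0 \<and> (\<forall>r\<ge>0. A j r \<le> C j + D j * t r)" by blast
  have CD: "C j \<ge> 0" "D j \<ge> 0" "r \<ge> 0 \<Longrightarrow> A j r \<le> C j + D j * t r" for j r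
    using C D by blast+
  have C0: "0 \<le> (\<Sum>j\<le>d. C j)" and D0: "0 \<le> (\<Sum>j\<le>d. D j)"
    by (intro sum_nonneg CD)+
  have "\<forall>r\<ge>0. (\<Sum>j\<le>d. A j r) \<le> (\<Sum>j\<le>d. C j) + (\<Sum>j\<le>d. D j) * t r"
  proof (intro allI impI)
    fix r :: real assume r: "r \<ge> 0"
    have "(\<Sum>j\<le>d. A j r) \<le> (\<Sum>j\<le>d. C j + D j * t r)"
      by (intro sum_mono CD(3) r)
    thus "(\<Sum>j\<le>d. A j r) \<le> (\<Sum>j\<le>d. C j) + (\<Sum>j\<le>d. D j) * t r"
      by (simp only: sum.distrib sum_distrib_right)
  qed
  with D0 have "\<exists>D\<ge>0. \<forall>r\<ge>0. (\<Sum>j\<le>d. A j r) \<le> (\<Sum>j\<le>d. C j) + D * t r"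
    by (intro exI[where x = "\<Sum>j\<le>d. D j"] conjI)
  with C0 have "\<exists>C\<ge>0. \<exists>D\<ge>0. \<forall>r\<ge>0. (\<Sum>j\<le>d. A j r) \<le> C + D * t r"
    by (rule_tac exI[where x = "\<Sum>j\<le>d. C j"], rule_tac conjI)
  thus ?thesis unfolding A_def t_def .
qed

lemma chain_le:
  fixes t :: "nat \<Rightarrow> real"
  assumes \<epsilon>: "0 < \<epsilon>" "\<epsilon> \<le> 1" and t: "\<And>i. t i \<ge> 0"
    and step: "\<And>i. Suc i < n \<Longrightarrow> t i \<le> \<epsilon> * t (Suc i)"
  shows "i < k \<Longrightarrow> k < n \<Longrightarrow> t i \<le> \<epsilon> * t k"
proof (induction k)
  case (Suc k)
  have le: "t k \<le> \<epsilon> * t (Suc k)" using step[of k] Suc.prems(2) by simp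
  show ?case
  proof (cases "i = k")
    case True thus ?thesis using le by simp
  next
    case False
    hence "t i \<le> \<epsilon> * t k" using Suc by simp
    also have "\<dots> \<le> t k" using \<epsilon> t[of k] by (simp add: mult_left_le_one_le)
    also have "\<dots> \<le> \<epsilon> * t (Suc k)" by (rule le)
    finally show ?thesis .
  qed
qed simp

text \<open>Twice \<open>x\<close> is at most half of \<open>t\<close>, so it can be absorbed into
  the left side.\<close>

lemma absorb_quarter:
  fixes t x y A B :: real
  assumes "x \<le> y" "4 * y \<le> t" "t \<le> A + 2 * (B + x)"
  shows "t \<le> 2 * A + 4 * B"
proof -
  have "2 * t \<le> 2 * (A + 2 * (B + x))" using assms(3) by (rule mult_left_mono) simp
  also have "\<dots> = 2 * A + 4 * B + 4 * x" by (simp add: algebra_simps)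
  also have "4 * x \<le> 4 * y" using assms(1) by simp
  finally show ?thesis using assms(2) by simp
qed

text \<open>A relation in the first \<open>Suc k\<close> functions makes \<open>g k\<close>
  algebraic over its predecessors, with coefficients that do not all vanish by the induction
  hypothesis. Then the characteristic of \<open>g k\<close> is at most a constant plus a multiple of
  the earlier ones, which are negligible at suitable large radii, so it is bounded there.\<close>

lemma growth_chain_alg_indep:
  fixes g :: "nat \<Rightarrow> complex ^ 'm \<Rightarrow> complex"
  assumes g: "\<And>i. i < n \<Longrightarrow> hol_vec_on (g i) UNIV"
    and nc: "\<And>i. i < n \<Longrightarrow> \<not> (\<exists>c. \<forall>z. g i z = c)"
    and growth: "\<And>\<epsilon> R0. \<epsilon> > 0 \<Longrightarrow> \<exists>r\<ge>R0. \<forall>i. Suc i < n \<longrightarrow> characteristic (g i) r \<le> \<epsilon> * characteristic (g (Suc i)) r"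
  shows "k \<le> n \<Longrightarrow> mpoly_ok k c \<Longrightarrow> c \<noteq> (\<lambda>_. 0) \<Longrightarrow> \<exists>z. mpoly_eval k c (\<lambda>i. g i z) \<noteq> 0"
proof (induction k arbitrary: c)
  case 0
  have "\<alpha> = (\<lambda>_. 0)" if "c \<alpha> \<noteq> 0" for \<alpha>
  proof
    show "\<alpha> i = 0" for i using 0(2) that unfolding mpoly_ok_def by simp
  qed
  moreover obtain \<alpha> where "c \<alpha> \<noteq> 0" using 0(3) by blast
  ultimately have "{\<alpha>. c \<alpha> \<noteq> 0} = {\<lambda>_. 0}" "c (\<lambda>_. 0) \<noteq> 0" by blast+
  thus ?case by (simp add: mpoly_eval_def)
next
  case (Suc k)
  show ?case
  proof (rule ccontr)
    assume contra: "\<not> ?thesis"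
    obtain d where d: "\<And>\<alpha>. c \<alpha> \<noteq> 0 \<Longrightarrow> \<alpha> k \<le> d" "\<exists>j\<le>d. mpoly_slice c k j \<noteq> (\<lambda>_. 0)"
      using mpoly_slice_nonzero[OF Suc.prems(2,3)] by blast
    define A where "A = (\<lambda>j z. mpoly_eval k (mpoly_slice c k j) (\<lambda>i. g i z))"
    have k: "k < n" using Suc.prems(1) by simp
    have gk: "hol_vec_on (g i) UNIV" if "i < k" for i using that k by (intro g) simp
    have holA: "hol_vec_on (A j) UNIV" for j
      unfolding A_def by (intro hol_vec_on_mpoly_eval gk)
    have rel: "(\<Sum>j\<le>d. A j z * g k z ^ j) = 0" for z
    proof -
      have "mpoly_eval (Suc k) c (\<lambda>i. g i z) = (\<Sum>j\<le>d. A j z * g k z ^ j)"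
        unfolding A_def by (rule mpoly_eval_slice[OF Suc.prems(2)]) (rule d(1))
      thus ?thesis using contra by simp
    qed
    have nz: "\<exists>j\<le>d. \<exists>z. A j z \<noteq> 0"
    proof -
      obtain j where j: "j \<le> d" "mpoly_slice c k j \<noteq> (\<lambda>_. 0)" using d(2) by blast
      have "\<exists>z. A j z \<noteq> 0"
        unfolding A_def by (rule Suc.IH[OF less_imp_le[OF k] mpoly_ok_slice[OF Suc.prems(2)] j(2)])
      thus ?thesis using j(1) by blast
    qed
    have "\<exists>C. \<forall>r\<ge>1. characteristic (g k) r \<le> C + 2 * (\<Sum>j\<le>d. characteristic (A j) r)"
      by (rule characteristic_algebraic_le[where A = A, OF holA g[OF k] rel nz])
    then obtain C1 where C1: "\<And>r. r \<ge> 1 \<Longrightarrow> characteristic (g k) r \<le> C1 + 2 * (\<Sum>j\<le>d. characteristic (A j) r)"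
      by blast
    have "\<exists>C\<ge>0. \<exists>D\<ge>0. \<forall>r\<ge>0. (\<Sum>j\<le>d. characteristic (A j) r) \<le> C + D * (\<Sum>i<k. characteristic (g i) r)"
      unfolding A_def by (rule characteristic_slices_le[OF Suc.prems(2) gk])
    then obtain C2 D where CD: "C2 \<ge> 0" "D \<ge> 0"
      "\<And>r. r \<ge> 0 \<Longrightarrow> (\<Sum>j\<le>d. characteristic (A j) r) \<le> C2 + D * (\<Sum>i<k. characteristic (g i) r)"
      by blast
    \<comment> \<open>Chosen to make \<open>D * k * \<epsilon>\<close> at most \<open>1 / 4\<close>,
      as the absorption requires; the summand \<open>1\<close> keeps \<open>\<epsilon>\<close>
      defined and at most \<open>1\<close> even if \<open>D * k = 0\<close>.\<close>
    define \<epsilon> where "\<epsilon> = 1 / (4 * D * k + 1)"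
    have den: "4 * D * k + 1 \<ge> 1" using CD(2) by simp
    have \<epsilon>: "0 < \<epsilon>" "\<epsilon> \<le> 1" using den by (auto simp: \<epsilon>_def)
    have \<epsilon>D: "4 * D * k * \<epsilon> \<le> 1" using den by (simp add: \<epsilon>_def divide_le_eq)
    have "\<exists>c. \<forall>z. g k z = c"
    proof (rule bounded_characteristic_imp_constant[OF g[OF k]])
      fix R0 :: real
      obtain r where r: "r \<ge> max R0 1"
        "\<And>i. Suc i < n \<Longrightarrow> characteristic (g i) r \<le> \<epsilon> * characteristic (g (Suc i)) r"
        using growth[OF \<epsilon>(1), of "max R0 1"] by blast
      have ch: "characteristic (g i) r \<le> \<epsilon> * characteristic (g k) r" if "i < k" for i
        by (rule chain_le[where t = "\<lambda>i. characteristic (g i) r" and n = n,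
              OF \<epsilon> characteristic_nonneg r(2) that k])
      have "(\<Sum>i<k. characteristic (g i) r) \<le> (\<Sum>i<k. \<epsilon> * characteristic (g k) r)"
        by (intro sum_mono ch) simp
      hence "(\<Sum>i<k. characteristic (g i) r) \<le> k * (\<epsilon> * characteristic (g k) r)" by simp
      hence "D * (\<Sum>i<k. characteristic (g i) r) \<le> D * (k * (\<epsilon> * characteristic (g k) r))"
        using CD(2) by (intro mult_left_mono)
      moreover have "4 * (D * (k * (\<epsilon> * characteristic (g k) r))) \<le> characteristic (g k) r"
        using mult_right_mono[OF \<epsilon>D characteristic_nonneg[of "g k" r]] by (simp add: mult_ac)
      moreover have "characteristic (g k) r \<le> C1 + 2 * (C2 + D * (\<Sum>i<k. characteristic (g i) r))"
        using C1[of r] CD(3)[of r] r(1) by simp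
      ultimately have "characteristic (g k) r \<le> 2 * C1 + 4 * C2" by (rule absorb_quarter)
      thus "\<exists>r\<ge>R0. sphere_mean r (\<lambda>z. log_plus (norm (g k z))) \<le> 2 * C1 + 4 * C2"
        using r(1) unfolding characteristic_def by auto
    qed
    thus False using nc[OF k] by blast
  qed
qed

text \<open>The coefficients of a relation for \<open>F (g n')\<close> are polynomials in the
  \<open>g i\<close>, not all zero by the independence of these. Their characteristics grow at most
  like a fixed multiple of that of \<open>g n'\<close>, whereas
  \<open>characteristic_composition_le\<close> forces growth by any prescribed factor
  \<open>K\<close>.\<close>

lemma growth_chain_composition_alg_indep:
  fixes g :: "nat \<Rightarrow> complex ^ 'm \<Rightarrow> complex"
  assumes n: "n = Suc n'" and g: "\<And>i. i < n \<Longrightarrow> hol_vec_on (g i) UNIV"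
    and nc: "\<And>i. i < n \<Longrightarrow> \<not> (\<exists>c. \<forall>z. g i z = c)"
    and growth: "\<And>\<epsilon> R0. \<epsilon> > 0 \<Longrightarrow> \<exists>r\<ge>R0. \<forall>i. Suc i < n \<longrightarrow> characteristic (g i) r \<le> \<epsilon> * characteristic (g (Suc i)) r"
    and F: "transcendental_mero F" and R: "mpoly_ok (Suc n) R" "R \<noteq> (\<lambda>_. 0)"
  shows "\<exists>z. F analytic_on {g n' z} \<and> mpoly_eval (Suc n) R (\<lambda>i. if i < n then g i z else F (g n' z)) \<noteq> 0"
proof (rule ccontr)
  assume contra: "\<not> ?thesis"
  obtain d where d: "\<And>\<alpha>. R \<alpha> \<noteq> 0 \<Longrightarrow> \<alpha> n \<le> d" "\<exists>j\<le>d. mpoly_slice R n j \<noteq> (\<lambda>_. 0)"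
    using mpoly_slice_nonzero[OF R] by blast
  define A where "A = (\<lambda>j z. mpoly_eval n (mpoly_slice R n j) (\<lambda>i. g i z))"
  have holA: "hol_vec_on (A j) UNIV" for j
    unfolding A_def by (intro hol_vec_on_mpoly_eval g)
  have rel: "(\<Sum>j\<le>d. A j z * F (g n' z) ^ j) = 0" if "F analytic_on {g n' z}" for z
  proof -
    have "mpoly_eval n (mpoly_slice R n j) (\<lambda>i. if i < n then g i z else F (g n' z)) = A j z" for j
      unfolding A_def by (rule mpoly_eval_cong) simp
    hence "mpoly_eval (Suc n) R (\<lambda>i. if i < n then g i z else F (g n' z)) = (\<Sum>j\<le>d. A j z * F (g n' z) ^ j)"
      by (subst mpoly_eval_slice[where d = d, OF R(1)]) (simp_all add: d(1))
    thus ?thesis using contra that by auto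
  qed
  have nz: "\<exists>j\<le>d. \<exists>z. A j z \<noteq> 0"
  proof -
    obtain j where j: "j \<le> d" "mpoly_slice R n j \<noteq> (\<lambda>_. 0)" using d(2) by blast
    have "\<exists>z. A j z \<noteq> 0"
      unfolding A_def by (rule growth_chain_alg_indep[OF g nc growth order.refl mpoly_ok_slice[OF R(1)] j(2)])
    thus ?thesis using j(1) by blast
  qed
  have n': "n' < n" using n by simp
  have "\<exists>C\<ge>0. \<exists>D\<ge>0. \<forall>r\<ge>0. (\<Sum>j\<le>d. characteristic (A j) r) \<le> C + D * (\<Sum>i<n. characteristic (g i) r)"
    unfolding A_def by (rule characteristic_slices_le[OF R(1) g])
  then obtain C2 D where CD: "C2 \<ge> 0" "D \<ge> 0"
    "\<And>r. r \<ge> 0 \<Longrightarrow> (\<Sum>j\<le>d. characteristic (A j) r) \<le> C2 + D * (\<Sum>i<n. characteristic (g i) r)"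
    by blast
  \<comment> \<open>\<open>D\<close> is fixed by the relation before \<open>K\<close> is chosen; the
    excess of \<open>1\<close> over \<open>D * n\<close> leaves one full characteristic of
    \<open>g n'\<close> to be bounded.\<close>
  obtain K :: nat where K: "D * n + 1 < K" using reals_Archimedean2 by blast
  have "\<exists>C. \<forall>r\<ge>1. real K * characteristic (g n') r \<le> C + (\<Sum>j\<le>d. characteristic (A j) r)"
    by (rule characteristic_composition_le[where R = A, OF g[OF n'] F holA rel nz])
  then obtain C1 where C1: "\<And>r. r \<ge> 1 \<Longrightarrow> real K * characteristic (g n') r \<le> C1 + (\<Sum>j\<le>d. characteristic (A j) r)"
    by blast
  have "\<exists>c. \<forall>z. g n' z = c"
  proof (rule bounded_characteristic_imp_constant[OF g[OF n']])
    fix R0 :: real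
    \<comment> \<open>Here \<open>\<epsilon> = 1\<close> is enough: the earlier characteristics need
      only be dominated, because \<open>K\<close> supplies the gain.\<close>
    obtain r where r: "r \<ge> max R0 1"
      "\<And>i. Suc i < n \<Longrightarrow> characteristic (g i) r \<le> 1 * characteristic (g (Suc i)) r"
      using growth[OF zero_less_one, of "max R0 1"] by blast
    have ch: "characteristic (g i) r \<le> characteristic (g n') r" if "i < n" for i
    proof (cases "i = n'")
      case False
      hence "i < n'" using that n by simp
      thus ?thesis
        using chain_le[where t = "\<lambda>i. characteristic (g i) r" and n = n,
            OF zero_less_one order.refl characteristic_nonneg r(2) _ n'] by simp
    qed simp
    have "(\<Sum>i<n. characteristic (g i) r) \<le> (\<Sum>i<n. characteristic (g n') r)"
      by (intro sum_mono ch) simp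
    hence "(\<Sum>i<n. characteristic (g i) r) \<le> n * characteristic (g n') r" by simp
    hence "D * (\<Sum>i<n. characteristic (g i) r) \<le> D * (n * characteristic (g n') r)"
      using CD(2) by (intro mult_left_mono)
    moreover have "(D * n + 1) * characteristic (g n') r \<le> real K * characteristic (g n') r"
      using K by (intro mult_right_mono characteristic_nonneg) simp
    moreover have "real K * characteristic (g n') r \<le> C1 + (C2 + D * (\<Sum>i<n. characteristic (g i) r))"
      using C1[of r] CD(3)[of r] r(1) by simp
    moreover have "(D * n + 1) * characteristic (g n') r = D * (n * characteristic (g n') r) + characteristic (g n') r"
      by (simp add: algebra_simps)
    ultimately have "characteristic (g n') r \<le> C1 + C2" by linarith
    thus "\<exists>r\<ge>R0. sphere_mean r (\<lambda>z. log_plus (norm (g n' z))) \<le> C1 + C2"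
      using r(1) unfolding characteristic_def by auto
  qed
  thus False using nc[OF n'] by blast
qed

section \<open>Radii off the exceptional sets and points of common regularity\<close>

text \<open>Finitely many exceptional sets of finite measure have a union of finite measure, which
  cannot contain a ray. So beyond any bound there is a radius good for all consecutive pairs at
  once.\<close>

lemma small_outside_chain:
  fixes T :: "nat \<Rightarrow> real \<Rightarrow> real"
  assumes so: "\<And>i. Suc i < n \<Longrightarrow> small_outside (T i) (T (Suc i))" and \<epsilon>: "\<epsilon> > 0"
  shows "\<exists>r\<ge>R0. \<forall>i. Suc i < n \<longrightarrow> T i r \<le> \<epsilon> * T (Suc i) r"
proof -
  define I where "I = {i. Suc i < n}"
  have finI: "finite I" by (rule finite_subset[of _ "{..n}"]) (auto simp: I_def)
  have "\<forall>i\<in>I. \<exists>E. E \<in> sets lebesgue \<and> emeasure lebesgue E < \<infinity> \<and>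
     (\<forall>\<epsilon>>0. \<exists>R. \<forall>r\<ge>R. r \<notin> E \<longrightarrow> \<bar>T i r\<bar> \<le> \<epsilon> * T (Suc i) r)"
    using so unfolding small_outside_def I_def by blast
  from bchoice[OF this] obtain E where E: "\<And>i. i \<in> I \<Longrightarrow> E i \<in> sets lebesgue"
    "\<And>i. i \<in> I \<Longrightarrow> emeasure lebesgue (E i) < \<infinity>"
    "\<And>i \<epsilon>. i \<in> I \<Longrightarrow> \<epsilon> > 0 \<Longrightarrow> \<exists>R. \<forall>r\<ge>R. r \<notin> E i \<longrightarrow> \<bar>T i r\<bar> \<le> \<epsilon> * T (Suc i) r" by blast
  have "\<forall>i\<in>I. \<exists>R. \<forall>r\<ge>R. r \<notin> E i \<longrightarrow> \<bar>T i r\<bar> \<le> \<epsilon> * T (Suc i) r" using E(3) \<epsilon> by blast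
  from bchoice[OF this] obtain R where
    R: "\<And>i r. i \<in> I \<Longrightarrow> r \<ge> R i \<Longrightarrow> r \<notin> E i \<Longrightarrow> \<bar>T i r\<bar> \<le> \<epsilon> * T (Suc i) r" by blast
  define E' where "E' = (\<Union>i\<in>I. E i)"
  have E': "E' \<in> sets lebesgue" unfolding E'_def using finI E(1) by (intro sets.finite_UN) auto
  have "emeasure lebesgue E' \<le> (\<Sum>i\<in>I. emeasure lebesgue (E i))"
    unfolding E'_def using finI E(1) by (intro emeasure_subadditive_finite) auto
  also have "\<dots> < \<infinity>" using finI E(2) by (simp add: ennreal_sum_less_top)
  finally have fin: "emeasure lebesgue E' < \<infinity>" .
  define R1 where "R1 = max R0 (Max (insert 0 (R ` I)))"
  have R1: "R1 \<ge> R0" "\<And>i. i \<in> I \<Longrightarrow> R i \<le> R1"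
    using finI by (auto simp: R1_def intro: max.coboundedI2)
  have "\<not> {R1..} \<subseteq> E'"
  proof
    assume "{R1..} \<subseteq> E'"
    hence "emeasure lebesgue {R1..} \<le> emeasure lebesgue E'" by (intro emeasure_mono E')
    hence "emeasure lebesgue {R1..} < \<infinity>" using fin by (rule order.strict_trans1)
    moreover have "emeasure lebesgue {R1..} = \<infinity>"
    proof (rule ccontr)
      assume "emeasure lebesgue {R1..} \<noteq> \<infinity>"
      then obtain B where B: "B \<ge> 0" "emeasure lebesgue {R1..} = ennreal B"
        by (cases "emeasure lebesgue {R1..}" rule: ennreal_cases) auto
      have "emeasure lebesgue {R1..R1 + (B + 1)} \<le> emeasure lebesgue {R1..}"
        by (intro emeasure_mono) auto
      hence "ennreal (B + 1) \<le> ennreal B" using B by simp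
      thus False using B(1) by (simp add: ennreal_le_iff)
    qed
    ultimately show False by simp
  qed
  then obtain r where r: "r \<ge> R1" "r \<notin> E'" by auto
  have "T i r \<le> \<epsilon> * T (Suc i) r" if "Suc i < n" for i
  proof -
    have i: "i \<in> I" using that by (simp add: I_def)
    have "\<bar>T i r\<bar> \<le> \<epsilon> * T (Suc i) r"
      using r R1(2)[OF i] i unfolding E'_def by (intro R) auto
    thus ?thesis by simp
  qed
  thus ?thesis using r(1) R1(1) by (intro exI[of _ r]) auto
qed

lemma hol_at_Cm_compose:
  assumes g: "entire_Cm g" and F: "F analytic_on {g z}"
  shows "hol_at_Cm (\<lambda>z. F (g z)) z"
proof -
  obtain W where W: "open W" "g z \<in> W" "F holomorphic_on W"
    using F unfolding analytic_at by blast
  have cont: "continuous_on UNIV g"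
    by (rule hol_vec_on_imp_continuous_on[OF entire_Cm_imp_hol_vec_on[OF g]])
  have "open (g -` W)" using W(1) cont by (rule open_vimage)
  moreover have "\<exists>D. ((\<lambda>z. F (g z)) has_derivative D) (at w) \<and> (\<forall>c v. D (c *s v) = c * D v)" if w: "w \<in> g -` W" for w
  proof -
    obtain D where D: "(g has_derivative D) (at w)" "\<And>c v. D (c *s v) = c * D v"
      using g unfolding entire_Cm_def hol_at_Cm_def by blast
    have "(F has_field_derivative deriv F (g w)) (at (g w))"
      using holomorphic_derivI[OF W(3,1)] w by simp
    hence "(F has_derivative (\<lambda>h. deriv F (g w) * h)) (at (g w))"
      by (simp add: has_field_derivative_def)
    from has_derivative_compose[OF D(1) this]
    have "((\<lambda>z. F (g z)) has_derivative (\<lambda>v. deriv F (g w) * D v)) (at w)" .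
    moreover have "\<forall>c v. deriv F (g w) * D (c *s v) = c * (deriv F (g w) * D v)"
      by (simp add: D(2) mult_ac)
    ultimately show ?thesis by blast
  qed
  ultimately show ?thesis unfolding hol_at_Cm_def using W(2) by blast
qed

text \<open>The points where \<open>F\<close> is not analytic form a closed countable set. Each
  nonconstant \<open>g i\<close> in turn avoids it somewhere in the current open set, and by
  continuity on a smaller nonempty open set.\<close>

lemma dense_common_analytic:
  fixes g :: "nat \<Rightarrow> complex ^ 'm \<Rightarrow> complex"
  assumes F: "F meromorphic_on UNIV"
    and g: "\<And>i. i < n \<Longrightarrow> hol_vec_on (g i) UNIV" and nc: "\<And>i. i < n \<Longrightarrow> \<not> (\<exists>c. \<forall>z. g i z = c)"
    and U: "open U" "U \<noteq> {}"
  shows "\<exists>z\<in>U. \<forall>i<n. F analytic_on {g i z}"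
proof -
  define S where "S = {w. \<not> F analytic_on {w}}"
  have sp: "S sparse_in UNIV"
    using meromorphic_on_imp_analytic_cosparse[OF F] by (simp add: eventually_cosparse S_def)
  have S: "closed S" "countable S"
    using sparse_in_UNIV_imp_closed[OF sp] sparse_imp_countable[OF open_UNIV sp] by auto
  have "k \<le> n \<Longrightarrow> \<exists>U'. open U' \<and> U' \<noteq> {} \<and> U' \<subseteq> U \<and> (\<forall>i<k. \<forall>z\<in>U'. g i z \<notin> S)" for k
  proof (induction k)
    case 0
    show ?case using U by (intro exI[of _ U]) simp
  next
    case (Suc k)
    then obtain U' where U': "open U'" "U' \<noteq> {}" "U' \<subseteq> U" "\<forall>i<k. \<forall>z\<in>U'. g i z \<notin> S" by auto
    have k: "k < n" using Suc.prems by simp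
    define U'' where "U'' = U' \<inter> g k -` (- S)"
    have "open U''"
      unfolding U''_def using S(1) hol_vec_on_imp_continuous_on[OF g[OF k]]
      by (intro open_Int U'(1) open_vimage) auto
    moreover have "U'' \<noteq> {}"
      using hol_vec_on_avoid_countable[OF g[OF k] nc[OF k] U'(1,2) S(2)] unfolding U''_def by blast
    moreover have "\<forall>i<Suc k. \<forall>z\<in>U''. g i z \<notin> S"
      using U'(4) unfolding U''_def less_Suc_eq by blast
    ultimately show ?case using U'(3) unfolding U''_def by blast
  qed
  from this[OF order.refl] obtain U' where "U' \<noteq> {}" "U' \<subseteq> U" "\<forall>i<n. \<forall>z\<in>U'. g i z \<notin> S" by blast
  thus ?thesis unfolding S_def by blast
qed

lemma mpoly_ok_single: "(\<And>i. i \<ge> k \<Longrightarrow> \<beta> i = 0) \<Longrightarrow> mpoly_ok k (\<lambda>\<alpha>. if \<alpha> = \<beta> then 1 else 0)"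
  by (auto simp: mpoly_ok_def)

lemma mpoly_eval_single: "mpoly_eval k (\<lambda>\<alpha>. if \<alpha> = \<beta> then 1 else 0) x = (\<Prod>i<k. x i ^ \<beta> i)"
  by (simp add: mpoly_eval_def)

theorem mainTheorem1:
  fixes f :: "nat \<Rightarrow> complex ^ 'm \<Rightarrow> complex" and n :: nat and F :: "complex \<Rightarrow> complex"
  assumes "n \<ge> 1"
    and "\<And>i. i \<in> {1..n} \<Longrightarrow> entire_Cm (f i) \<and> \<not> (\<exists>c. \<forall>z. f i z = c)"
    and "\<And>i. i \<in> {1..n-1} \<Longrightarrow>
           small_outside (nev_T_entire (f i)) (nev_T_entire (f (Suc i)))"
    and "transcendental_mero F"
  shows "tr_deg (\<lambda>j. if j < n then f (Suc j) else (\<lambda>z. F (f (Suc (j - n)) z))) (2 * n)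
           \<ge> enat (n + 1)"
proof -
  obtain n' where n: "n = Suc n'" using assms(1) by (cases n) auto
  define g where "g = (\<lambda>i. f (Suc i))"
  have ent: "entire_Cm (g i)" and nc: "\<not> (\<exists>c. \<forall>z. g i z = c)" if "i < n" for i
    using assms(2)[of "Suc i"] that by (auto simp: g_def)
  have g: "hol_vec_on (g i) UNIV" if "i < n" for i
    by (rule entire_Cm_imp_hol_vec_on[OF ent[OF that]])
  have T: "nev_T_entire (g i) = characteristic (g i)" if "i < n" for i
    using nev_T_entire_eq_sphere_mean[OF hol_vec_on_imp_continuous_on[OF g[OF that]]]
    by (simp add: characteristic_def fun_eq_iff)
  have "small_outside (characteristic (g i)) (characteristic (g (Suc i)))" if "Suc i < n" for i
    using assms(3)[of "Suc i"] that T[of i] T[of "Suc i"] by (simp add: g_def)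
  from small_outside_chain[of n "\<lambda>i. characteristic (g i)", OF this]
  have growth: "\<exists>r\<ge>R0. \<forall>i. Suc i < n \<longrightarrow> characteristic (g i) r \<le> \<epsilon> * characteristic (g (Suc i)) r"
    if "\<epsilon> > 0" for \<epsilon> R0 using that by blast
  have mero: "F meromorphic_on UNIV" using assms(4) by (simp add: transcendental_mero_def)

  have dense: "\<exists>z\<in>U. \<forall>i<n. F analytic_on {g i z}" if "open U" "U \<noteq> {}" for U
    by (rule dense_common_analytic[OF mero _ _ that]) (use g nc in auto)
  define G where "G = (\<lambda>j. if j < n then f (Suc j) else (\<lambda>z. F (f (Suc (j - n)) z)))"
  have reg: "z \<in> reg_dom G (2 * n)" if z: "\<forall>i<n. F analytic_on {g i z}" for z
    unfolding reg_dom_def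
  proof (intro CollectI allI impI)
    fix j assume j: "j < 2 * n"
    show "hol_at_Cm (G j) z"
    proof (cases "j < n")
      case True
      thus ?thesis using ent[OF True] by (simp add: G_def g_def entire_Cm_def)
    next
      case False
      hence jn: "j - n < n" using j by simp
      have "hol_at_Cm (\<lambda>z. F (g (j - n) z)) z"
        by (rule hol_at_Cm_compose[OF ent[OF jn]]) (use z jn in blast)
      thus ?thesis using False by (simp add: G_def g_def)
    qed
  qed
  \<comment> \<open>The \<open>n + 1\<close> independent elements are the \<open>n\<close> given
    functions and \<open>F\<close> composed with the last of them, which has the last index
    \<open>2 * n - 1\<close>. Each is a single variable \<open>P l\<close> over the constant
    denominator \<open>Q l = 1\<close>.\<close>
  define ix where "ix = (\<lambda>l. if l < n then l else 2 * n - 1)"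
  have ix: "ix l < 2 * n" if "l < n + 1" for l using that n by (auto simp: ix_def)
  define \<beta> where "\<beta> = (\<lambda>l i. if i = ix l then 1 else 0 :: nat)"
  define P :: "nat \<Rightarrow> (nat \<Rightarrow> nat) \<Rightarrow> complex" where "P = (\<lambda>l \<alpha>. if \<alpha> = \<beta> l then 1 else 0)"
  define Q :: "nat \<Rightarrow> (nat \<Rightarrow> nat) \<Rightarrow> complex" where "Q = (\<lambda>l \<alpha>. if \<alpha> = (\<lambda>_. 0) then 1 else 0)"
  have evP: "mpoly_eval (2 * n) (P l) x = x (ix l)" if "l < n + 1" for l x
  proof -
    have "(\<Prod>i<2 * n. x i ^ \<beta> l i) = (\<Prod>i<2 * n. if i = ix l then x i else 1)"
      by (intro prod.cong refl) (simp add: \<beta>_def)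
    also have "\<dots> = x (ix l)" using ix[OF that] by simp
    finally show ?thesis unfolding P_def mpoly_eval_single .
  qed
  have evQ: "mpoly_eval (2 * n) (Q l) x = 1" for l x
    unfolding Q_def mpoly_eval_single by simp
  have okP: "mpoly_ok (2 * n) (P l)" if "l < n + 1" for l
    unfolding P_def using ix[OF that] by (intro mpoly_ok_single) (simp add: \<beta>_def)
  have okQ: "mpoly_ok (2 * n) (Q l)" for l
    unfolding Q_def by (intro mpoly_ok_single) simp
  have Gix: "G (ix l) z = (if l < n then g l z else F (g n' z))" if "l < n + 1" for l z
    using that n by (auto simp: G_def ix_def g_def)
  have "alg_indep_in_field G (2 * n) (n + 1) P Q"
    unfolding alg_indep_in_field_def
  proof (intro conjI allI impI)
    fix l assume l: "l < n + 1"
    show "mpoly_ok (2 * n) (P l)" "mpoly_ok (2 * n) (Q l)" using okP[OF l] okQ by auto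
    obtain z where "\<forall>i<n. F analytic_on {g i z}"
      using dense[OF open_UNIV] by blast
    thus "\<exists>z\<in>reg_dom G (2 * n). mpoly_eval (2 * n) (Q l) (\<lambda>j. G j z) \<noteq> 0"
      using reg evQ by (intro bexI[of _ z]) auto
  next
    fix R assume "mpoly_ok (n + 1) R \<and> R \<noteq> (\<lambda>_. 0)"
    hence R: "mpoly_ok (Suc n) R" "R \<noteq> (\<lambda>_. 0)" by auto
    \<comment> \<open>The nonvanishing point \<open>z0\<close> need not lie in
      \<open>reg_dom\<close>, as another composition may be singular there. But \<open>u\<close> is
      continuous near \<open>z0\<close>, so it is nonzero on an open set, and by
      \<open>dense\<close> this set contains a point regular for all generators.\<close>
    define u where "u = (\<lambda>z. mpoly_eval (Suc n) R (\<lambda>i. if i < n then g i z else F (g n' z)))"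
    obtain z0 where z0: "F analytic_on {g n' z0}" "u z0 \<noteq> 0"
      using growth_chain_composition_alg_indep[OF n g nc growth assms(4) R] unfolding u_def by blast
    obtain W where W: "open W" "g n' z0 \<in> W" "F holomorphic_on W"
      using z0(1) unfolding analytic_at by blast
    have n': "n' < n" using n by simp
    define U where "U = g n' -` W"
    have openU: "open U"
      unfolding U_def using W(1) hol_vec_on_imp_continuous_on[OF g[OF n']] by (rule open_vimage)
    have holg: "hol_vec_on (g i) U" if "i < n" for i
      by (rule hol_vec_on_subset[OF g[OF that]]) simp
    have "hol_vec_on (\<lambda>z. F (g n' z)) U"
      by (rule hol_vec_on_compose[OF holg[OF n'] W(3)]) (auto simp: U_def)
    hence "hol_vec_on (\<lambda>z. if i < n then g i z else F (g n' z)) U" for i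
      using holg by (cases "i < n") simp_all
    hence "hol_vec_on u U" unfolding u_def by (intro hol_vec_on_mpoly_eval)
    hence "continuous_on U u" by (rule hol_vec_on_imp_continuous_on)
    hence "open (U \<inter> u -` (- {0}))"
      using openU by (intro continuous_open_preimage) auto
    moreover have "z0 \<in> U \<inter> u -` (- {0})" using W(2) z0(2) by (simp add: U_def)
    ultimately obtain z where z: "u z \<noteq> 0" "\<forall>i<n. F analytic_on {g i z}"
      using dense[of "U \<inter> u -` (- {0})"] by blast
    have "mpoly_eval (n + 1) R (\<lambda>l. mpoly_eval (2 * n) (P l) (\<lambda>j. G j z) / mpoly_eval (2 * n) (Q l) (\<lambda>j. G j z)) = u z"
      unfolding u_def Suc_eq_plus1 by (rule mpoly_eval_cong) (simp add: evP evQ Gix)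
    thus "\<exists>z\<in>reg_dom G (2 * n). (\<forall>l<n + 1. mpoly_eval (2 * n) (Q l) (\<lambda>j. G j z) \<noteq> 0) \<and>
       mpoly_eval (n + 1) R (\<lambda>l. mpoly_eval (2 * n) (P l) (\<lambda>j. G j z) / mpoly_eval (2 * n) (Q l) (\<lambda>j. G j z)) \<noteq> 0"
      using z(1) reg[OF z(2)] by (intro bexI[of _ z]) (simp_all add: evQ)
  qed
  hence "enat (n + 1) \<le> tr_deg G (2 * n)"
    unfolding tr_deg_def by (intro Sup_upper) blast
  thus ?thesis by (simp add: G_def)
qed

end
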